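(* Let $A$ be a finite dimensional $\Omega$-algebra over a field $F$, let $A^*$ be the dual $\Omega^*$-algebra, and let $V\subseteq\mathrm{End}_F(A^* )$ be a unital subalgebra. Then there is a bialgebra isomorphism $$\mathcal{B}^\square(A^*,V)\cong\mathcal{B}^\square(A,V^{\#})^{\mathrm{cop}},$$ where $V^{\#}:=\{f^*\mid f\in V\}\subseteq\mathrm{End}_F(A)$.
   Context: $F$ is a fixed field; everything is over $F$; coalgebras are coassociative and counital. $B^{\mathrm{cop}}$ denotes the bialgebra with opposite comultiplication. $\Omega$ is a fixed set with two maps $s,t\colon\Omega\to\mathbb{Z}_+$. An $\Omega$-algebra is a vector space $A$ with a linear map $\omega_A\colon A^{\otimes s(\omega)}\to A^{\otimes t(\omega)}$ for every $\omega\in\Omega$, where $A^{\otimes 0}:=F$. $\Omega^*=\{\omega^*\mid\omega\in\Omega\}$ is the set with $s^*(\omega^* )=t(\omega)$, $t^*(\omega^* )=s(\omega)$; for a finite dimensional $\Omega$-algebra $A$, $A^*$ is an $\Omega^*$-algebra whose operations are the dual maps of the $\omega_A$ (identifying $(A^{\otimes n})^*=(A^* )^{\otimes n}$). For $f\in\mathrm{End}_F(A^* )$, $f^*\in\mathrm{End}_F(A^{**})=\mathrm{End}_F(A)$ is the dual operator. For an $\Omega$-algebra $A$ (similarly for $\Omega^*$-algebras), a unital associative algebra $Q$ and linear $\rho\colon A\to A\otimes Q$, $\rho(a)=a_{(0)}\otimes a_{(1)}$, put $\rho_0(\alpha)=\alpha1_Q$, $\rho_n(a_1\otimes\dots\otimes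 a_n)=(a_1)_{(0)}\otimes\dots\otimes(a_n)_{(0)}\otimes(a_1)_{(1)}\cdots(a_n)_{(1)}$ for $n>0$; $\rho$ is a comeasuring if $\rho_{t(\omega)}(\omega_A(x))=(\omega_A\otimes\mathrm{id}_Q)\rho_{s(\omega)}(x)$ for all $\omega,x$. $\mathrm{cosupp}\,\rho\subseteq\mathrm{End}_F(A)$ is the set of all maps $a\mapsto q^*(a_{(1)})a_{(0)}$, $q^*\in Q^*$. A coaction of a bialgebra $B$ on $A$ is a counital right comodule structure $A\to A\otimes B$ that is a comeasuring. For $A$ finite dimensional and a unital subalgebra $V\subseteq\mathrm{End}_F(A)$, the $V$-universal coacting bialgebra $(\mathcal{B}^\square(A,V),\rho_{A,V})$ is the initial object in the category of comeasurings $\rho\colon A\to A\otimes Q$ with $\mathrm{cosupp}\,\rho\subseteq V$ ($Q$ a unital associative algebra; morphisms are unital algebra maps $\varphi$ with $(\mathrm{id}_A\otimes\varphi)\rho_1=\rho_2$), with the unique bialgebra structure making $\rho_{A,V}$ a coaction; it exists and is also initial among coactions of bialgebras on $A$ with cosupport in $V$ (morphisms being bialgebra maps). *)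

theory Defs
  imports "HOL-Algebra.Subrings" "Jordan_Normal_Form.Missing_VectorSpace"
begin

text \<open>
  Vector spaces over a field \<open>F\<close> are HOL-Algebra module records. Linear maps that are compared
  with each other (functionals, endomorphisms, algebra maps) are normalised to be
  \<^const>\<open>undefined\<close> outside their domain, so that equality of HOL functions is equality of maps.
\<close>

definition lin ::
  "('f, 'm) ring_scheme \<Rightarrow> ('f, 'a, 'n) module_scheme \<Rightarrow> ('f, 'b, 'k) module_scheme \<Rightarrow> ('a \<Rightarrow> 'b) set"
  where "lin F V W = LinearCombinations.module_hom F V W \<inter> extensional (carrier V)"

definition ground :: "('f, 'm) ring_scheme \<Rightarrow> ('f, 'f) module"
  where "ground F = \<lparr>carrier = carrier F, mult = mult F, one = one F, zero = zero F,
    add = add F, smult = mult F\<rparr>"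

definition dual :: "('f, 'm) ring_scheme \<Rightarrow> ('f, 'a, 'n) module_scheme \<Rightarrow> ('f, 'a \<Rightarrow> 'f) module"
  where "dual F V =
    (LinearCombinations.ring.func_space F (carrier V)) \<lparr>carrier := lin F V (ground F)\<rparr>"

definition dual_map ::
  "('f, 'm) ring_scheme \<Rightarrow> ('f, 'a, 'n) module_scheme \<Rightarrow> ('f, 'b, 'k) module_scheme
    \<Rightarrow> ('a \<Rightarrow> 'b) \<Rightarrow> ('b \<Rightarrow> 'f) \<Rightarrow> ('a \<Rightarrow> 'f)"
  where "dual_map F V W f = (\<lambda>\<phi>\<in>carrier (dual F W). compose (carrier V) \<phi> f)"

definition eval_bidual ::
  "('f, 'm) ring_scheme \<Rightarrow> ('f, 'a, 'n) module_scheme \<Rightarrow> 'a \<Rightarrow> ('a \<Rightarrow> 'f) \<Rightarrow> 'f"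
  where "eval_bidual F V = (\<lambda>v\<in>carrier V. \<lambda>\<phi>\<in>carrier (dual F V). \<phi> v)"


section \<open>Tensor products\<close>

definition free_space :: "('f, 'm) ring_scheme \<Rightarrow> 'x set \<Rightarrow> ('f, 'x \<Rightarrow> 'f) module"
  where "free_space F X = (LinearCombinations.ring.func_space F X)
    \<lparr>carrier := {f \<in> X \<rightarrow>\<^sub>E carrier F. finite {x \<in> X. f x \<noteq> \<zero>\<^bsub>F\<^esub>}}\<rparr>"

definition free_gen :: "('f, 'm) ring_scheme \<Rightarrow> 'x set \<Rightarrow> 'x \<Rightarrow> 'x \<Rightarrow> 'f"
  where "free_gen F X x = (\<lambda>y\<in>X. if y = x then \<one>\<^bsub>F\<^esub> else \<zero>\<^bsub>F\<^esub>)"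

text \<open>The fields \<open>mult\<close> and \<open>one\<close> of a module record play no role for a bare vector space.\<close>

definition quot_space :: "('f, 'a, 'n) module_scheme \<Rightarrow> 'a set \<Rightarrow> ('f, 'a set) module"
  where "quot_space M N = \<lparr>carrier = a_rcosets\<^bsub>M\<^esub> N, mult = undefined, one = undefined,
    zero = N, add = set_add M, smult = (\<lambda>c X. \<Union>x\<in>X. N +>\<^bsub>M\<^esub> (c \<odot>\<^bsub>M\<^esub> x))\<rparr>"

definition rel_span :: "('f, 'm) ring_scheme \<Rightarrow> 'x set \<Rightarrow> ('x \<Rightarrow> 'f) set \<Rightarrow> ('x \<Rightarrow> 'f) set"
  where "rel_span F X R = LinearCombinations.module.span F (free_space F X) R"

definition presented ::
  "('f, 'm) ring_scheme \<Rightarrow> 'x set \<Rightarrow> ('x \<Rightarrow> 'f) set \<Rightarrow> ('f, ('x \<Rightarrow> 'f) set) module"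
  where "presented F X R = quot_space (free_space F X) (rel_span F X R)"

definition presented_gen ::
  "('f, 'm) ring_scheme \<Rightarrow> 'x set \<Rightarrow> ('x \<Rightarrow> 'f) set \<Rightarrow> 'x \<Rightarrow> ('x \<Rightarrow> 'f) set"
  where "presented_gen F X R x = rel_span F X R +>\<^bsub>free_space F X\<^esub> free_gen F X x"

text \<open>The linear map determined by its values \<open>g\<close> on the generators; it exists whenever \<open>g\<close>
  respects the relations, and it is then unique.\<close>

definition presented_lift ::
  "('f, 'm) ring_scheme \<Rightarrow> 'x set \<Rightarrow> ('x \<Rightarrow> 'f) set \<Rightarrow> ('f, 'b, 'k) module_scheme
    \<Rightarrow> ('x \<Rightarrow> 'b) \<Rightarrow> ('x \<Rightarrow> 'f) set \<Rightarrow> 'b"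
  where "presented_lift F X R U g =
    (THE h. h \<in> lin F (presented F X R) U \<and> (\<forall>x\<in>X. h (presented_gen F X R x) = g x))"

type_synonym ('f, 'a, 'b) tensor_elem = "('a \<times> 'b \<Rightarrow> 'f) set"
type_synonym ('f, 'a) tpower_elem = "('a list \<Rightarrow> 'f) set"

definition tensor_rels ::
  "('f, 'm) ring_scheme \<Rightarrow> ('f, 'a, 'n) module_scheme \<Rightarrow> ('f, 'b, 'k) module_scheme
    \<Rightarrow> ('a \<times> 'b \<Rightarrow> 'f) set"
  where "tensor_rels F V W =
    (let X = carrier V \<times> carrier W; L = free_space F X; g = free_gen F X in
      {g (v \<oplus>\<^bsub>V\<^esub> v', w) \<ominus>\<^bsub>L\<^esub> (g (v, w) \<oplus>\<^bsub>L\<^esub> g (v', w)) | v v' w.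
         v \<in> carrier V \<and> v' \<in> carrier V \<and> w \<in> carrier W} \<union>
      {g (v, w \<oplus>\<^bsub>W\<^esub> w') \<ominus>\<^bsub>L\<^esub> (g (v, w) \<oplus>\<^bsub>L\<^esub> g (v, w')) | v w w'.
         v \<in> carrier V \<and> w \<in> carrier W \<and> w' \<in> carrier W} \<union>
      {g (c \<odot>\<^bsub>V\<^esub> v, w) \<ominus>\<^bsub>L\<^esub> c \<odot>\<^bsub>L\<^esub> g (v, w) | c v w.
         c \<in> carrier F \<and> v \<in> carrier V \<and> w \<in> carrier W} \<union>
      {g (v, c \<odot>\<^bsub>W\<^esub> w) \<ominus>\<^bsub>L\<^esub> c \<odot>\<^bsub>L\<^esub> g (v, w) | c v w.
         c \<in> carrier F \<and> v \<in> carrier V \<and> w \<in> carrier W})"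

definition tensor ::
  "('f, 'm) ring_scheme \<Rightarrow> ('f, 'a, 'n) module_scheme \<Rightarrow> ('f, 'b, 'k) module_scheme
    \<Rightarrow> ('f, ('f, 'a, 'b) tensor_elem) module"
  where "tensor F V W = presented F (carrier V \<times> carrier W) (tensor_rels F V W)"

definition pure_tensor ::
  "('f, 'm) ring_scheme \<Rightarrow> ('f, 'a, 'n) module_scheme \<Rightarrow> ('f, 'b, 'k) module_scheme
    \<Rightarrow> 'a \<Rightarrow> 'b \<Rightarrow> ('f, 'a, 'b) tensor_elem"
  where "pure_tensor F V W v w =
    presented_gen F (carrier V \<times> carrier W) (tensor_rels F V W) (v, w)"

definition tensor_lift ::
  "('f, 'm) ring_scheme \<Rightarrow> ('f, 'a, 'n) module_scheme \<Rightarrow> ('f, 'b, 'k) module_scheme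
    \<Rightarrow> ('f, 'c, 'l) module_scheme \<Rightarrow> ('a \<Rightarrow> 'b \<Rightarrow> 'c) \<Rightarrow> ('f, 'a, 'b) tensor_elem \<Rightarrow> 'c"
  where "tensor_lift F V W U \<beta> =
    presented_lift F (carrier V \<times> carrier W) (tensor_rels F V W) U (case_prod \<beta>)"

definition tensor_map ::
  "('f, 'm) ring_scheme \<Rightarrow> ('f, 'a, 'n) module_scheme \<Rightarrow> ('f, 'b, 'k) module_scheme
    \<Rightarrow> ('f, 'c, 'n1) module_scheme \<Rightarrow> ('f, 'd, 'k1) module_scheme
    \<Rightarrow> ('a \<Rightarrow> 'c) \<Rightarrow> ('b \<Rightarrow> 'd) \<Rightarrow> ('f, 'a, 'b) tensor_elem \<Rightarrow> ('f, 'c, 'd) tensor_elem"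
  where "tensor_map F V W V' W' f g =
    tensor_lift F V W (tensor F V' W') (\<lambda>v w. pure_tensor F V' W' (f v) (g w))"

definition tensor_assoc ::
  "('f, 'm) ring_scheme \<Rightarrow> ('f, 'a, 'n) module_scheme \<Rightarrow> ('f, 'b, 'k) module_scheme
    \<Rightarrow> ('f, 'c, 'l) module_scheme
    \<Rightarrow> ('f, ('f, 'a, 'b) tensor_elem, 'c) tensor_elem \<Rightarrow> ('f, 'a, ('f, 'b, 'c) tensor_elem) tensor_elem"
  where "tensor_assoc F U V W =
    (let T = tensor F U (tensor F V W) in
      tensor_lift F (tensor F U V) W T (\<lambda>x w.
        tensor_lift F U V T (\<lambda>u v. pure_tensor F U (tensor F V W) u (pure_tensor F V W v w)) x))"

definition tensor_flip ::
  "('f, 'm) ring_scheme \<Rightarrow> ('f, 'a, 'n) module_scheme \<Rightarrow> ('f, 'b, 'k) module_scheme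
    \<Rightarrow> ('f, 'a, 'b) tensor_elem \<Rightarrow> ('f, 'b, 'a) tensor_elem"
  where "tensor_flip F V W =
    tensor_lift F V W (tensor F W V) (\<lambda>v w. pure_tensor F W V w v)"

text \<open>Tensor powers. For \<open>n = 0\<close> there are no relations and the only generator is the empty word,
  so \<open>tpower F A 0\<close> is the ground field with the empty word as \<open>1\<close>.\<close>

definition words :: "('f, 'a, 'n) module_scheme \<Rightarrow> nat \<Rightarrow> 'a list set"
  where "words A n = {xs \<in> lists (carrier A). length xs = n}"

definition tpower_rels ::
  "('f, 'm) ring_scheme \<Rightarrow> ('f, 'a, 'n) module_scheme \<Rightarrow> nat \<Rightarrow> ('a list \<Rightarrow> 'f) set"
  where "tpower_rels F A n =
    (let X = words A n; L = free_space F X; g = free_gen F X in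
      {g (xs @ (a \<oplus>\<^bsub>A\<^esub> b) # ys) \<ominus>\<^bsub>L\<^esub> (g (xs @ a # ys) \<oplus>\<^bsub>L\<^esub> g (xs @ b # ys)) | xs a b ys.
         xs @ a # ys \<in> X \<and> xs @ b # ys \<in> X} \<union>
      {g (xs @ (c \<odot>\<^bsub>A\<^esub> a) # ys) \<ominus>\<^bsub>L\<^esub> c \<odot>\<^bsub>L\<^esub> g (xs @ a # ys) | xs c a ys.
         c \<in> carrier F \<and> xs @ a # ys \<in> X})"

definition tpower ::
  "('f, 'm) ring_scheme \<Rightarrow> ('f, 'a, 'n) module_scheme \<Rightarrow> nat \<Rightarrow> ('f, ('f, 'a) tpower_elem) module"
  where "tpower F A n = presented F (words A n) (tpower_rels F A n)"

definition pure_word ::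
  "('f, 'm) ring_scheme \<Rightarrow> ('f, 'a, 'n) module_scheme \<Rightarrow> 'a list \<Rightarrow> ('f, 'a) tpower_elem"
  where "pure_word F A xs =
    presented_gen F (words A (length xs)) (tpower_rels F A (length xs)) xs"

definition tpower_lift ::
  "('f, 'm) ring_scheme \<Rightarrow> ('f, 'a, 'n) module_scheme \<Rightarrow> nat \<Rightarrow> ('f, 'b, 'k) module_scheme
    \<Rightarrow> ('a list \<Rightarrow> 'b) \<Rightarrow> ('f, 'a) tpower_elem \<Rightarrow> 'b"
  where "tpower_lift F A n U \<mu> = presented_lift F (words A n) (tpower_rels F A n) U \<mu>"


section \<open>Algebras and bialgebras\<close>

locale unital_algebra = vectorspace F Q + Q?: ring Q
  for F :: "('f, 'm) ring_scheme" and Q :: "('f, 'q, 'n) module_scheme" (structure) +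
  assumes smult_mult_left:
      "\<lbrakk>c \<in> carrier F; x \<in> carrier Q; y \<in> carrier Q\<rbrakk> \<Longrightarrow> (c \<odot> x) \<otimes> y = c \<odot> (x \<otimes> y)"
    and smult_mult_right:
      "\<lbrakk>c \<in> carrier F; x \<in> carrier Q; y \<in> carrier Q\<rbrakk> \<Longrightarrow> x \<otimes> (c \<odot> y) = c \<odot> (x \<otimes> y)"

definition algebra_hom ::
  "('f, 'm) ring_scheme \<Rightarrow> ('f, 'p, 'n) module_scheme \<Rightarrow> ('f, 'q, 'k) module_scheme \<Rightarrow> ('p \<Rightarrow> 'q) set"
  where "algebra_hom F P Q = lin F P Q \<inter> ring_hom P Q"

definition End_algebra ::
  "('f, 'm) ring_scheme \<Rightarrow> ('f, 'a, 'n) module_scheme \<Rightarrow> ('f, 'a \<Rightarrow> 'a) module"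
  where "End_algebra F A = \<lparr>carrier = lin F A A, mult = compose (carrier A),
    one = (\<lambda>a\<in>carrier A. a), zero = (\<lambda>a\<in>carrier A. \<zero>\<^bsub>A\<^esub>),
    add = (\<lambda>f g. \<lambda>a\<in>carrier A. f a \<oplus>\<^bsub>A\<^esub> g a), smult = (\<lambda>c f. \<lambda>a\<in>carrier A. c \<odot>\<^bsub>A\<^esub> f a)\<rparr>"

definition unital_subalgebra ::
  "('f, 'm) ring_scheme \<Rightarrow> 'q set \<Rightarrow> ('f, 'q, 'n) module_scheme \<Rightarrow> bool"
  where "unital_subalgebra F S Q \<longleftrightarrow> VectorSpace.subspace F S Q \<and> subring S Q"

definition tensor_algebra ::
  "('f, 'm) ring_scheme \<Rightarrow> ('f, 'p, 'n) module_scheme \<Rightarrow> ('f, 'q, 'k) module_scheme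
    \<Rightarrow> ('f, ('f, 'p, 'q) tensor_elem) module"
  where "tensor_algebra F P Q = (tensor F P Q)
    \<lparr>mult := (\<lambda>x y. tensor_lift F P Q (tensor F P Q) (\<lambda>a b.
                tensor_lift F P Q (tensor F P Q) (\<lambda>c d.
                  pure_tensor F P Q (a \<otimes>\<^bsub>P\<^esub> c) (b \<otimes>\<^bsub>Q\<^esub> d)) y) x),
     one := pure_tensor F P Q \<one>\<^bsub>P\<^esub> \<one>\<^bsub>Q\<^esub>\<rparr>"

record ('f, 'b) bialgebra = "('f, 'b) module" +
  comult :: "'b \<Rightarrow> ('f, 'b, 'b) tensor_elem"
  counit :: "'b \<Rightarrow> 'f"

definition is_bialgebra :: "('f, 'm) ring_scheme \<Rightarrow> ('f, 'b, 'n) bialgebra_scheme \<Rightarrow> bool"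
  where "is_bialgebra F B \<longleftrightarrow>
    unital_algebra F B \<and>
    comult B \<in> LinearCombinations.module_hom F B (tensor F B B) \<and>
    counit B \<in> LinearCombinations.module_hom F B (ground F) \<and>
    (\<forall>b\<in>carrier B.
      tensor_assoc F B B B (tensor_map F B B (tensor F B B) B (comult B) (\<lambda>x. x) (comult B b)) =
      tensor_map F B B B (tensor F B B) (\<lambda>x. x) (comult B) (comult B b)) \<and>
    (\<forall>b\<in>carrier B.
      tensor_lift F B B B (\<lambda>x y. counit B x \<odot>\<^bsub>B\<^esub> y) (comult B b) = b \<and>
      tensor_lift F B B B (\<lambda>x y. counit B y \<odot>\<^bsub>B\<^esub> x) (comult B b) = b) \<and>
    comult B \<in> ring_hom B (tensor_algebra F B B) \<and>
    counit B \<in> ring_hom B F"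

definition cop ::
  "('f, 'm) ring_scheme \<Rightarrow> ('f, 'b, 'n) bialgebra_scheme \<Rightarrow> ('f, 'b, 'n) bialgebra_scheme"
  where "cop F B = B \<lparr>comult := (\<lambda>b. tensor_flip F B B (comult B b))\<rparr>"

definition bialgebra_iso ::
  "('f, 'm) ring_scheme \<Rightarrow> ('f, 'b, 'n) bialgebra_scheme \<Rightarrow> ('f, 'c, 'k) bialgebra_scheme
    \<Rightarrow> ('b \<Rightarrow> 'c) set"
  where "bialgebra_iso F B C = {\<phi> \<in> algebra_hom F B C.
    bij_betw \<phi> (carrier B) (carrier C) \<and>
    (\<forall>b\<in>carrier B. comult C (\<phi> b) = tensor_map F B B C C \<phi> \<phi> (comult B b)) \<and>
    (\<forall>b\<in>carrier B. counit C (\<phi> b) = counit B b)}"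


section \<open>Omega-algebras, comeasurings and coactions\<close>

definition omega_algebra ::
  "('f, 'm) ring_scheme \<Rightarrow> 'w set \<Rightarrow> ('w \<Rightarrow> nat) \<Rightarrow> ('w \<Rightarrow> nat) \<Rightarrow> ('f, 'a, 'n) module_scheme
    \<Rightarrow> ('w \<Rightarrow> ('f, 'a) tpower_elem \<Rightarrow> ('f, 'a) tpower_elem) \<Rightarrow> bool"
  where "omega_algebra F \<Omega> s t A ops \<longleftrightarrow> vectorspace F A \<and>
    (\<forall>w\<in>\<Omega>. ops w \<in> LinearCombinations.module_hom F (tpower F A (s w)) (tpower F A (t w)))"

text \<open>The canonical map from the \<open>n\<close>-th tensor power of the dual to the dual of the \<open>n\<close>-th tensor
  power, \<open>f\<^sub>1 \<otimes> \<dots> \<otimes> f\<^sub>n \<mapsto> (a\<^sub>1 \<otimes> \<dots> \<otimes> a\<^sub>n \<mapsto> f\<^sub>1(a\<^sub>1) \<dots> f\<^sub>n(a\<^sub>n))\<close>; bijective for finite dimensional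
  \<open>A\<close>.\<close>

definition tpower_dual ::
  "('f, 'm) ring_scheme \<Rightarrow> ('f, 'a, 'n) module_scheme \<Rightarrow> nat
    \<Rightarrow> ('f, 'a \<Rightarrow> 'f) tpower_elem \<Rightarrow> ('f, 'a) tpower_elem \<Rightarrow> 'f"
  where "tpower_dual F A n = tpower_lift F (dual F A) n (dual F (tpower F A n)) (\<lambda>fs.
    tpower_lift F A n (ground F) (\<lambda>as. foldr (\<lambda>(f, a) r. f a \<otimes>\<^bsub>F\<^esub> r) (zip fs as) \<one>\<^bsub>F\<^esub>))"

text \<open>The operations of the dual of an \<open>\<Omega>\<close>-algebra. The symbols \<open>\<omega>\<^sup>*\<close> are named by \<open>\<omega>\<close> itself, so the
  dual is an algebra for the same index set with the two arity functions interchanged.\<close>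

definition dual_ops ::
  "('f, 'm) ring_scheme \<Rightarrow> ('w \<Rightarrow> nat) \<Rightarrow> ('w \<Rightarrow> nat) \<Rightarrow> ('f, 'a, 'n) module_scheme
    \<Rightarrow> ('w \<Rightarrow> ('f, 'a) tpower_elem \<Rightarrow> ('f, 'a) tpower_elem)
    \<Rightarrow> 'w \<Rightarrow> ('f, 'a \<Rightarrow> 'f) tpower_elem \<Rightarrow> ('f, 'a \<Rightarrow> 'f) tpower_elem"
  where "dual_ops F s t A ops w = (\<lambda>\<xi>\<in>carrier (tpower F (dual F A) (t w)).
    inv_into (carrier (tpower F (dual F A) (s w))) (tpower_dual F A (s w))
      (dual_map F (tpower F A (s w)) (tpower F A (t w)) (ops w) (tpower_dual F A (t w) \<xi>)))"

text \<open>\<open>rho_join F A Q n\<close> is the bilinear map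
  \<open>(a \<otimes> q, (a\<^sub>1 \<otimes> \<dots> \<otimes> a\<^sub>n) \<otimes> q') \<mapsto> (a \<otimes> a\<^sub>1 \<otimes> \<dots> \<otimes> a\<^sub>n) \<otimes> q q'\<close>,
  and \<open>rho_word F A Q \<rho> [a\<^sub>1, \<dots>, a\<^sub>n]\<close> is the value of \<open>\<rho>\<^sub>n\<close> on \<open>a\<^sub>1 \<otimes> \<dots> \<otimes> a\<^sub>n\<close>.\<close>

definition rho_join ::
  "('f, 'm) ring_scheme \<Rightarrow> ('f, 'a, 'n) module_scheme \<Rightarrow> ('f, 'q, 'k) module_scheme \<Rightarrow> nat
    \<Rightarrow> ('f, 'a, 'q) tensor_elem \<Rightarrow> ('f, ('f, 'a) tpower_elem, 'q) tensor_elem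
    \<Rightarrow> ('f, ('f, 'a) tpower_elem, 'q) tensor_elem"
  where "rho_join F A Q n z y =
    (let T = tensor F (tpower F A (Suc n)) Q in
      tensor_lift F A Q T (\<lambda>a q.
        tensor_lift F (tpower F A n) Q T (\<lambda>x q'.
          pure_tensor F (tpower F A (Suc n)) Q
            (tpower_lift F A n (tpower F A (Suc n)) (\<lambda>as. pure_word F A (a # as)) x)
            (q \<otimes>\<^bsub>Q\<^esub> q')) y) z)"

fun rho_word ::
  "('f, 'm) ring_scheme \<Rightarrow> ('f, 'a, 'n) module_scheme \<Rightarrow> ('f, 'q, 'k) module_scheme
    \<Rightarrow> ('a \<Rightarrow> ('f, 'a, 'q) tensor_elem) \<Rightarrow> 'a list \<Rightarrow> ('f, ('f, 'a) tpower_elem, 'q) tensor_elem"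
  where
    "rho_word F A Q \<rho> [] = pure_tensor F (tpower F A 0) Q (pure_word F A []) \<one>\<^bsub>Q\<^esub>"
  | "rho_word F A Q \<rho> (a # as) = rho_join F A Q (length as) (\<rho> a) (rho_word F A Q \<rho> as)"

definition rho_power ::
  "('f, 'm) ring_scheme \<Rightarrow> ('f, 'a, 'n) module_scheme \<Rightarrow> ('f, 'q, 'k) module_scheme
    \<Rightarrow> ('a \<Rightarrow> ('f, 'a, 'q) tensor_elem) \<Rightarrow> nat
    \<Rightarrow> ('f, 'a) tpower_elem \<Rightarrow> ('f, ('f, 'a) tpower_elem, 'q) tensor_elem"
  where "rho_power F A Q \<rho> n = tpower_lift F A n (tensor F (tpower F A n) Q) (rho_word F A Q \<rho>)"

definition comeasuring ::
  "('f, 'm) ring_scheme \<Rightarrow> 'w set \<Rightarrow> ('w \<Rightarrow> nat) \<Rightarrow> ('w \<Rightarrow> nat) \<Rightarrow> ('f, 'a, 'n) module_scheme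
    \<Rightarrow> ('w \<Rightarrow> ('f, 'a) tpower_elem \<Rightarrow> ('f, 'a) tpower_elem)
    \<Rightarrow> ('f, 'q, 'k) module_scheme \<Rightarrow> ('a \<Rightarrow> ('f, 'a, 'q) tensor_elem) \<Rightarrow> bool"
  where "comeasuring F \<Omega> s t A ops Q \<rho> \<longleftrightarrow>
    unital_algebra F Q \<and> \<rho> \<in> LinearCombinations.module_hom F A (tensor F A Q) \<and>
    (\<forall>w\<in>\<Omega>. \<forall>x\<in>carrier (tpower F A (s w)).
      rho_power F A Q \<rho> (t w) (ops w x) =
      tensor_map F (tpower F A (s w)) Q (tpower F A (t w)) Q (ops w) (\<lambda>q. q)
        (rho_power F A Q \<rho> (s w) x))"

definition cosupp ::
  "('f, 'm) ring_scheme \<Rightarrow> ('f, 'a, 'n) module_scheme \<Rightarrow> ('f, 'q, 'k) module_scheme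
    \<Rightarrow> ('a \<Rightarrow> ('f, 'a, 'q) tensor_elem) \<Rightarrow> ('a \<Rightarrow> 'a) set"
  where "cosupp F A Q \<rho> =
    (\<lambda>\<theta>. \<lambda>a\<in>carrier A. tensor_lift F A Q A (\<lambda>b q. \<theta> q \<odot>\<^bsub>A\<^esub> b) (\<rho> a)) ` carrier (dual F Q)"

definition coaction ::
  "('f, 'm) ring_scheme \<Rightarrow> 'w set \<Rightarrow> ('w \<Rightarrow> nat) \<Rightarrow> ('w \<Rightarrow> nat) \<Rightarrow> ('f, 'a, 'n) module_scheme
    \<Rightarrow> ('w \<Rightarrow> ('f, 'a) tpower_elem \<Rightarrow> ('f, 'a) tpower_elem)
    \<Rightarrow> ('f, 'b, 'k) bialgebra_scheme \<Rightarrow> ('a \<Rightarrow> ('f, 'a, 'b) tensor_elem) \<Rightarrow> bool"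
  where "coaction F \<Omega> s t A ops B \<rho> \<longleftrightarrow>
    is_bialgebra F B \<and> comeasuring F \<Omega> s t A ops B \<rho> \<and>
    (\<forall>a\<in>carrier A.
      tensor_assoc F A B B (tensor_map F A B (tensor F A B) B \<rho> (\<lambda>b. b) (\<rho> a)) =
      tensor_map F A B A (tensor F B B) (\<lambda>a. a) (comult B) (\<rho> a)) \<and>
    (\<forall>a\<in>carrier A. tensor_lift F A B A (\<lambda>a' b. counit B b \<odot>\<^bsub>A\<^esub> a') (\<rho> a) = a)"

text \<open>The pair \<open>(B, \<rho>)\<close> is a \<open>V\<close>-universal coacting bialgebra on \<open>A\<close>: it is an initial object of the
  category of comeasurings with cosupport in \<open>V\<close>, and the bialgebra structure makes \<open>\<rho>\<close> a coaction.
  The objects of the category are the comeasurings by algebras whose underlying set is an arbitrary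
  subset of the type \<open>'q\<close>, which is also the type that carries \<open>B\<close>.\<close>

definition universal_coacting_bialgebra ::
  "('f, 'm) ring_scheme \<Rightarrow> 'w set \<Rightarrow> ('w \<Rightarrow> nat) \<Rightarrow> ('w \<Rightarrow> nat) \<Rightarrow> ('f, 'a, 'n) module_scheme
    \<Rightarrow> ('w \<Rightarrow> ('f, 'a) tpower_elem \<Rightarrow> ('f, 'a) tpower_elem) \<Rightarrow> ('a \<Rightarrow> 'a) set
    \<Rightarrow> ('f, 'q) bialgebra \<Rightarrow> ('a \<Rightarrow> ('f, 'a, 'q) tensor_elem) \<Rightarrow> bool"
  where "universal_coacting_bialgebra F \<Omega> s t A ops V B \<rho> \<longleftrightarrow>
    coaction F \<Omega> s t A ops B \<rho> \<and> cosupp F A B \<rho> \<subseteq> V \<and>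
    (\<forall>(Q :: ('f, 'q) module) \<sigma>.
      comeasuring F \<Omega> s t A ops Q \<sigma> \<and> cosupp F A Q \<sigma> \<subseteq> V \<longrightarrow>
      (\<exists>!\<phi>. \<phi> \<in> algebra_hom F B Q \<and>
        (\<forall>a\<in>carrier A. tensor_map F A B A Q (\<lambda>a. a) \<phi> (\<rho> a) = \<sigma> a)))"

text \<open>For \<open>f\<close> in \<open>End(A\<^sup>*)\<close> the dual operator lives on \<open>A\<^sup>*\<^sup>*\<close> and is carried back to \<open>A\<close> along the
  evaluation isomorphism.\<close>

definition sharp ::
  "('f, 'm) ring_scheme \<Rightarrow> ('f, 'a, 'n) module_scheme \<Rightarrow> (('a \<Rightarrow> 'f) \<Rightarrow> 'a \<Rightarrow> 'f) set \<Rightarrow> ('a \<Rightarrow> 'a) set"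
  where "sharp F A V =
    (\<lambda>f. \<lambda>a\<in>carrier A. inv_into (carrier A) (eval_bidual F A)
      (dual_map F (dual F A) (dual F A) f (eval_bidual F A a))) ` V"

end

theory Submission
  imports Defs
begin

text \<open>
  In terms of a basis \<open>e\<^sub>i\<close> of \<open>A\<close> with dual basis \<open>d\<^sub>i\<close> of \<open>A\<^sup>*\<close>, a linear map \<open>\<rho> : A \<rightarrow> A \<otimes> Q\<close> is a matrix \<open>m\<close> over \<open>Q\<close>,
  \<open>\<rho>(e\<^sub>j) = \<Sum>\<^sub>i e\<^sub>i \<otimes> m\<^sub>i\<^sub>j\<close>. It is a comeasuring iff the products \<open>m\<^sub>i\<^sub>1\<^sub>k\<^sub>1 \<cdots> m\<^sub>i\<^sub>n\<^sub>k\<^sub>n\<close> satisfy linear equations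
  whose coefficients are the structure constants of the operations, and its cosupport consists of the
  operators with matrices \<open>(\<theta>(m\<^sub>i\<^sub>j))\<close> for functionals \<open>\<theta>\<close> on \<open>Q\<close>. Transposing \<open>m\<close> turns these conditions for \<open>A\<close>
  and \<open>V\<^sup>#\<close> into those for \<open>A\<^sup>*\<close> and \<open>V\<close>, without reversing any product in \<open>Q\<close>. So the initial objects of both categories
  are related by mutually inverse algebra maps sending one coefficient matrix to the transpose of the
  other. As \<open>\<Delta>(m\<^sub>k\<^sub>j) = \<Sum>\<^sub>i m\<^sub>k\<^sub>i \<otimes> m\<^sub>i\<^sub>j\<close>, transposition reverses the comultiplication of the coefficients, and these generate
  a universal coacting bialgebra as an algebra.
\<close>

section \<open>Linear maps\<close>

text \<open>Why the coefficients generate is the delicate point: initiality speaks about maps out of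
  \<open>B\<close>, not about its elements. A subalgebra containing the coefficients must itself
  carry an object of the category, and its cosupport is computed with functionals on the subalgebra.
  These have to extend to the whole algebra, which may be infinite dimensional; hence the complement
  from Zorn's lemma. Generation then reduces every identity between algebra maps out of
  \<open>B\<close> to its coefficients.

  A second constraint: tensor products are quotients of huge free spaces, and the maps on them are
  definite descriptions. Once the quotients are built, elements are never inspected: a map exists
  because it respects the relations, and two linear maps agree if they agree on pure tensors. Finite
  dimension enters through a basis with coordinate functionals, an arrangement that the dual and all
  tensor powers inherit, so one set of lemmas serves them all.

  Since test objects are plain \<open>module\<close> records over the type \<open>'q\<close>,
  \<open>B\<close> and \<open>C\<close> are repackaged before one is fed to the initiality of the
  other.\<close>

abbreviation lhom ::
  "('f, 'm) ring_scheme \<Rightarrow> ('f, 'a, 'n) module_scheme \<Rightarrow> ('f, 'b, 'k) module_scheme \<Rightarrow> ('a \<Rightarrow> 'b) set"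
  where "lhom \<equiv> LinearCombinations.module_hom"

lemma lhomI:
  assumes "\<And>x. x \<in> carrier V \<Longrightarrow> f x \<in> carrier W"
    and "\<And>x y. x \<in> carrier V \<Longrightarrow> y \<in> carrier V \<Longrightarrow> f (x \<oplus>\<^bsub>V\<^esub> y) = f x \<oplus>\<^bsub>W\<^esub> f y"
    and "\<And>c x. c \<in> carrier F \<Longrightarrow> x \<in> carrier V \<Longrightarrow> f (c \<odot>\<^bsub>V\<^esub> x) = c \<odot>\<^bsub>W\<^esub> f x"
  shows "f \<in> lhom F V W"
  using assms by (auto simp: module_hom_def)

lemma lhom_closed: "f \<in> lhom F V W \<Longrightarrow> x \<in> carrier V \<Longrightarrow> f x \<in> carrier W"
  by (auto simp: module_hom_def)

lemma lhom_cong: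
  assumes "vectorspace F V" "\<And>x. x \<in> carrier V \<Longrightarrow> f x = g x"
  shows "f \<in> lhom F V W \<longleftrightarrow> g \<in> lhom F V W"
proof -
  interpret V: vectorspace F V by fact
  show ?thesis using assms(2) unfolding module_hom_def by (auto simp: Pi_iff)
qed

lemma linD: "f \<in> lin F V W \<Longrightarrow> f \<in> lhom F V W"
  by (simp add: lin_def)

lemma lin_restrict:
  assumes "vectorspace F V" "f \<in> lhom F V W" shows "restrict f (carrier V) \<in> lin F V W"
  using lhom_cong[OF assms(1), of f "restrict f (carrier V)" W] assms(2) by (auto simp: lin_def)

lemma lin_eqI:
  assumes "f \<in> lin F V W" "g \<in> lin F V W" "\<And>x. x \<in> carrier V \<Longrightarrow> f x = g x" shows "f = g"
  using assms by (auto simp: lin_def intro: extensionalityI)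

lemma mod_hom_lhom:
  assumes "vectorspace F V" "vectorspace F W" "f \<in> lhom F V W" shows "mod_hom F V W f"
  using assms by (auto simp: mod_hom_def mod_hom_axioms_def vectorspace_def)

lemma lhom_zero:
  assumes "vectorspace F V" "vectorspace F W" "f \<in> lhom F V W" shows "f \<zero>\<^bsub>V\<^esub> = \<zero>\<^bsub>W\<^esub>"
  using mod_hom.f0_is_0[OF mod_hom_lhom[OF assms]] .

lemma lhom_minus:
  assumes "vectorspace F V" "vectorspace F W" "f \<in> lhom F V W" "x \<in> carrier V" "y \<in> carrier V"
  shows "f (x \<ominus>\<^bsub>V\<^esub> y) = f x \<ominus>\<^bsub>W\<^esub> f y"
  using mod_hom.f_minus[OF mod_hom_lhom[OF assms(1-3)] assms(4,5)] .

text \<open>Holds for infinite \<open>I\<close> too: there \<open>finsum\<close> is zero on both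
  sides, and linear maps preserve zero.\<close>

lemma lhom_finsum:
  assumes V: "vectorspace F V" and W: "vectorspace F W" and f: "f \<in> lhom F V W"
    and g: "\<And>i. i \<in> I \<Longrightarrow> g i \<in> carrier V"
  shows "f (finsum V g I) = finsum W (\<lambda>i. f (g i)) I"
proof -
  interpret V: vectorspace F V by fact
  interpret W: vectorspace F W by fact
  show ?thesis using g
  proof (induct I rule: infinite_finite_induct)
    case (insert i I)
    then have *: "(\<lambda>i. f (g i)) \<in> I \<rightarrow> carrier W" "f (g i) \<in> carrier W" "g \<in> I \<rightarrow> carrier V"
      using lhom_closed[OF f] by auto
    show ?case
      using insert * module_hom_add[OF f, of "g i" "finsum V g I"] by simp
  qed (simp_all add: lhom_zero[OF V W f])
qed

lemma lhom_comp:
  assumes "f \<in> lhom F U V" "g \<in> lhom F V W" shows "(\<lambda>x. g (f x)) \<in> lhom F U W"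
  using assms by (auto simp: module_hom_def Pi_iff)

lemma lhom_id: "(\<lambda>x. x) \<in> lhom F V V"
  by (auto simp: module_hom_def)

lemma lhom_const_zero:
  assumes "vectorspace F W" shows "(\<lambda>x. \<zero>\<^bsub>W\<^esub>) \<in> lhom F V W"
proof -
  interpret W: vectorspace F W by fact
  show ?thesis by (intro lhomI) auto
qed

lemma lhom_add_fun:
  assumes "vectorspace F W" "f \<in> lhom F V W" "g \<in> lhom F V W"
  shows "(\<lambda>x. f x \<oplus>\<^bsub>W\<^esub> g x) \<in> lhom F V W"
proof -
  interpret W: vectorspace F W by fact
  show ?thesis
    by (intro lhomI)
       (auto simp: lhom_closed[OF assms(2)] lhom_closed[OF assms(3)] module_hom_add[OF assms(2)]
         module_hom_add[OF assms(3)] module_hom_smult[OF assms(2)] module_hom_smult[OF assms(3)]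
         W.M.a_ac W.smult_r_distr)
qed

lemma lhom_smult_fun:
  assumes "vectorspace F W" "f \<in> lhom F V W" "c \<in> carrier F"
  shows "(\<lambda>x. c \<odot>\<^bsub>W\<^esub> f x) \<in> lhom F V W"
proof -
  interpret W: vectorspace F W by fact
  have "c \<odot>\<^bsub>W\<^esub> (a \<odot>\<^bsub>W\<^esub> f x) = a \<odot>\<^bsub>W\<^esub> (c \<odot>\<^bsub>W\<^esub> f x)" if "a \<in> carrier F" "x \<in> carrier V" for a x
    using that assms(3) lhom_closed[OF assms(2)]
    by (simp add: W.smult_assoc1[symmetric] W.R.m_comm)
  then show ?thesis
    using assms(3)
    by (intro lhomI) (auto simp: lhom_closed[OF assms(2)] module_hom_add[OF assms(2)]
         module_hom_smult[OF assms(2)] W.smult_r_distr)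
qed

lemma lhom_finsum_fun:
  assumes "vectorspace F V" "vectorspace F W" "\<And>i. i \<in> I \<Longrightarrow> f i \<in> lhom F V W"
  shows "(\<lambda>x. finsum W (\<lambda>i. f i x) I) \<in> lhom F V W"
proof -
  interpret W: vectorspace F W by fact
  show ?thesis using assms(3)
  proof (induct I rule: infinite_finite_induct)
    case (insert i I)
    have "(\<lambda>x. f i x \<oplus>\<^bsub>W\<^esub> finsum W (\<lambda>i. f i x) I) \<in> lhom F V W"
      using insert by (intro lhom_add_fun[OF assms(2)]) auto
    moreover have "finsum W (\<lambda>i. f i x) (insert i I) = f i x \<oplus>\<^bsub>W\<^esub> finsum W (\<lambda>i. f i x) I"
      if "x \<in> carrier V" for x
      using that insert by (intro W.finsum_insert) (auto intro: lhom_closed)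
    ultimately show ?case
      by (subst lhom_cong[OF assms(1)]) auto
  qed (simp_all add: lhom_const_zero[OF assms(2)])
qed

lemma finsum_delta:
  assumes "vectorspace F V" "finite I" "i \<in> I" "\<And>j. j \<in> I \<Longrightarrow> g j \<in> carrier V"
  shows "finsum V (\<lambda>j. (if j = i then \<one>\<^bsub>F\<^esub> else \<zero>\<^bsub>F\<^esub>) \<odot>\<^bsub>V\<^esub> g j) I = g i"
proof -
  interpret V: vectorspace F V by fact
  have "finsum V (\<lambda>j. (if j = i then \<one>\<^bsub>F\<^esub> else \<zero>\<^bsub>F\<^esub>) \<odot>\<^bsub>V\<^esub> g j) I
      = finsum V (\<lambda>j. if i = j then g j else \<zero>\<^bsub>V\<^esub>) I"
    using assms(4) by (intro V.M.finsum_cong') auto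
  then show ?thesis using V.M.finsum_singleton[of i I g] assms by auto
qed

subsection \<open>The ground field, the dual space and free spaces\<close>

lemma field_vectorspace: "vectorspace F V \<Longrightarrow> field F"
  by (simp add: vectorspace_def)

lemma ground_vs: assumes "field F" shows "vectorspace F (ground F)"
proof -
  interpret field F by fact
  have "module F (ground F)"
    by (rule module_criteria)
       (auto simp: ground_def is_cring a_ac m_assoc l_distr r_distr intro!: bexI[of _ "\<ominus>\<^bsub>F\<^esub> x" for x] r_neg)
  then show ?thesis by (simp add: vectorspace_def assms)
qed

text \<open>\<open>finsum\<close> depends only on carrier, addition and zero, so sums of scalars in
  \<open>F\<close> and vector sums in \<open>ground F\<close> coincide; later computations pass
  freely between the two views.\<close>

lemma ground_simps [simp]:
  "carrier (ground F) = carrier F" "add (ground F) = add F" "zero (ground F) = zero F"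
  "smult (ground F) = mult F" "finsum (ground F) = finsum F" "mult (ground F) = mult F"
  "one (ground F) = one F"
  by (simp_all add: ground_def finsum_def finprod_def fun_eq_iff)

lemma func_space_vs: assumes "field F" shows "vectorspace F (LinearCombinations.ring.func_space F X)"
proof -
  interpret field F by fact
  show ?thesis using assms func_space_is_module by (simp add: vectorspace_def)
qed

lemma func_space_simps:
  assumes "field F"
  shows "carrier (LinearCombinations.ring.func_space F X) = (X \<rightarrow>\<^sub>E carrier F)"
    "zero (LinearCombinations.ring.func_space F X) = (\<lambda>x\<in>X. \<zero>\<^bsub>F\<^esub>)"
    "add (LinearCombinations.ring.func_space F X) = (\<lambda>f g. \<lambda>x\<in>X. f x \<oplus>\<^bsub>F\<^esub> g x)"
    "smult (LinearCombinations.ring.func_space F X) = (\<lambda>c f. \<lambda>x\<in>X. c \<otimes>\<^bsub>F\<^esub> f x)"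
proof -
  interpret field F by fact
  show "carrier (LinearCombinations.ring.func_space F X) = (X \<rightarrow>\<^sub>E carrier F)"
    "zero (LinearCombinations.ring.func_space F X) = (\<lambda>x\<in>X. \<zero>\<^bsub>F\<^esub>)"
    "add (LinearCombinations.ring.func_space F X) = (\<lambda>f g. \<lambda>x\<in>X. f x \<oplus>\<^bsub>F\<^esub> g x)"
    "smult (LinearCombinations.ring.func_space F X) = (\<lambda>c f. \<lambda>x\<in>X. c \<otimes>\<^bsub>F\<^esub> f x)"
    by (simp_all add: func_space_def)
qed

text \<open>Shared by \<open>dual\<close> and \<open>free_space\<close>, which are both a function
  space with a smaller carrier.\<close>

lemma func_subspace_vs:
  assumes F: "field F" and sub: "S \<subseteq> X \<rightarrow>\<^sub>E carrier F" and zero: "(\<lambda>x\<in>X. \<zero>\<^bsub>F\<^esub>) \<in> S"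
    and add: "\<And>f g. f \<in> S \<Longrightarrow> g \<in> S \<Longrightarrow> (\<lambda>x\<in>X. f x \<oplus>\<^bsub>F\<^esub> g x) \<in> S"
    and smult: "\<And>c f. c \<in> carrier F \<Longrightarrow> f \<in> S \<Longrightarrow> (\<lambda>x\<in>X. c \<otimes>\<^bsub>F\<^esub> f x) \<in> S"
  shows "vectorspace F ((LinearCombinations.ring.func_space F X)\<lparr>carrier := S\<rparr>)"
proof -
  interpret P: vectorspace F "LinearCombinations.ring.func_space F X" by (rule func_space_vs[OF F])
  have "subspace F S (LinearCombinations.ring.func_space F X)"
    unfolding subspace_def LinearCombinations.submodule_def
    using sub zero add smult by (simp add: func_space_simps[OF F] P.vectorspace_axioms P.module_axioms)
  then show ?thesis by (rule P.subspace_is_vs)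
qed

lemma dual_simps:
  assumes "field F"
  shows "carrier (dual F V) = lin F V (ground F)"
    "zero (dual F V) = (\<lambda>x\<in>carrier V. \<zero>\<^bsub>F\<^esub>)"
    "add (dual F V) = (\<lambda>f g. \<lambda>x\<in>carrier V. f x \<oplus>\<^bsub>F\<^esub> g x)"
    "smult (dual F V) = (\<lambda>c f. \<lambda>x\<in>carrier V. c \<otimes>\<^bsub>F\<^esub> f x)"
  by (simp_all add: dual_def func_space_simps[OF assms])

lemma dual_vs: assumes V: "vectorspace F V" shows "vectorspace F (dual F V)"
proof -
  note F = field_vectorspace[OF V]
  note G = ground_vs[OF F]
  show ?thesis unfolding dual_def
  proof (rule func_subspace_vs[OF F])
    show "lin F V (ground F) \<subseteq> carrier V \<rightarrow>\<^sub>E carrier F"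
      by (auto simp: lin_def module_hom_def extensional_def)
    show "(\<lambda>x\<in>carrier V. \<zero>\<^bsub>F\<^esub>) \<in> lin F V (ground F)"
      using lin_restrict[OF V lhom_const_zero[OF G]] by simp
    show "(\<lambda>x\<in>carrier V. f x \<oplus>\<^bsub>F\<^esub> g x) \<in> lin F V (ground F)"
      if "f \<in> lin F V (ground F)" "g \<in> lin F V (ground F)" for f g
      using lin_restrict[OF V lhom_add_fun[OF G linD[OF that(1)] linD[OF that(2)]]] by simp
    show "(\<lambda>x\<in>carrier V. c \<otimes>\<^bsub>F\<^esub> f x) \<in> lin F V (ground F)"
      if "c \<in> carrier F" "f \<in> lin F V (ground F)" for c f
      using lin_restrict[OF V lhom_smult_fun[OF G linD[OF that(2)] that(1)]] by simp
  qed
qed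

lemma free_space_simps:
  assumes "field F"
  shows "carrier (free_space F X) = {f \<in> X \<rightarrow>\<^sub>E carrier F. finite {x \<in> X. f x \<noteq> \<zero>\<^bsub>F\<^esub>}}"
    "zero (free_space F X) = (\<lambda>x\<in>X. \<zero>\<^bsub>F\<^esub>)"
    "add (free_space F X) = (\<lambda>f g. \<lambda>x\<in>X. f x \<oplus>\<^bsub>F\<^esub> g x)"
    "smult (free_space F X) = (\<lambda>c f. \<lambda>x\<in>X. c \<otimes>\<^bsub>F\<^esub> f x)"
  by (simp_all add: free_space_def func_space_simps[OF assms])

lemma free_space_vs: assumes F: "field F" shows "vectorspace F (free_space F X)"
proof -
  interpret field F by fact
  show ?thesis unfolding free_space_def
  proof (rule func_subspace_vs[OF F], goal_cases)
    case (3 f g)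
    have "finite {x \<in> X. (\<lambda>x\<in>X. f x \<oplus>\<^bsub>F\<^esub> g x) x \<noteq> \<zero>\<^bsub>F\<^esub>}"
      by (rule finite_subset[of _ "{x \<in> X. f x \<noteq> \<zero>\<^bsub>F\<^esub>} \<union> {x \<in> X. g x \<noteq> \<zero>\<^bsub>F\<^esub>}"]) (use 3 in auto)
    then show ?case using 3 by (auto simp: PiE_iff)
  next
    case (4 c f)
    have "finite {x \<in> X. (\<lambda>x\<in>X. c \<otimes>\<^bsub>F\<^esub> f x) x \<noteq> \<zero>\<^bsub>F\<^esub>}"
      by (rule finite_subset[of _ "{x \<in> X. f x \<noteq> \<zero>\<^bsub>F\<^esub>}"]) (use 4 in auto)
    then show ?case using 4 by (auto simp: PiE_iff)
  qed auto
qed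

lemma free_gen_closed:
  assumes F: "field F" and "x \<in> X" shows "free_gen F X x \<in> carrier (free_space F X)"
proof -
  interpret field F by fact
  have "finite {y \<in> X. free_gen F X x y \<noteq> \<zero>\<^bsub>F\<^esub>}"
    by (rule finite_subset[of _ "{x}"]) (auto simp: free_gen_def)
  then show ?thesis using assms(2) by (auto simp: free_space_simps[OF F] free_gen_def)
qed

lemma free_eval_lhom:
  assumes F: "field F" and x: "x \<in> X" shows "(\<lambda>f. f x) \<in> lhom F (free_space F X) (ground F)"
  using x by (intro lhomI) (auto simp: free_space_simps[OF F])

text \<open>Checked by evaluating at each \<open>y\<close>, where only the summand of
  \<open>y\<close> itself can survive.\<close>

lemma free_decomp:
  assumes F: "field F" and f: "f \<in> carrier (free_space F X)"
  shows "f = finsum (free_space F X) (\<lambda>x. f x \<odot>\<^bsub>free_space F X\<^esub> free_gen F X x) {x \<in> X. f x \<noteq> \<zero>\<^bsub>F\<^esub>}"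
    (is "f = finsum ?L ?h ?S")
proof -
  interpret field F by fact
  interpret L: vectorspace F ?L by (rule free_space_vs[OF F])
  have fin: "finite ?S" and ext: "f \<in> X \<rightarrow>\<^sub>E carrier F" using f by (auto simp: free_space_simps[OF F])
  have h: "?h x \<in> carrier ?L" if "x \<in> ?S" for x
    using that ext by (auto intro!: L.smult_closed free_gen_closed[OF F])
  have s: "finsum ?L ?h ?S \<in> carrier ?L" using h by (intro L.M.finsum_closed) auto
  show ?thesis
  proof (rule PiE_ext[OF ext])
    show "finsum ?L ?h ?S \<in> X \<rightarrow>\<^sub>E carrier F" using s by (auto simp: free_space_simps[OF F])
    fix y assume y: "y \<in> X"
    have "finsum ?L ?h ?S y = finsum F (\<lambda>x. ?h x y) ?S"
      using lhom_finsum[OF free_space_vs[OF F] ground_vs[OF F] free_eval_lhom[OF F y], of ?S ?h] h by simp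
    also have "\<dots> = finsum F (\<lambda>x. if y = x then f x else \<zero>\<^bsub>F\<^esub>) ?S"
      using y ext by (intro finsum_cong') (auto simp: free_space_simps[OF F] free_gen_def PiE_iff)
    also have "\<dots> = f y"
    proof (cases "f y = \<zero>\<^bsub>F\<^esub>")
      case True
      then have "finsum F (\<lambda>x. if y = x then f x else \<zero>\<^bsub>F\<^esub>) ?S = finsum F (\<lambda>x. \<zero>\<^bsub>F\<^esub>) ?S"
        by (intro finsum_cong') auto
      then show ?thesis using True by simp
    next
      case False
      then show ?thesis using finsum_singleton[of y ?S f] fin y ext by auto
    qed
    finally show "f y = finsum ?L ?h ?S y" by simp
  qed
qed

lemma free_eqI:
  assumes F: "field F" and U: "vectorspace F U"
    and h: "h \<in> lhom F (free_space F X) U" "h' \<in> lhom F (free_space F X) U"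
    and eq: "\<And>x. x \<in> X \<Longrightarrow> h (free_gen F X x) = h' (free_gen F X x)"
    and f: "f \<in> carrier (free_space F X)"
  shows "h f = h' f"
proof -
  let ?L = "free_space F X" let ?S = "{x \<in> X. f x \<noteq> \<zero>\<^bsub>F\<^esub>}"
  interpret U: vectorspace F U by fact
  interpret L: vectorspace F ?L by (rule free_space_vs[OF F])
  have c: "f x \<in> carrier F" "free_gen F X x \<in> carrier ?L" if "x \<in> ?S" for x
    using f that free_gen_closed[OF F, of x X] by (auto simp: free_space_simps[OF F])
  have *: "k f = finsum U (\<lambda>x. f x \<odot>\<^bsub>U\<^esub> k (free_gen F X x)) ?S" if k: "k \<in> lhom F ?L U" for k
  proof -
    have "k f = k (finsum ?L (\<lambda>x. f x \<odot>\<^bsub>?L\<^esub> free_gen F X x) ?S)"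
      using free_decomp[OF F f] by simp
    also have "\<dots> = finsum U (\<lambda>x. k (f x \<odot>\<^bsub>?L\<^esub> free_gen F X x)) ?S"
      using c by (intro lhom_finsum[OF L.vectorspace_axioms U k] L.smult_closed) auto
    also have "\<dots> = finsum U (\<lambda>x. f x \<odot>\<^bsub>U\<^esub> k (free_gen F X x)) ?S"
      using c lhom_closed[OF k] by (intro U.M.finsum_cong') (auto simp: module_hom_smult[OF k])
    finally show ?thesis .
  qed
  show ?thesis unfolding *[OF h(1)] *[OF h(2)]
    using eq c lhom_closed[OF h(2)] by (intro U.M.finsum_cong') auto
qed

text \<open>The linear extension of \<open>g\<close> to formal combinations. The sum runs over the
  support because \<open>X\<close>, typically the set of all pairs or words of vectors, is infinite
  in general.\<close>

definition free_lift ::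
  "('f, 'm) ring_scheme \<Rightarrow> 'x set \<Rightarrow> ('f, 'b, 'k) module_scheme \<Rightarrow> ('x \<Rightarrow> 'b) \<Rightarrow> ('x \<Rightarrow> 'f) \<Rightarrow> 'b"
  where "free_lift F X U g f = finsum U (\<lambda>x. f x \<odot>\<^bsub>U\<^esub> g x) {x \<in> X. f x \<noteq> \<zero>\<^bsub>F\<^esub>}"

text \<open>Different elements have different supports. Additivity needs their sums over one common
  finite set, and the added terms are zero.\<close>

lemma free_lift_superset:
  assumes U: "vectorspace F U" and g: "\<And>x. x \<in> X \<Longrightarrow> g x \<in> carrier U"
    and f: "f \<in> carrier (free_space F X)"
    and S: "finite S" "S \<subseteq> X" "{x \<in> X. f x \<noteq> \<zero>\<^bsub>F\<^esub>} \<subseteq> S"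
  shows "free_lift F X U g f = finsum U (\<lambda>x. f x \<odot>\<^bsub>U\<^esub> g x) S"
proof -
  interpret U: vectorspace F U by fact
  have "f \<in> X \<rightarrow>\<^sub>E carrier F" using f by (auto simp: free_space_simps[OF field_vectorspace[OF U]])
  then show ?thesis unfolding free_lift_def
    using g S by (intro U.M.add.finprod_mono_neutral_cong_left) auto
qed

lemma free_lift_lhom:
  assumes U: "vectorspace F U" and g: "\<And>x. x \<in> X \<Longrightarrow> g x \<in> carrier U"
  shows "free_lift F X U g \<in> lhom F (free_space F X) U"
proof -
  let ?L = "free_space F X" let ?S = "\<lambda>f. {x \<in> X. f x \<noteq> \<zero>\<^bsub>F\<^esub>}"
  note F = field_vectorspace[OF U]
  interpret U: vectorspace F U by fact
  interpret L: vectorspace F ?L by (rule free_space_vs[OF F])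
  have ext: "f \<in> X \<rightarrow>\<^sub>E carrier F" "finite (?S f)" if "f \<in> carrier ?L" for f
    using that by (auto simp: free_space_simps[OF F])
  show ?thesis
  proof (rule lhomI)
    fix f assume f: "f \<in> carrier ?L"
    show "free_lift F X U g f \<in> carrier U"
      unfolding free_lift_def using ext[OF f] g by (intro U.M.finsum_closed) auto
  next
    fix f f' assume f: "f \<in> carrier ?L" and f': "f' \<in> carrier ?L"
    let ?T = "?S f \<union> ?S f'"
    have T: "finite ?T" "?T \<subseteq> X" using ext[OF f] ext[OF f'] by auto
    have c: "f x \<in> carrier F" "f' x \<in> carrier F" if "x \<in> X" for x
      using that ext[OF f] ext[OF f'] by auto
    have v: "(f \<oplus>\<^bsub>?L\<^esub> f') x = f x \<oplus>\<^bsub>F\<^esub> f' x" if "x \<in> X" for x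
      using that by (simp add: free_space_simps[OF F])
    have "free_lift F X U g (f \<oplus>\<^bsub>?L\<^esub> f') = finsum U (\<lambda>x. (f \<oplus>\<^bsub>?L\<^esub> f') x \<odot>\<^bsub>U\<^esub> g x) ?T"
      using f f' T v by (intro free_lift_superset[OF U g]) (auto intro: L.a_closed)
    also have "\<dots> = finsum U (\<lambda>x. f x \<odot>\<^bsub>U\<^esub> g x \<oplus>\<^bsub>U\<^esub> f' x \<odot>\<^bsub>U\<^esub> g x) ?T"
      using c g v by (intro U.M.finsum_cong') (auto simp: U.smult_l_distr)
    also have "\<dots> = finsum U (\<lambda>x. f x \<odot>\<^bsub>U\<^esub> g x) ?T \<oplus>\<^bsub>U\<^esub> finsum U (\<lambda>x. f' x \<odot>\<^bsub>U\<^esub> g x) ?T"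
      using c g by (intro U.M.finsum_addf) auto
    also have "\<dots> = free_lift F X U g f \<oplus>\<^bsub>U\<^esub> free_lift F X U g f'"
      using free_lift_superset[OF U g f T] free_lift_superset[OF U g f' T] by auto
    finally show "free_lift F X U g (f \<oplus>\<^bsub>?L\<^esub> f') = free_lift F X U g f \<oplus>\<^bsub>U\<^esub> free_lift F X U g f'" .
  next
    fix a f assume a: "a \<in> carrier F" and f: "f \<in> carrier ?L"
    have c: "f x \<in> carrier F" if "x \<in> X" for x using that ext[OF f] by auto
    have v: "(a \<odot>\<^bsub>?L\<^esub> f) x = a \<otimes>\<^bsub>F\<^esub> f x" if "x \<in> X" for x
      using that by (simp add: free_space_simps[OF F])
    have "free_lift F X U g (a \<odot>\<^bsub>?L\<^esub> f) = finsum U (\<lambda>x. (a \<odot>\<^bsub>?L\<^esub> f) x \<odot>\<^bsub>U\<^esub> g x) (?S f)"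
      using f a ext[OF f] v by (intro free_lift_superset[OF U g]) (auto intro: L.smult_closed)
    also have "\<dots> = finsum U (\<lambda>x. a \<odot>\<^bsub>U\<^esub> (f x \<odot>\<^bsub>U\<^esub> g x)) (?S f)"
      using c g v a by (intro U.M.finsum_cong') (auto simp: U.smult_assoc1)
    also have "\<dots> = a \<odot>\<^bsub>U\<^esub> free_lift F X U g f"
      unfolding free_lift_def using c g a by (intro U.finsum_smult[symmetric]) auto
    finally show "free_lift F X U g (a \<odot>\<^bsub>?L\<^esub> f) = a \<odot>\<^bsub>U\<^esub> free_lift F X U g f" .
  qed
qed

lemma free_lift_gen:
  assumes U: "vectorspace F U" and g: "\<And>x. x \<in> X \<Longrightarrow> g x \<in> carrier U" and x: "x \<in> X"
  shows "free_lift F X U g (free_gen F X x) = g x"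
proof -
  note F = field_vectorspace[OF U]
  interpret U: vectorspace F U by fact
  have "free_lift F X U g (free_gen F X x) = finsum U (\<lambda>y. free_gen F X x y \<odot>\<^bsub>U\<^esub> g y) {x}"
    using x by (intro free_lift_superset[OF U g] free_gen_closed[OF F]) (auto simp: free_gen_def)
  then show ?thesis using x g by (simp add: free_gen_def)
qed

section \<open>Spaces given by generators and relations\<close>

text \<open>Gives access to the coset lemmas for abelian subgroups. Closure under negation comes
  from scaling by minus one.\<close>

lemma quot_rcoset:
  assumes "vectorspace F M" "LinearCombinations.submodule F N M"
  shows "abelian_subgroup N M"
proof -
  interpret M: vectorspace F M by fact
  interpret N: LinearCombinations.submodule F N M by fact
  have "subgroup N (add_monoid M)"
  proof (rule subgroup.intro, goal_cases)
    case 1 show ?case using N.subset by simp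
  next
    case (2 x y) then show ?case by simp
  next
    case 3 show ?case by simp
  next
    case (4 x)
    then have "x \<in> carrier M" using N.subset by auto
    then have "\<ominus>\<^bsub>M\<^esub> x = (\<ominus>\<^bsub>F\<^esub> \<one>\<^bsub>F\<^esub>) \<odot>\<^bsub>M\<^esub> x" by (simp add: M.smult_minus_1)
    also have "\<dots> \<in> N" using 4 by (intro N.smult_closed) auto
    finally show ?case by (simp add: a_inv_def)
  qed
  then show ?thesis
    by (intro abelian_subgroupI3 additive_subgroup.intro M.M.abelian_group_axioms)
qed

text \<open>The union in \<open>quot_space\<close> is constant: another representative
  \<open>n + x\<close> gives \<open>c n + c x\<close> with \<open>c n\<close> in \<open>N\<close>,
  hence the same coset. Taking cosets before the union keeps \<open>c = 0\<close> correct, where the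
  bare image of a coset would be just the zero vector instead of \<open>N\<close>.\<close>

lemma quot_smult:
  assumes "vectorspace F M" "LinearCombinations.submodule F N M" "c \<in> carrier F" "x \<in> carrier M"
  shows "c \<odot>\<^bsub>quot_space M N\<^esub> (N +>\<^bsub>M\<^esub> x) = N +>\<^bsub>M\<^esub> (c \<odot>\<^bsub>M\<^esub> x)"
proof -
  interpret M: vectorspace F M by fact
  interpret N: LinearCombinations.submodule F N M by fact
  interpret S: abelian_subgroup N M by (rule quot_rcoset) fact+
  have "N +>\<^bsub>M\<^esub> (c \<odot>\<^bsub>M\<^esub> y) = N +>\<^bsub>M\<^esub> (c \<odot>\<^bsub>M\<^esub> x)" if y: "y \<in> N +>\<^bsub>M\<^esub> x" for y
  proof -
    obtain n where n: "n \<in> N" "y = n \<oplus>\<^bsub>M\<^esub> x" using y by (auto simp: a_r_coset_def')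
    have nM: "n \<in> carrier M" using n N.subset by auto
    have "c \<odot>\<^bsub>M\<^esub> y = c \<odot>\<^bsub>M\<^esub> n \<oplus>\<^bsub>M\<^esub> c \<odot>\<^bsub>M\<^esub> x" using n nM assms by (simp add: M.smult_r_distr)
    then have "c \<odot>\<^bsub>M\<^esub> y \<in> N +>\<^bsub>M\<^esub> (c \<odot>\<^bsub>M\<^esub> x)" using n assms(3) by (auto simp: a_r_coset_def')
    from S.a_repr_independence'[OF this M.smult_closed[OF assms(3,4)]] show ?thesis by (rule sym)
  qed
  moreover have "x \<in> N +>\<^bsub>M\<^esub> x" using S.a_rcos_self assms(4) by auto
  ultimately have "(\<Union>y\<in>N +>\<^bsub>M\<^esub> x. N +>\<^bsub>M\<^esub> (c \<odot>\<^bsub>M\<^esub> y)) = N +>\<^bsub>M\<^esub> (c \<odot>\<^bsub>M\<^esub> x)"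
    by (intro SUP_eq_const) blast+
  then show ?thesis by (simp only: quot_space_def module.simps)
qed

lemma quot_add:
  assumes "vectorspace F M" "LinearCombinations.submodule F N M" "x \<in> carrier M" "y \<in> carrier M"
  shows "(N +>\<^bsub>M\<^esub> x) \<oplus>\<^bsub>quot_space M N\<^esub> (N +>\<^bsub>M\<^esub> y) = N +>\<^bsub>M\<^esub> (x \<oplus>\<^bsub>M\<^esub> y)"
proof -
  interpret S: abelian_subgroup N M by (rule quot_rcoset) fact+
  show ?thesis using S.a_rcos_sum assms by (simp add: quot_space_def)
qed

lemma quot_carrier: "carrier (quot_space M N) = (\<lambda>x. N +>\<^bsub>M\<^esub> x) ` carrier M"
  by (auto simp: quot_space_def A_RCOSETS_def')

lemma quot_zero:
  assumes "vectorspace F M" "LinearCombinations.submodule F N M" "x \<in> N"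
  shows "N +>\<^bsub>M\<^esub> x = \<zero>\<^bsub>quot_space M N\<^esub>"
proof -
  interpret S: abelian_subgroup N M by (rule quot_rcoset) fact+
  show ?thesis using S.a_rcos_const assms by (simp add: quot_space_def)
qed

lemma quot_vs:
  assumes M: "vectorspace F M" and N: "LinearCombinations.submodule F N M"
  shows "vectorspace F (quot_space M N)"
proof -
  interpret M: vectorspace F M by fact
  interpret N: LinearCombinations.submodule F N M by fact
  define p where "p x = N +>\<^bsub>M\<^esub> x" for x
  let ?Q = "quot_space M N"
  have zero: "\<zero>\<^bsub>?Q\<^esub> = p \<zero>\<^bsub>M\<^esub>" using quot_zero[OF M N, of "\<zero>\<^bsub>M\<^esub>"] by (simp add: p_def)
  have carrier: "carrier ?Q = p ` carrier M" by (auto simp: quot_carrier p_def)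
  have add: "p x \<oplus>\<^bsub>?Q\<^esub> p y = p (x \<oplus>\<^bsub>M\<^esub> y)" if "x \<in> carrier M" "y \<in> carrier M" for x y
    using that by (simp add: p_def quot_add[OF M N])
  have smult: "c \<odot>\<^bsub>?Q\<^esub> p x = p (c \<odot>\<^bsub>M\<^esub> x)" if "c \<in> carrier F" "x \<in> carrier M" for c x
    using that by (simp add: p_def quot_smult[OF M N])
  note s = carrier add smult zero
  have "module F ?Q"
  proof (rule module_criteria, goal_cases)
    case 1 show ?case by (rule M.is_cring)
  next
    case 4
    have "\<exists>w\<in>carrier ?Q. p x \<oplus>\<^bsub>?Q\<^esub> w = \<zero>\<^bsub>?Q\<^esub>" if "x \<in> carrier M" for x
      using that by (intro bexI[of _ "p (\<ominus>\<^bsub>M\<^esub> x)"]) (auto simp: s M.M.r_neg)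
    then show ?case by (auto simp: carrier)
  next
    case 6 show ?case by (auto simp: s M.M.a_comm)
  next
    case 7 show ?case by (auto simp: s M.M.a_assoc)
  next
    case 9 show ?case by (auto simp: s M.smult_assoc1)
  next
    case 11 show ?case by (auto simp: s M.smult_l_distr)
  next
    case 12 show ?case by (auto simp: s M.smult_r_distr)
  qed (auto simp: s)
  then show ?thesis using field_vectorspace[OF M] by (simp add: vectorspace_def)
qed

lemma quot_proj_lhom:
  assumes M: "vectorspace F M" and N: "LinearCombinations.submodule F N M"
  shows "(\<lambda>x. N +>\<^bsub>M\<^esub> x) \<in> lhom F M (quot_space M N)"
proof (rule lhomI)
  fix x assume "x \<in> carrier M"
  then show "N +>\<^bsub>M\<^esub> x \<in> carrier (quot_space M N)" unfolding quot_carrier by (rule imageI)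
next
  fix x y assume "x \<in> carrier M" "y \<in> carrier M"
  from quot_add[OF M N this] show "N +>\<^bsub>M\<^esub> (x \<oplus>\<^bsub>M\<^esub> y)
    = (N +>\<^bsub>M\<^esub> x) \<oplus>\<^bsub>quot_space M N\<^esub> (N +>\<^bsub>M\<^esub> y)" by (rule sym)
next
  fix c x assume "c \<in> carrier F" "x \<in> carrier M"
  from quot_smult[OF M N this] show "N +>\<^bsub>M\<^esub> (c \<odot>\<^bsub>M\<^esub> x)
    = c \<odot>\<^bsub>quot_space M N\<^esub> (N +>\<^bsub>M\<^esub> x)" by (rule sym)
qed

text \<open>Evaluating \<open>h\<close> at an arbitrarily chosen representative of a coset is
  harmless: representatives differ by elements of \<open>N\<close>, where \<open>h\<close>
  vanishes.\<close>

lemma quot_lift: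
  assumes M: "vectorspace F M" and N: "LinearCombinations.submodule F N M" and U: "vectorspace F U"
    and h: "h \<in> lhom F M U" and 0: "\<And>x. x \<in> N \<Longrightarrow> h x = \<zero>\<^bsub>U\<^esub>"
  obtains k where "k \<in> lin F (quot_space M N) U" "\<And>x. x \<in> carrier M \<Longrightarrow> k (N +>\<^bsub>M\<^esub> x) = h x"
proof -
  interpret M: vectorspace F M by fact
  interpret U: vectorspace F U by fact
  interpret N: LinearCombinations.submodule F N M by fact
  interpret S: abelian_subgroup N M by (rule quot_rcoset) fact+
  let ?k = "\<lambda>X. h (SOME x. x \<in> X)"
  have *: "?k (N +>\<^bsub>M\<^esub> x) = h x" if x: "x \<in> carrier M" for x
  proof -
    have "(SOME y. y \<in> N +>\<^bsub>M\<^esub> x) \<in> N +>\<^bsub>M\<^esub> x" using S.a_rcos_self[OF x] by (rule someI)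
    then obtain n where n: "n \<in> N" "(SOME y. y \<in> N +>\<^bsub>M\<^esub> x) = n \<oplus>\<^bsub>M\<^esub> x" by (auto simp: a_r_coset_def')
    then show ?thesis using 0 x N.subset by (auto simp: module_hom_add[OF h] lhom_closed[OF h])
  qed
  have "?k \<in> lhom F (quot_space M N) U"
    by (intro lhomI)
       (auto simp: quot_carrier quot_add[OF M N] quot_smult[OF M N] * lhom_closed[OF h]
         module_hom_add[OF h] module_hom_smult[OF h])
  then have "restrict ?k (carrier (quot_space M N)) \<in> lin F (quot_space M N) U"
    by (rule lin_restrict[OF quot_vs[OF M N]])
  then show ?thesis using * by (intro that) (auto simp: quot_carrier)
qed

lemma lhom_span_zero:
  assumes M: "vectorspace F M" and U: "vectorspace F U" and R: "R \<subseteq> carrier M"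
    and h: "h \<in> lhom F M U" and 0: "\<And>r. r \<in> R \<Longrightarrow> h r = \<zero>\<^bsub>U\<^esub>"
    and x: "x \<in> LinearCombinations.module.span F M R"
  shows "h x = \<zero>\<^bsub>U\<^esub>"
proof -
  interpret M: vectorspace F M by fact
  interpret U: vectorspace F U by fact
  obtain a A where A: "A \<subseteq> R" "a \<in> A \<rightarrow> carrier F" "x = finsum M (\<lambda>v. a v \<odot>\<^bsub>M\<^esub> v) A"
    using x unfolding M.span_def M.lincomb_def by auto
  have "h x = finsum U (\<lambda>v. h (a v \<odot>\<^bsub>M\<^esub> v)) A"
    unfolding A(3) using A R by (intro lhom_finsum[OF M U h]) auto
  also have "\<dots> = finsum U (\<lambda>v. \<zero>\<^bsub>U\<^esub>) A"
    using A R 0 by (intro U.M.finsum_cong') (auto simp: module_hom_smult[OF h] subset_iff Pi_iff)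
  finally show ?thesis by simp
qed

text \<open>Both \<open>tensor\<close> and \<open>tpower\<close> are instances, so existence and
  uniqueness of linear extensions are proved once for the two of them.\<close>

locale presentation =
  fixes F :: "('f, 'm) ring_scheme" and X :: "'x set" and R :: "('x \<Rightarrow> 'f) set"
  assumes field: "field F" and rels: "R \<subseteq> carrier (free_space F X)"
begin

lemma submod: "LinearCombinations.submodule F (rel_span F X R) (free_space F X)"
proof -
  interpret L: vectorspace F "free_space F X" by (rule free_space_vs[OF field])
  show ?thesis unfolding rel_span_def by (rule L.span_is_submodule[OF rels])
qed

lemma vs: "vectorspace F (presented F X R)"
  unfolding presented_def by (rule quot_vs[OF free_space_vs[OF field] submod])

definition proj :: "('x \<Rightarrow> 'f) \<Rightarrow> ('x \<Rightarrow> 'f) set"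
  where "proj f = rel_span F X R +>\<^bsub>free_space F X\<^esub> f"

lemma proj_lhom: "proj \<in> lhom F (free_space F X) (presented F X R)"
  unfolding presented_def proj_def by (rule quot_proj_lhom[OF free_space_vs[OF field] submod])

lemma proj_gen: "proj (free_gen F X x) = presented_gen F X R x"
  by (simp add: proj_def presented_gen_def)

lemma proj_rel: "r \<in> R \<Longrightarrow> proj r = \<zero>\<^bsub>presented F X R\<^esub>"
proof -
  interpret L: vectorspace F "free_space F X" by (rule free_space_vs[OF field])
  assume "r \<in> R"
  then have "r \<in> rel_span F X R" using L.in_own_span[OF rels] by (auto simp: rel_span_def)
  then show ?thesis unfolding proj_def presented_def
    by (rule quot_zero[OF free_space_vs[OF field] submod])
qed

lemma eqI:
  assumes U: "vectorspace F U" and h: "h \<in> lhom F (presented F X R) U" "h' \<in> lhom F (presented F X R) U"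
    and eq: "\<And>x. x \<in> X \<Longrightarrow> h (presented_gen F X R x) = h' (presented_gen F X R x)"
    and z: "z \<in> carrier (presented F X R)"
  shows "h z = h' z"
proof -
  obtain f where f: "f \<in> carrier (free_space F X)" "z = proj f"
    using z by (auto simp: presented_def quot_carrier proj_def)
  show ?thesis unfolding f(2)
    by (rule free_eqI[OF field U lhom_comp[OF proj_lhom h(1)] lhom_comp[OF proj_lhom h(2)] _ f(1)])
       (simp add: proj_gen eq)
qed

text \<open>The definite description in \<open>presented_lift\<close> needs a unique witness.
  Existence is the factorisation of the free linear extension through the quotient; uniqueness holds
  as HOL functions because \<open>lin\<close> also fixes the values off the carrier.\<close>

lemma lift:
  assumes U: "vectorspace F U" and g: "\<And>x. x \<in> X \<Longrightarrow> g x \<in> carrier U"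
    and 0: "\<And>r. r \<in> R \<Longrightarrow> free_lift F X U g r = \<zero>\<^bsub>U\<^esub>"
  shows "presented_lift F X R U g \<in> lin F (presented F X R) U"
    and "\<And>x. x \<in> X \<Longrightarrow> presented_lift F X R U g (presented_gen F X R x) = g x"
proof -
  note L = free_space_vs[OF field, of X]
  have span: "free_lift F X U g x = \<zero>\<^bsub>U\<^esub>" if "x \<in> rel_span F X R" for x
    using lhom_span_zero[OF L U rels free_lift_lhom[OF U g] 0] that by (auto simp: rel_span_def)
  obtain k where k: "k \<in> lin F (presented F X R) U"
      "\<And>x. x \<in> carrier (free_space F X) \<Longrightarrow> k (proj x) = free_lift F X U g x"
    unfolding presented_def proj_def
    using quot_lift[OF L submod U free_lift_lhom[OF U g] span] by blast
  have kg: "k (presented_gen F X R x) = g x" if "x \<in> X" for x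
    using k(2)[OF free_gen_closed[OF field that]] free_lift_gen[OF U g that] by (simp add: proj_gen)
  have "\<exists>!h. h \<in> lin F (presented F X R) U \<and> (\<forall>x\<in>X. h (presented_gen F X R x) = g x)"
  proof (rule ex1I[of _ k])
    fix h assume h: "h \<in> lin F (presented F X R) U \<and> (\<forall>x\<in>X. h (presented_gen F X R x) = g x)"
    show "h = k"
      by (rule lin_eqI[OF conjunct1[OF h] k(1)], rule eqI[OF U linD linD])
         (use h k(1) kg in auto)
  qed (use k(1) kg in auto)
  from theI'[OF this]
  show "presented_lift F X R U g \<in> lin F (presented F X R) U"
    and "\<And>x. x \<in> X \<Longrightarrow> presented_lift F X R U g (presented_gen F X R x) = g x"
    unfolding presented_lift_def by auto
qed

end

section \<open>Tensor products\<close>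

definition bilin ::
  "('f, 'm) ring_scheme \<Rightarrow> ('f, 'a, 'n) module_scheme \<Rightarrow> ('f, 'b, 'k) module_scheme
    \<Rightarrow> ('f, 'c, 'l) module_scheme \<Rightarrow> ('a \<Rightarrow> 'b \<Rightarrow> 'c) \<Rightarrow> bool"
  where "bilin F V W U \<beta> \<longleftrightarrow>
    (\<forall>v\<in>carrier V. \<beta> v \<in> lhom F W U) \<and> (\<forall>w\<in>carrier W. (\<lambda>v. \<beta> v w) \<in> lhom F V U)"

lemma bilinI:
  assumes "\<And>v. v \<in> carrier V \<Longrightarrow> \<beta> v \<in> lhom F W U"
    and "\<And>w. w \<in> carrier W \<Longrightarrow> (\<lambda>v. \<beta> v w) \<in> lhom F V U"
  shows "bilin F V W U \<beta>"
  using assms by (auto simp: bilin_def)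

lemma bilin_left: "bilin F V W U \<beta> \<Longrightarrow> w \<in> carrier W \<Longrightarrow> (\<lambda>v. \<beta> v w) \<in> lhom F V U"
  and bilin_right: "bilin F V W U \<beta> \<Longrightarrow> v \<in> carrier V \<Longrightarrow> \<beta> v \<in> lhom F W U"
  by (auto simp: bilin_def)

lemma bilin_closed: "bilin F V W U \<beta> \<Longrightarrow> v \<in> carrier V \<Longrightarrow> w \<in> carrier W \<Longrightarrow> \<beta> v w \<in> carrier U"
  by (rule lhom_closed[OF bilin_right])

lemma bilin_comp:
  assumes "bilin F V W U \<beta>" "f \<in> lhom F V' V" "g \<in> lhom F W' W" "h \<in> lhom F U U'"
  shows "bilin F V' W' U' (\<lambda>v w. h (\<beta> (f v) (g w)))"
  by (intro bilinI)
     (use lhom_comp[OF assms(3) lhom_comp[OF bilin_right[OF assms(1)] assms(4)]]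
       lhom_comp[OF assms(2) lhom_comp[OF bilin_left[OF assms(1)] assms(4)]]
       lhom_closed[OF assms(2)] lhom_closed[OF assms(3)] in auto)

lemma smult_bilin:
  assumes "vectorspace F V" shows "bilin F (ground F) V V (\<lambda>c v. c \<odot>\<^bsub>V\<^esub> v)"
proof -
  interpret V: vectorspace F V by fact
  show ?thesis
  proof (rule bilinI)
    fix c assume "c \<in> carrier (ground F)"
    then show "(\<odot>\<^bsub>V\<^esub>) c \<in> lhom F V V" using lhom_smult_fun[OF assms lhom_id, of c] by simp
  qed (auto intro!: lhomI simp: V.smult_l_distr V.smult_assoc1)
qed

lemma smult_bilin':
  assumes "vectorspace F V" shows "bilin F V (ground F) V (\<lambda>v c. c \<odot>\<^bsub>V\<^esub> v)"
  using smult_bilin[OF assms] by (auto simp: bilin_def)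

lemma tensor_presentation:
  assumes V: "vectorspace F V" and W: "vectorspace F W"
  shows "presentation F (carrier V \<times> carrier W) (tensor_rels F V W)"
proof -
  note F = field_vectorspace[OF V]
  interpret V: vectorspace F V by fact
  interpret W: vectorspace F W by fact
  interpret L: vectorspace F "free_space F (carrier V \<times> carrier W)" by (rule free_space_vs[OF F])
  have g: "free_gen F (carrier V \<times> carrier W) (v, w) \<in> carrier (free_space F (carrier V \<times> carrier W))"
    if "v \<in> carrier V" "w \<in> carrier W" for v w using that by (intro free_gen_closed[OF F]) auto
  show ?thesis
    by (intro presentation.intro F)
       (auto simp: tensor_rels_def Let_def g intro!: L.M.minus_closed L.smult_closed L.M.a_closed)
qed

lemma tensor_vs:
  assumes V: "vectorspace F V" and W: "vectorspace F W" shows "vectorspace F (tensor F V W)"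
  unfolding tensor_def by (rule presentation.vs[OF tensor_presentation[OF assms]])

lemma pure_tensor_bilin:
  assumes V: "vectorspace F V" and W: "vectorspace F W"
  shows "bilin F V W (tensor F V W) (pure_tensor F V W)"
proof -
  let ?X = "carrier V \<times> carrier W" and ?T = "tensor F V W"
  let ?L = "free_space F ?X" let ?g = "free_gen F ?X"
  note F = field_vectorspace[OF V]
  interpret V: vectorspace F V by fact
  interpret W: vectorspace F W by fact
  interpret L: vectorspace F ?L by (rule free_space_vs[OF F])
  interpret T: vectorspace F ?T by (rule tensor_vs[OF V W])
  interpret P: presentation F ?X "tensor_rels F V W" by (rule tensor_presentation[OF V W])
  have p: "P.proj \<in> lhom F ?L ?T" using P.proj_lhom by (simp add: tensor_def)
  have pg: "P.proj (?g (v, w)) = pure_tensor F V W v w" for v w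
    by (simp add: pure_tensor_def P.proj_gen)
  have g: "?g (v, w) \<in> carrier ?L" if "v \<in> carrier V" "w \<in> carrier W" for v w
    using that by (intro free_gen_closed[OF F]) auto
  \<comment> \<open>Every relation is a difference, and the projection kills it, so its two terms
    get the same class. Each law of bilinearity below is one family of relations read this
    way.\<close>
  have eq: "P.proj x = P.proj y"
    if "x \<ominus>\<^bsub>?L\<^esub> y \<in> tensor_rels F V W" "x \<in> carrier ?L" "y \<in> carrier ?L" for x y
    using P.proj_rel[OF that(1)] lhom_minus[OF L.vectorspace_axioms T.vectorspace_axioms p that(2,3)]
      lhom_closed[OF p that(2)] lhom_closed[OF p that(3)] by (simp add: tensor_def[symmetric])
  have cl: "pure_tensor F V W v w \<in> carrier ?T" if "v \<in> carrier V" "w \<in> carrier W" for v w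
    using lhom_closed[OF p g[OF that]] by (simp add: pg)
  have ad: "P.proj (?g (v, w) \<oplus>\<^bsub>?L\<^esub> ?g (v', w')) = pure_tensor F V W v w \<oplus>\<^bsub>?T\<^esub> pure_tensor F V W v' w'"
    if "v \<in> carrier V" "w \<in> carrier W" "v' \<in> carrier V" "w' \<in> carrier W" for v v' w w'
    using module_hom_add[OF p g[OF that(1,2)] g[OF that(3,4)]] by (simp add: pg)
  have sm: "P.proj (c \<odot>\<^bsub>?L\<^esub> ?g (v, w)) = c \<odot>\<^bsub>?T\<^esub> pure_tensor F V W v w"
    if "v \<in> carrier V" "w \<in> carrier W" "c \<in> carrier F" for v w c
    using module_hom_smult[OF p that(3) g[OF that(1,2)]] by (simp add: pg)
  show ?thesis
  proof (intro bilinI lhomI)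
    fix v w w' assume *: "v \<in> carrier V" "w \<in> carrier W" "w' \<in> carrier W"
    have "?g (v, w \<oplus>\<^bsub>W\<^esub> w') \<ominus>\<^bsub>?L\<^esub> (?g (v, w) \<oplus>\<^bsub>?L\<^esub> ?g (v, w')) \<in> tensor_rels F V W"
      unfolding tensor_rels_def Let_def using * by blast
    then have "P.proj (?g (v, w \<oplus>\<^bsub>W\<^esub> w')) = P.proj (?g (v, w) \<oplus>\<^bsub>?L\<^esub> ?g (v, w'))"
      by (rule eq) (simp_all add: * g)
    then show "pure_tensor F V W v (w \<oplus>\<^bsub>W\<^esub> w')
        = pure_tensor F V W v w \<oplus>\<^bsub>?T\<^esub> pure_tensor F V W v w'" using * by (simp add: pg ad)
  next
    fix w v v' assume *: "w \<in> carrier W" "v \<in> carrier V" "v' \<in> carrier V"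
    have "?g (v \<oplus>\<^bsub>V\<^esub> v', w) \<ominus>\<^bsub>?L\<^esub> (?g (v, w) \<oplus>\<^bsub>?L\<^esub> ?g (v', w)) \<in> tensor_rels F V W"
      unfolding tensor_rels_def Let_def using * by blast
    then have "P.proj (?g (v \<oplus>\<^bsub>V\<^esub> v', w)) = P.proj (?g (v, w) \<oplus>\<^bsub>?L\<^esub> ?g (v', w))"
      by (rule eq) (simp_all add: * g)
    then show "pure_tensor F V W (v \<oplus>\<^bsub>V\<^esub> v') w
        = pure_tensor F V W v w \<oplus>\<^bsub>?T\<^esub> pure_tensor F V W v' w" using * by (simp add: pg ad)
  next
    fix v c w assume *: "v \<in> carrier V" "c \<in> carrier F" "w \<in> carrier W"
    have "?g (v, c \<odot>\<^bsub>W\<^esub> w) \<ominus>\<^bsub>?L\<^esub> c \<odot>\<^bsub>?L\<^esub> ?g (v, w) \<in> tensor_rels F V W"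
      unfolding tensor_rels_def Let_def using * by blast
    then have "P.proj (?g (v, c \<odot>\<^bsub>W\<^esub> w)) = P.proj (c \<odot>\<^bsub>?L\<^esub> ?g (v, w))"
      by (rule eq) (simp_all add: * g)
    then show "pure_tensor F V W v (c \<odot>\<^bsub>W\<^esub> w) = c \<odot>\<^bsub>?T\<^esub> pure_tensor F V W v w"
      using * by (simp add: pg sm)
  next
    fix w c v assume *: "w \<in> carrier W" "c \<in> carrier F" "v \<in> carrier V"
    have "?g (c \<odot>\<^bsub>V\<^esub> v, w) \<ominus>\<^bsub>?L\<^esub> c \<odot>\<^bsub>?L\<^esub> ?g (v, w) \<in> tensor_rels F V W"
      unfolding tensor_rels_def Let_def using * by blast
    then have "P.proj (?g (c \<odot>\<^bsub>V\<^esub> v, w)) = P.proj (c \<odot>\<^bsub>?L\<^esub> ?g (v, w))"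
      by (rule eq) (simp_all add: * g)
    then show "pure_tensor F V W (c \<odot>\<^bsub>V\<^esub> v) w = c \<odot>\<^bsub>?T\<^esub> pure_tensor F V W v w"
      using * by (simp add: pg sm)
  qed (auto simp: cl)
qed

lemma pure_tensor_closed:
  assumes "vectorspace F V" "vectorspace F W" "v \<in> carrier V" "w \<in> carrier W"
  shows "pure_tensor F V W v w \<in> carrier (tensor F V W)"
  by (rule bilin_closed[OF pure_tensor_bilin[OF assms(1,2)] assms(3,4)])

lemma tensor_eqI:
  assumes V: "vectorspace F V" and W: "vectorspace F W" and U: "vectorspace F U"
    and h: "h \<in> lhom F (tensor F V W) U" "h' \<in> lhom F (tensor F V W) U"
    and eq: "\<And>v w. v \<in> carrier V \<Longrightarrow> w \<in> carrier W \<Longrightarrow>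
      h (pure_tensor F V W v w) = h' (pure_tensor F V W v w)"
    and z: "z \<in> carrier (tensor F V W)"
  shows "h z = h' z"
  using presentation.eqI[OF tensor_presentation[OF V W] U h[unfolded tensor_def] _ z[unfolded tensor_def]]
    eq by (auto simp: pure_tensor_def)

text \<open>Bilinearity of \<open>\<beta>\<close> says precisely that its linear extension to the
  free space kills the four families of relations, treated in turn as \<open>t1\<close> to
  \<open>t4\<close>.\<close>

lemma tensor_lift:
  assumes V: "vectorspace F V" and W: "vectorspace F W" and U: "vectorspace F U"
    and \<beta>: "bilin F V W U \<beta>"
  shows tensor_lift_lin: "tensor_lift F V W U \<beta> \<in> lin F (tensor F V W) U"
    and tensor_lift_lhom: "tensor_lift F V W U \<beta> \<in> lhom F (tensor F V W) U"
    and tensor_lift_pure: "\<And>v w. v \<in> carrier V \<Longrightarrow> w \<in> carrier W \<Longrightarrow>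
      tensor_lift F V W U \<beta> (pure_tensor F V W v w) = \<beta> v w"
proof -
  let ?X = "carrier V \<times> carrier W" let ?L = "free_space F ?X" let ?g = "free_gen F ?X"
  let ?k = "free_lift F ?X U (case_prod \<beta>)"
  note F = field_vectorspace[OF V]
  interpret V: vectorspace F V by fact
  interpret W: vectorspace F W by fact
  interpret U: vectorspace F U by fact
  interpret L: vectorspace F ?L by (rule free_space_vs[OF F])
  interpret P: presentation F ?X "tensor_rels F V W" by (rule tensor_presentation[OF V W])
  have c: "case_prod \<beta> x \<in> carrier U" if "x \<in> ?X" for x using that bilin_closed[OF \<beta>] by auto
  note k = free_lift_lhom[where g = "case_prod \<beta>", OF U c]
  have g: "?g (v, w) \<in> carrier ?L" "?k (?g (v, w)) = \<beta> v w" "\<beta> v w \<in> carrier U"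
    if vw: "v \<in> carrier V" "w \<in> carrier W" for v w
  proof -
    have x: "(v, w) \<in> ?X" using vw by simp
    show "?g (v, w) \<in> carrier ?L" by (rule free_gen_closed[OF F x])
    have "?k (?g (v, w)) = case_prod \<beta> (v, w)" by (rule free_lift_gen[where g = "case_prod \<beta>", OF U c x])
    then show "?k (?g (v, w)) = \<beta> v w" by (simp only: prod.case)
    show "\<beta> v w \<in> carrier U" by (rule bilin_closed[OF \<beta> vw])
  qed
  note closed = g(1) g(3) L.M.a_closed L.smult_closed V.M.a_closed V.smult_closed W.M.a_closed W.smult_closed
  have t1: "?k (?g (v \<oplus>\<^bsub>V\<^esub> v', w) \<ominus>\<^bsub>?L\<^esub> (?g (v, w) \<oplus>\<^bsub>?L\<^esub> ?g (v', w))) = \<zero>\<^bsub>U\<^esub>"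
    if x: "v \<in> carrier V" "v' \<in> carrier V" "w \<in> carrier W" for v v' w
  proof -
    have "?k (?g (v \<oplus>\<^bsub>V\<^esub> v', w) \<ominus>\<^bsub>?L\<^esub> (?g (v, w) \<oplus>\<^bsub>?L\<^esub> ?g (v', w)))
        = \<beta> (v \<oplus>\<^bsub>V\<^esub> v') w \<ominus>\<^bsub>U\<^esub> (\<beta> v w \<oplus>\<^bsub>U\<^esub> \<beta> v' w)"
      using x by (simp add: closed g(2) lhom_minus[OF L.vectorspace_axioms U k] module_hom_add[OF k])
    then show ?thesis using x by (simp add: closed module_hom_add[OF bilin_left[OF \<beta>]])
  qed
  have t2: "?k (?g (v, w \<oplus>\<^bsub>W\<^esub> w') \<ominus>\<^bsub>?L\<^esub> (?g (v, w) \<oplus>\<^bsub>?L\<^esub> ?g (v, w'))) = \<zero>\<^bsub>U\<^esub>"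
    if x: "v \<in> carrier V" "w \<in> carrier W" "w' \<in> carrier W" for v w w'
  proof -
    have "?k (?g (v, w \<oplus>\<^bsub>W\<^esub> w') \<ominus>\<^bsub>?L\<^esub> (?g (v, w) \<oplus>\<^bsub>?L\<^esub> ?g (v, w')))
        = \<beta> v (w \<oplus>\<^bsub>W\<^esub> w') \<ominus>\<^bsub>U\<^esub> (\<beta> v w \<oplus>\<^bsub>U\<^esub> \<beta> v w')"
      using x by (simp add: closed g(2) lhom_minus[OF L.vectorspace_axioms U k] module_hom_add[OF k])
    then show ?thesis using x by (simp add: closed module_hom_add[OF bilin_right[OF \<beta>]])
  qed
  have t3: "?k (?g (a \<odot>\<^bsub>V\<^esub> v, w) \<ominus>\<^bsub>?L\<^esub> a \<odot>\<^bsub>?L\<^esub> ?g (v, w)) = \<zero>\<^bsub>U\<^esub>"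
    if x: "a \<in> carrier F" "v \<in> carrier V" "w \<in> carrier W" for a v w
  proof -
    have "?k (?g (a \<odot>\<^bsub>V\<^esub> v, w) \<ominus>\<^bsub>?L\<^esub> a \<odot>\<^bsub>?L\<^esub> ?g (v, w)) = \<beta> (a \<odot>\<^bsub>V\<^esub> v) w \<ominus>\<^bsub>U\<^esub> a \<odot>\<^bsub>U\<^esub> \<beta> v w"
      using x by (simp add: closed g(2) lhom_minus[OF L.vectorspace_axioms U k] module_hom_smult[OF k])
    then show ?thesis using x by (simp add: closed module_hom_smult[OF bilin_left[OF \<beta>]])
  qed
  have t4: "?k (?g (v, a \<odot>\<^bsub>W\<^esub> w) \<ominus>\<^bsub>?L\<^esub> a \<odot>\<^bsub>?L\<^esub> ?g (v, w)) = \<zero>\<^bsub>U\<^esub>"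
    if x: "a \<in> carrier F" "v \<in> carrier V" "w \<in> carrier W" for a v w
  proof -
    have "?k (?g (v, a \<odot>\<^bsub>W\<^esub> w) \<ominus>\<^bsub>?L\<^esub> a \<odot>\<^bsub>?L\<^esub> ?g (v, w)) = \<beta> v (a \<odot>\<^bsub>W\<^esub> w) \<ominus>\<^bsub>U\<^esub> a \<odot>\<^bsub>U\<^esub> \<beta> v w"
      using x by (simp add: closed g(2) lhom_minus[OF L.vectorspace_axioms U k] module_hom_smult[OF k])
    then show ?thesis using x by (simp add: closed module_hom_smult[OF bilin_right[OF \<beta>]])
  qed
  have "?k r = \<zero>\<^bsub>U\<^esub>" if "r \<in> tensor_rels F V W" for r
    using that unfolding tensor_rels_def Let_def
    by (elim UnE CollectE exE conjE) (simp_all only: t1 t2 t3 t4)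
  note l = P.lift[where g = "case_prod \<beta>", OF U c this]
  show "tensor_lift F V W U \<beta> \<in> lin F (tensor F V W) U"
    using l(1) by (simp add: tensor_lift_def tensor_def)
  then show "tensor_lift F V W U \<beta> \<in> lhom F (tensor F V W) U" by (rule linD)
  show "tensor_lift F V W U \<beta> (pure_tensor F V W v w) = \<beta> v w"
    if "v \<in> carrier V" "w \<in> carrier W" for v w
    using l(2)[of "(v, w)"] that by (simp add: tensor_lift_def pure_tensor_def)
qed

lemma tensor_map:
  assumes "vectorspace F V" "vectorspace F W" "vectorspace F V'" "vectorspace F W'"
    and "f \<in> lhom F V V'" "g \<in> lhom F W W'"
  shows tensor_map_lhom: "tensor_map F V W V' W' f g \<in> lhom F (tensor F V W) (tensor F V' W')"
    and tensor_map_pure: "\<And>v w. v \<in> carrier V \<Longrightarrow> w \<in> carrier W \<Longrightarrow>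
      tensor_map F V W V' W' f g (pure_tensor F V W v w) = pure_tensor F V' W' (f v) (g w)"
proof -
  note b = bilin_comp[OF pure_tensor_bilin[OF assms(3,4)] assms(5,6) lhom_id]
  show "tensor_map F V W V' W' f g \<in> lhom F (tensor F V W) (tensor F V' W')"
    unfolding tensor_map_def by (rule tensor_lift_lhom[OF assms(1,2) tensor_vs[OF assms(3,4)] b])
  show "tensor_map F V W V' W' f g (pure_tensor F V W v w) = pure_tensor F V' W' (f v) (g w)"
    if "v \<in> carrier V" "w \<in> carrier W" for v w
    unfolding tensor_map_def by (rule tensor_lift_pure[OF assms(1,2) tensor_vs[OF assms(3,4)] b that])
qed

lemma tensor_flip:
  assumes V: "vectorspace F V" and W: "vectorspace F W"
  shows tensor_flip_lhom: "tensor_flip F V W \<in> lhom F (tensor F V W) (tensor F W V)"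
    and tensor_flip_pure: "\<And>v w. v \<in> carrier V \<Longrightarrow> w \<in> carrier W \<Longrightarrow>
      tensor_flip F V W (pure_tensor F V W v w) = pure_tensor F W V w v"
proof -
  have b: "bilin F V W (tensor F W V) (\<lambda>v w. pure_tensor F W V w v)"
    using pure_tensor_bilin[OF W V] by (auto simp: bilin_def)
  show "tensor_flip F V W \<in> lhom F (tensor F V W) (tensor F W V)"
    unfolding tensor_flip_def by (rule tensor_lift_lhom[OF V W tensor_vs[OF W V] b])
  show "tensor_flip F V W (pure_tensor F V W v w) = pure_tensor F W V w v"
    if "v \<in> carrier V" "w \<in> carrier W" for v w
    unfolding tensor_flip_def by (rule tensor_lift_pure[OF V W tensor_vs[OF W V] b that])
qed

text \<open>Needed for nested lifts, where the inner lift must be linear in the variables of the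
  outer one. For fixed parameters both sides of each law are linear in \<open>z\<close>, so pure
  tensors suffice.\<close>

lemma tensor_lift_param:
  assumes V: "vectorspace F V" and W: "vectorspace F W" and U: "vectorspace F U" and P: "vectorspace F P"
    and \<beta>: "\<And>p. p \<in> carrier P \<Longrightarrow> bilin F V W U (\<lambda>v w. \<beta> v w p)"
    and lin: "\<And>v w. v \<in> carrier V \<Longrightarrow> w \<in> carrier W \<Longrightarrow> \<beta> v w \<in> lhom F P U"
    and z: "z \<in> carrier (tensor F V W)"
  shows "(\<lambda>p. tensor_lift F V W U (\<lambda>v w. \<beta> v w p) z) \<in> lhom F P U"
proof -
  interpret U: vectorspace F U by fact
  interpret P: vectorspace F P by fact
  note l = tensor_lift_lin[OF V W U \<beta>] tensor_lift_lhom[OF V W U \<beta>] tensor_lift_pure[OF V W U \<beta>]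
  show ?thesis
  proof (rule lhomI)
    show "tensor_lift F V W U (\<lambda>v w. \<beta> v w p) z \<in> carrier U" if "p \<in> carrier P" for p
      using lhom_closed[OF l(2)[OF that] z] .
  next
    fix p q assume p: "p \<in> carrier P" and q: "q \<in> carrier P"
    then have pq: "p \<oplus>\<^bsub>P\<^esub> q \<in> carrier P" by simp
    show "tensor_lift F V W U (\<lambda>v w. \<beta> v w (p \<oplus>\<^bsub>P\<^esub> q)) z
      = tensor_lift F V W U (\<lambda>v w. \<beta> v w p) z \<oplus>\<^bsub>U\<^esub> tensor_lift F V W U (\<lambda>v w. \<beta> v w q) z"
    proof (rule tensor_eqI[OF V W U l(2)[OF pq] lhom_add_fun[OF U l(2)[OF p] l(2)[OF q]] _ z])
      fix v w assume vw: "v \<in> carrier V" "w \<in> carrier W"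
      show "tensor_lift F V W U (\<lambda>v w. \<beta> v w (p \<oplus>\<^bsub>P\<^esub> q)) (pure_tensor F V W v w)
        = tensor_lift F V W U (\<lambda>v w. \<beta> v w p) (pure_tensor F V W v w)
          \<oplus>\<^bsub>U\<^esub> tensor_lift F V W U (\<lambda>v w. \<beta> v w q) (pure_tensor F V W v w)"
        unfolding l(3)[OF pq vw] l(3)[OF p vw] l(3)[OF q vw] by (rule module_hom_add[OF lin[OF vw] p q])
    qed
  next
    fix c p assume c: "c \<in> carrier F" and p: "p \<in> carrier P"
    then have cp: "c \<odot>\<^bsub>P\<^esub> p \<in> carrier P" by simp
    show "tensor_lift F V W U (\<lambda>v w. \<beta> v w (c \<odot>\<^bsub>P\<^esub> p)) z = c \<odot>\<^bsub>U\<^esub> tensor_lift F V W U (\<lambda>v w. \<beta> v w p) z"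
    proof (rule tensor_eqI[OF V W U l(2)[OF cp] lhom_smult_fun[OF U l(2)[OF p] c] _ z])
      fix v w assume vw: "v \<in> carrier V" "w \<in> carrier W"
      show "tensor_lift F V W U (\<lambda>v w. \<beta> v w (c \<odot>\<^bsub>P\<^esub> p)) (pure_tensor F V W v w)
        = c \<odot>\<^bsub>U\<^esub> tensor_lift F V W U (\<lambda>v w. \<beta> v w p) (pure_tensor F V W v w)"
        unfolding l(3)[OF cp vw] l(3)[OF p vw] by (rule module_hom_smult[OF lin[OF vw] c p])
    qed
  qed
qed

section \<open>Tensor powers\<close>

text \<open>The separate closure clause matters for \<open>n = 0\<close>, where there is no slot to
  vary and the second clause is vacuous.\<close>

definition multilin ::
  "('f, 'm) ring_scheme \<Rightarrow> ('f, 'a, 'n) module_scheme \<Rightarrow> nat \<Rightarrow> ('f, 'b, 'k) module_scheme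
    \<Rightarrow> ('a list \<Rightarrow> 'b) \<Rightarrow> bool"
  where "multilin F A n U \<mu> \<longleftrightarrow> (\<forall>as\<in>words A n. \<mu> as \<in> carrier U) \<and>
    (\<forall>xs ys. xs \<in> lists (carrier A) \<longrightarrow> ys \<in> lists (carrier A) \<longrightarrow> Suc (length xs + length ys) = n
      \<longrightarrow> (\<lambda>a. \<mu> (xs @ a # ys)) \<in> lhom F A U)"

lemma multilin_closed: "multilin F A n U \<mu> \<Longrightarrow> as \<in> words A n \<Longrightarrow> \<mu> as \<in> carrier U"
  by (simp add: multilin_def)

lemma words_0: "words A 0 = {[]}"
  by (auto simp: words_def)

lemma words_Suc: "words A (Suc n) = {a # as | a as. a \<in> carrier A \<and> as \<in> words A n}"
  by (auto simp: words_def length_Suc_conv)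

lemma words_Cons_iff: "a # as \<in> words A (Suc n) \<longleftrightarrow> a \<in> carrier A \<and> as \<in> words A n"
  by (auto simp: words_def)

lemma words_mid_iff:
  "xs @ a # ys \<in> words A n \<longleftrightarrow>
    xs \<in> lists (carrier A) \<and> a \<in> carrier A \<and> ys \<in> lists (carrier A) \<and> Suc (length xs + length ys) = n"
  by (auto simp: words_def)

lemma tpower_relsE:
  assumes "r \<in> tpower_rels F A n"
  obtains
    (add) xs a b ys where "xs @ a # ys \<in> words A n" "xs @ b # ys \<in> words A n"
      "r = free_gen F (words A n) (xs @ (a \<oplus>\<^bsub>A\<^esub> b) # ys) \<ominus>\<^bsub>free_space F (words A n)\<^esub>
        (free_gen F (words A n) (xs @ a # ys) \<oplus>\<^bsub>free_space F (words A n)\<^esub>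
          free_gen F (words A n) (xs @ b # ys))"
  | (smult) xs c a ys where "c \<in> carrier F" "xs @ a # ys \<in> words A n"
      "r = free_gen F (words A n) (xs @ (c \<odot>\<^bsub>A\<^esub> a) # ys) \<ominus>\<^bsub>free_space F (words A n)\<^esub>
        c \<odot>\<^bsub>free_space F (words A n)\<^esub> free_gen F (words A n) (xs @ a # ys)"
  using assms unfolding tpower_rels_def Let_def by (elim UnE CollectE exE conjE) metis+

lemma tpower_presentation:
  assumes A: "vectorspace F A" shows "presentation F (words A n) (tpower_rels F A n)"
proof -
  note F = field_vectorspace[OF A]
  interpret A: vectorspace F A by fact
  interpret L: vectorspace F "free_space F (words A n)" by (rule free_space_vs[OF F])
  note g = free_gen_closed[OF F, of _ "words A n"]
  have add': "free_gen F (words A n) (xs @ (a \<oplus>\<^bsub>A\<^esub> b) # ys) \<in> carrier (free_space F (words A n))"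
    if "xs @ a # ys \<in> words A n" "xs @ b # ys \<in> words A n" for xs a b ys
    using that by (intro g) (simp add: words_mid_iff)
  have smult': "free_gen F (words A n) (xs @ (c \<odot>\<^bsub>A\<^esub> a) # ys) \<in> carrier (free_space F (words A n))"
    if "xs @ a # ys \<in> words A n" "c \<in> carrier F" for xs c a ys
    using that by (intro g) (simp add: words_mid_iff)
  have "r \<in> carrier (free_space F (words A n))" if "r \<in> tpower_rels F A n" for r
    using that
  proof (cases rule: tpower_relsE)
    case (add xs a b ys)
    show ?thesis unfolding add(3)
      by (intro L.M.minus_closed L.M.a_closed g add'[OF add(1,2)] add(1,2))
  next
    case (smult xs c a ys)
    show ?thesis unfolding smult(3)
      by (intro L.M.minus_closed L.smult_closed g smult'[OF smult(2,1)] smult(1,2))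
  qed
  then show ?thesis by (intro presentation.intro F subsetI)
qed

lemma tpower_vs:
  assumes "vectorspace F A" shows "vectorspace F (tpower F A n)"
  unfolding tpower_def by (rule presentation.vs[OF tpower_presentation[OF assms]])

lemma pure_word_multilin:
  assumes A: "vectorspace F A" shows "multilin F A n (tpower F A n) (pure_word F A)"
proof -
  let ?X = "words A n" and ?T = "tpower F A n"
  let ?L = "free_space F ?X" let ?g = "free_gen F ?X"
  note F = field_vectorspace[OF A]
  interpret A: vectorspace F A by fact
  interpret L: vectorspace F ?L by (rule free_space_vs[OF F])
  interpret T: vectorspace F ?T by (rule tpower_vs[OF A])
  interpret P: presentation F ?X "tpower_rels F A n" by (rule tpower_presentation[OF A])
  have p: "P.proj \<in> lhom F ?L ?T" using P.proj_lhom by (simp add: tpower_def)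
  have pg: "P.proj (?g as) = pure_word F A as" if "as \<in> words A n" for as
  proof -
    \<comment> \<open>\<open>pure_word\<close> takes the exponent of the tensor power from the
      length of its argument, so it must be matched with \<open>n\<close> first.\<close>
    have "length as = n" using that by (simp add: words_def)
    then show ?thesis by (simp add: pure_word_def P.proj_gen)
  qed
  note g = free_gen_closed[OF F, of _ "words A n"]
  have eq: "P.proj x = P.proj y"
    if "x \<ominus>\<^bsub>?L\<^esub> y \<in> tpower_rels F A n" "x \<in> carrier ?L" "y \<in> carrier ?L" for x y
    using P.proj_rel[OF that(1)] lhom_minus[OF L.vectorspace_axioms T.vectorspace_axioms p that(2,3)]
      lhom_closed[OF p that(2)] lhom_closed[OF p that(3)] by (simp add: tpower_def[symmetric])
  have cl: "pure_word F A as \<in> carrier ?T" if "as \<in> words A n" for as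
    using lhom_closed[OF p g[OF that]] by (simp add: pg that)
  have "(\<lambda>a. pure_word F A (xs @ a # ys)) \<in> lhom F A ?T"
    if *: "xs \<in> lists (carrier A)" "ys \<in> lists (carrier A)" "Suc (length xs + length ys) = n" for xs ys
  proof -
    have w: "xs @ a # ys \<in> words A n" if "a \<in> carrier A" for a using that * by (simp add: words_mid_iff)
    show ?thesis
    proof (rule lhomI)
      fix a b assume a: "a \<in> carrier A" and b: "b \<in> carrier A"
      then have ab: "a \<oplus>\<^bsub>A\<^esub> b \<in> carrier A" by simp
      have "?g (xs @ (a \<oplus>\<^bsub>A\<^esub> b) # ys) \<ominus>\<^bsub>?L\<^esub> (?g (xs @ a # ys) \<oplus>\<^bsub>?L\<^esub> ?g (xs @ b # ys)) \<in> tpower_rels F A n"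
        unfolding tpower_rels_def Let_def using w[OF a] w[OF b] by blast
      then have "P.proj (?g (xs @ (a \<oplus>\<^bsub>A\<^esub> b) # ys)) = P.proj (?g (xs @ a # ys) \<oplus>\<^bsub>?L\<^esub> ?g (xs @ b # ys))"
        using g w a b ab by (intro eq) auto
      then show "pure_word F A (xs @ (a \<oplus>\<^bsub>A\<^esub> b) # ys)
          = pure_word F A (xs @ a # ys) \<oplus>\<^bsub>?T\<^esub> pure_word F A (xs @ b # ys)"
        using module_hom_add[OF p g[OF w[OF a]] g[OF w[OF b]]] by (simp add: pg w a b ab)
    next
      fix c a assume c: "c \<in> carrier F" and a: "a \<in> carrier A"
      then have ca: "c \<odot>\<^bsub>A\<^esub> a \<in> carrier A" by simp
      have "?g (xs @ (c \<odot>\<^bsub>A\<^esub> a) # ys) \<ominus>\<^bsub>?L\<^esub> c \<odot>\<^bsub>?L\<^esub> ?g (xs @ a # ys) \<in> tpower_rels F A n"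
        unfolding tpower_rels_def Let_def using w[OF a] c by blast
      then have "P.proj (?g (xs @ (c \<odot>\<^bsub>A\<^esub> a) # ys)) = P.proj (c \<odot>\<^bsub>?L\<^esub> ?g (xs @ a # ys))"
        using g w a c ca by (intro eq) auto
      then show "pure_word F A (xs @ (c \<odot>\<^bsub>A\<^esub> a) # ys) = c \<odot>\<^bsub>?T\<^esub> pure_word F A (xs @ a # ys)"
        using module_hom_smult[OF p c g[OF w[OF a]]] by (simp add: pg w a ca)
    qed (simp add: w cl)
  qed
  then show ?thesis by (auto simp: multilin_def cl)
qed

lemma pure_word_closed:
  assumes "vectorspace F A" "as \<in> words A n" shows "pure_word F A as \<in> carrier (tpower F A n)"
  by (rule multilin_closed[OF pure_word_multilin[OF assms(1)] assms(2)])

lemma tpower_eqI: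
  assumes A: "vectorspace F A" and U: "vectorspace F U"
    and h: "h \<in> lhom F (tpower F A n) U" "h' \<in> lhom F (tpower F A n) U"
    and eq: "\<And>as. as \<in> words A n \<Longrightarrow> h (pure_word F A as) = h' (pure_word F A as)"
    and z: "z \<in> carrier (tpower F A n)"
  shows "h z = h' z"
proof (rule presentation.eqI[OF tpower_presentation[OF A] U h[unfolded tpower_def] _ z[unfolded tpower_def]])
  fix as assume "as \<in> words A n"
  then show "h (presented_gen F (words A n) (tpower_rels F A n) as)
      = h' (presented_gen F (words A n) (tpower_rels F A n) as)"
    using eq[of as] by (auto simp: pure_word_def words_def)
qed

lemma tpower_lift:
  assumes A: "vectorspace F A" and U: "vectorspace F U" and \<mu>: "multilin F A n U \<mu>"
  shows tpower_lift_lin: "tpower_lift F A n U \<mu> \<in> lin F (tpower F A n) U"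
    and tpower_lift_lhom: "tpower_lift F A n U \<mu> \<in> lhom F (tpower F A n) U"
    and tpower_lift_pure: "\<And>as. as \<in> words A n \<Longrightarrow> tpower_lift F A n U \<mu> (pure_word F A as) = \<mu> as"
proof -
  let ?X = "words A n" let ?L = "free_space F ?X" let ?g = "free_gen F ?X"
  let ?k = "free_lift F ?X U \<mu>"
  note F = field_vectorspace[OF A]
  interpret A: vectorspace F A by fact
  interpret U: vectorspace F U by fact
  interpret L: vectorspace F ?L by (rule free_space_vs[OF F])
  interpret P: presentation F ?X "tpower_rels F A n" by (rule tpower_presentation[OF A])
  note c = multilin_closed[OF \<mu>]
  note k = free_lift_lhom[where g = \<mu>, OF U c]
  have g: "?g as \<in> carrier ?L" "?k (?g as) = \<mu> as" if "as \<in> words A n" for as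
    using that free_lift_gen[OF U c] by (auto intro: free_gen_closed[OF F])
  have \<mu>l: "(\<lambda>a. \<mu> (xs @ a # ys)) \<in> lhom F A U"
    if "xs \<in> lists (carrier A)" "ys \<in> lists (carrier A)" "Suc (length xs + length ys) = n" for xs ys
    using \<mu> that unfolding multilin_def by blast
  have "?k r = \<zero>\<^bsub>U\<^esub>" if r: "r \<in> tpower_rels F A n" for r
  proof -
    have t1: "?k (?g (xs @ (a \<oplus>\<^bsub>A\<^esub> b) # ys) \<ominus>\<^bsub>?L\<^esub> (?g (xs @ a # ys) \<oplus>\<^bsub>?L\<^esub> ?g (xs @ b # ys))) = \<zero>\<^bsub>U\<^esub>"
      if w: "xs @ a # ys \<in> words A n" "xs @ b # ys \<in> words A n" for xs a b ys
    proof -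
      have *: "xs @ (a \<oplus>\<^bsub>A\<^esub> b) # ys \<in> words A n" using w by (simp add: words_mid_iff)
      have "\<mu> (xs @ (a \<oplus>\<^bsub>A\<^esub> b) # ys) = \<mu> (xs @ a # ys) \<oplus>\<^bsub>U\<^esub> \<mu> (xs @ b # ys)"
        using w by (intro module_hom_add[OF \<mu>l]) (auto simp: words_mid_iff)
      then show ?thesis
        using g[OF w(1)] g[OF w(2)] g[OF *] c[OF w(1)] c[OF w(2)]
        by (simp add: lhom_minus[OF L.vectorspace_axioms U k] module_hom_add[OF k])
    qed
    have t2: "?k (?g (xs @ (c' \<odot>\<^bsub>A\<^esub> a) # ys) \<ominus>\<^bsub>?L\<^esub> c' \<odot>\<^bsub>?L\<^esub> ?g (xs @ a # ys)) = \<zero>\<^bsub>U\<^esub>"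
      if w: "xs @ a # ys \<in> words A n" and c': "c' \<in> carrier F" for xs c' a ys
    proof -
      have *: "xs @ (c' \<odot>\<^bsub>A\<^esub> a) # ys \<in> words A n" using w c' by (simp add: words_mid_iff)
      have "\<mu> (xs @ (c' \<odot>\<^bsub>A\<^esub> a) # ys) = c' \<odot>\<^bsub>U\<^esub> \<mu> (xs @ a # ys)"
        using w c' by (intro module_hom_smult[OF \<mu>l]) (auto simp: words_mid_iff)
      then show ?thesis
        using g[OF w(1)] g[OF *] c[OF w(1)] c'
        by (simp add: lhom_minus[OF L.vectorspace_axioms U k] module_hom_smult[OF k])
    qed
    from r show ?thesis
      by (cases rule: tpower_relsE) (simp_all only: t1 t2)
  qed
  note l = P.lift[where g = \<mu>, OF U c this]
  show "tpower_lift F A n U \<mu> \<in> lin F (tpower F A n) U"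
    using l(1) by (simp add: tpower_lift_def tpower_def)
  then show "tpower_lift F A n U \<mu> \<in> lhom F (tpower F A n) U" by (rule linD)
  show "tpower_lift F A n U \<mu> (pure_word F A as) = \<mu> as" if "as \<in> words A n" for as
    using l(2)[of as] that by (auto simp: tpower_lift_def pure_word_def words_def)
qed

section \<open>Finite dual bases\<close>

text \<open>The basis is an indexed family, and the axioms treat vectors and functionals in
  parallel, so that the dual space and the tensor powers become further instances. In particular
  \<open>A\<close> and its dual share the index set \<open>J\<close>, and their matrices can be
  transposed into each other.\<close>

locale dual_bases =
  fixes F :: "('f, 'm) ring_scheme" and A :: "('f, 'a, 'n) module_scheme"
    and J :: "'i set" and e :: "'i \<Rightarrow> 'a" and d :: "'i \<Rightarrow> 'a \<Rightarrow> 'f"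
  assumes vs: "vectorspace F A" and fin: "finite J"
    and e_closed: "\<And>i. i \<in> J \<Longrightarrow> e i \<in> carrier A"
    and d_lin: "\<And>i. i \<in> J \<Longrightarrow> d i \<in> lin F A (ground F)"
    and d_e: "\<And>i j. i \<in> J \<Longrightarrow> j \<in> J \<Longrightarrow> d i (e j) = (if i = j then \<one>\<^bsub>F\<^esub> else \<zero>\<^bsub>F\<^esub>)"
    and expand: "\<And>a. a \<in> carrier A \<Longrightarrow> a = finsum A (\<lambda>i. d i a \<odot>\<^bsub>A\<^esub> e i) J"

text \<open>The functional of a basis vector \<open>s\<close> reads off the coefficient of
  \<open>s\<close>. It is linear since sums and multiples of expansions are again expansions, and
  expansions are unique.\<close>

lemma (in vectorspace) dual_bases_exist:
  assumes "fin_dim"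
  shows "\<exists>J d. dual_bases K V J (\<lambda>x. x) d"
proof -
  obtain S where S: "finite S" "basis S" using finite_basis_exists[OF assms] by blast
  have SV: "S \<subseteq> carrier V" using S(2) by (simp add: basis_def)
  have ex: "\<exists>!a. a \<in> S \<rightarrow>\<^sub>E carrier K \<and> lincomb a S = v" if "v \<in> carrier V" for v
    using basis_criterion[OF S(1) SV] S(2) that by blast
  then have ex1_unique: "a = b" if "v \<in> carrier V" "a \<in> S \<rightarrow>\<^sub>E carrier K \<and> lincomb a S = v"
      "b \<in> S \<rightarrow>\<^sub>E carrier K \<and> lincomb b S = v" for v a b
    using that by blast
  define c where "c v = (THE a. a \<in> S \<rightarrow>\<^sub>E carrier K \<and> lincomb a S = v)" for v
  have c: "c v \<in> S \<rightarrow>\<^sub>E carrier K" "lincomb (c v) S = v" if "v \<in> carrier V" for v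
    using theI'[OF ex[OF that]] by (simp_all add: c_def)
  have cF: "c v s \<in> carrier K" if "v \<in> carrier V" "s \<in> S" for v s using c(1)[OF that(1)] that(2) by auto
  have cP: "c v \<in> S \<rightarrow> carrier K" if "v \<in> carrier V" for v using cF that by blast
  \<comment> \<open>Uniqueness is available only among coefficient functions that are
    \<open>undefined\<close> off \<open>S\<close>; restricting \<open>a\<close> brings it into that
    class without changing the combination.\<close>
  have cI: "c v s = a s" if "v \<in> carrier V" "a \<in> S \<rightarrow> carrier K" "lincomb a S = v" "s \<in> S" for v a s
  proof -
    have "lincomb (restrict a S) S = lincomb a S"
      by (rule lincomb_cong[OF refl SV _ that(2)]) simp
    then have l: "lincomb (restrict a S) S = v" using that(3) by (rule trans)
    have "restrict a S \<in> S \<rightarrow>\<^sub>E carrier K" using that(2) by (simp add: restrict_PiE_iff Pi_iff)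
    then have "restrict a S = c v"
      by (intro ex1_unique[OF that(1)] conjI l c[OF that(1)])
    then show ?thesis using that(4) by (metis restrict_apply')
  qed
  have "(\<lambda>v. c v s) \<in> lhom K V (ground K)" if s: "s \<in> S" for s
  proof (rule lhomI, goal_cases)
    case (1 v) then show ?case using cF s by simp
  next
    case (2 v w)
    have "c (v \<oplus>\<^bsub>V\<^esub> w) s = c v s \<oplus>\<^bsub>K\<^esub> c w s"
    proof (rule cI[OF _ _ _ s])
      show "lincomb (\<lambda>s. c v s \<oplus>\<^bsub>K\<^esub> c w s) S = v \<oplus>\<^bsub>V\<^esub> w"
        using lincomb_sum[OF S(1) SV cP[OF 2(1)] cP[OF 2(2)]] by (simp only: c(2)[OF 2(1)] c(2)[OF 2(2)])
      show "v \<oplus>\<^bsub>V\<^esub> w \<in> carrier V" using 2 by simp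
      show "(\<lambda>s. c v s \<oplus>\<^bsub>K\<^esub> c w s) \<in> S \<rightarrow> carrier K" by (intro Pi_I R.a_closed cF 2)
    qed
    then show ?case by simp
  next
    case (3 k v)
    have "c (k \<odot>\<^bsub>V\<^esub> v) s = k \<otimes>\<^bsub>K\<^esub> c v s"
    proof (rule cI[OF _ _ _ s])
      show "lincomb (\<lambda>s. k \<otimes>\<^bsub>K\<^esub> c v s) S = k \<odot>\<^bsub>V\<^esub> v"
        using lincomb_smult[OF SV cP[OF 3(2)] 3(1)] by (simp only: c(2)[OF 3(2)])
      show "k \<odot>\<^bsub>V\<^esub> v \<in> carrier V" using 3 by simp
      show "(\<lambda>s. k \<otimes>\<^bsub>K\<^esub> c v s) \<in> S \<rightarrow> carrier K" by (intro Pi_I R.m_closed cF 3)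
    qed
    then show ?case by simp
  qed
  then have d: "(\<lambda>v\<in>carrier V. c v s) \<in> lin K V (ground K)" if "s \<in> S" for s
    using lin_restrict[OF vectorspace_axioms] that by blast
  have delta: "lincomb (\<lambda>s. if s = t then \<one>\<^bsub>K\<^esub> else \<zero>\<^bsub>K\<^esub>) S = t" if t: "t \<in> S" for t
    unfolding lincomb_def by (rule finsum_delta[OF vectorspace_axioms S(1) t]) (rule subsetD[OF SV])
  have "dual_bases K V S (\<lambda>x. x) (\<lambda>s. \<lambda>v\<in>carrier V. c v s)"
  proof (rule dual_bases.intro)
    show "vectorspace K V" by (rule vectorspace_axioms)
    show "finite S" by (rule S)
    fix s assume s: "s \<in> S"
    show "s \<in> carrier V" using SV s by blast
    show "(\<lambda>v\<in>carrier V. c v s) \<in> lin K V (ground K)" by (rule d[OF s])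
    fix t assume t: "t \<in> S"
    then have tV: "t \<in> carrier V" using SV by blast
    have "c t s = (if s = t then \<one>\<^bsub>K\<^esub> else \<zero>\<^bsub>K\<^esub>)"
      by (rule cI[OF tV _ delta[OF t] s]) simp
    then show "(\<lambda>v\<in>carrier V. c v s) t = (if s = t then \<one>\<^bsub>K\<^esub> else \<zero>\<^bsub>K\<^esub>)" using tV by simp
  next
    fix v assume v: "v \<in> carrier V"
    show "v = (\<Oplus>\<^bsub>V\<^esub>s\<in>S. (\<lambda>v\<in>carrier V. c v s) v \<odot>\<^bsub>V\<^esub> s)"
      using c(2)[OF v] v by (simp add: lincomb_def)
  qed
  then show ?thesis by blast
qed

section \<open>Coordinates, linear extension from a basis, and the basis of the dual\<close>

context dual_bases
begin

lemma F: "field F" by (rule field_vectorspace[OF vs])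

lemma d_lhom: "i \<in> J \<Longrightarrow> d i \<in> lhom F A (ground F)"
  by (rule linD[OF d_lin])

lemma d_closed: "i \<in> J \<Longrightarrow> a \<in> carrier A \<Longrightarrow> d i a \<in> carrier F"
  using lhom_closed[OF d_lhom] by simp

lemma eqI:
  assumes "a \<in> carrier A" "b \<in> carrier A" "\<And>i. i \<in> J \<Longrightarrow> d i a = d i b" shows "a = b"
proof -
  interpret A: vectorspace F A by (rule vs)
  have "finsum A (\<lambda>i. d i a \<odot>\<^bsub>A\<^esub> e i) J = finsum A (\<lambda>i. d i b \<odot>\<^bsub>A\<^esub> e i) J"
    using assms d_closed e_closed by (intro A.M.finsum_cong') auto
  then show ?thesis using expand[OF assms(1)] expand[OF assms(2)] by simp
qed

lemma lhom_expand:
  assumes U: "vectorspace F U" and h: "h \<in> lhom F A U" and a: "a \<in> carrier A"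
  shows "h a = finsum U (\<lambda>i. d i a \<odot>\<^bsub>U\<^esub> h (e i)) J"
proof -
  interpret A: vectorspace F A by (rule vs)
  interpret U: vectorspace F U by (rule U)
  have "h a = h (finsum A (\<lambda>i. d i a \<odot>\<^bsub>A\<^esub> e i) J)" using expand[OF a] by simp
  also have "\<dots> = finsum U (\<lambda>i. h (d i a \<odot>\<^bsub>A\<^esub> e i)) J"
    using d_closed[OF _ a] e_closed by (intro lhom_finsum[OF vs U h]) simp
  also have "\<dots> = finsum U (\<lambda>i. d i a \<odot>\<^bsub>U\<^esub> h (e i)) J"
    using d_closed[OF _ a] e_closed lhom_closed[OF h]
    by (intro U.M.finsum_cong') (simp_all add: module_hom_smult[OF h])
  finally show ?thesis .
qed

lemma lhom_eqI:
  assumes U: "vectorspace F U" and h: "h \<in> lhom F A U" "h' \<in> lhom F A U"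
    and eq: "\<And>i. i \<in> J \<Longrightarrow> h (e i) = h' (e i)" and a: "a \<in> carrier A"
  shows "h a = h' a"
proof -
  interpret U: vectorspace F U by (rule U)
  show ?thesis
    unfolding lhom_expand[OF U h(1) a] lhom_expand[OF U h(2) a]
    using d_closed[OF _ a] e_closed lhom_closed[OF h(2)] eq by (intro U.M.finsum_cong') auto
qed

lemma d_sum:
  assumes i: "i \<in> J" and c: "\<And>j. j \<in> J \<Longrightarrow> c j \<in> carrier F"
  shows "d i (finsum A (\<lambda>j. c j \<odot>\<^bsub>A\<^esub> e j) J) = c i"
proof -
  interpret A: vectorspace F A by (rule vs)
  interpret G: vectorspace F "ground F" by (rule ground_vs[OF F])
  have "d i (finsum A (\<lambda>j. c j \<odot>\<^bsub>A\<^esub> e j) J) = finsum (ground F) (\<lambda>j. d i (c j \<odot>\<^bsub>A\<^esub> e j)) J"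
    using c e_closed by (intro lhom_finsum[OF vs G.vectorspace_axioms d_lhom[OF i]]) simp
  also have "\<dots> = finsum (ground F) (\<lambda>j. (if j = i then \<one>\<^bsub>F\<^esub> else \<zero>\<^bsub>F\<^esub>) \<odot>\<^bsub>ground F\<^esub> c j) J"
    using c e_closed i
    by (intro G.M.finsum_cong')
       (auto simp: module_hom_smult[OF d_lhom[OF i]] d_e simp del: G.smult_closed)
  also have "\<dots> = c i"
    using c by (intro finsum_delta[OF G.vectorspace_axioms fin i]) simp
  finally show ?thesis .
qed

lemma sum_closed:
  assumes "\<And>j. j \<in> J \<Longrightarrow> c j \<in> carrier F" shows "finsum A (\<lambda>j. c j \<odot>\<^bsub>A\<^esub> e j) J \<in> carrier A"
proof -
  interpret A: vectorspace F A by (rule vs)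
  show ?thesis using assms e_closed by (intro A.M.finsum_closed) auto
qed

text \<open>The existence half of the universal property of a basis; \<open>mat_op\<close> and
  \<open>mat_coact\<close> are built from this formula.\<close>

lemma extend_lhom:
  assumes U: "vectorspace F U" and u: "\<And>i. i \<in> J \<Longrightarrow> u i \<in> carrier U"
  shows "(\<lambda>a. finsum U (\<lambda>i. d i a \<odot>\<^bsub>U\<^esub> u i) J) \<in> lhom F A U"
    and "\<And>j. j \<in> J \<Longrightarrow> finsum U (\<lambda>i. d i (e j) \<odot>\<^bsub>U\<^esub> u i) J = u j"
proof -
  interpret U: vectorspace F U by (rule U)
  show "(\<lambda>a. finsum U (\<lambda>i. d i a \<odot>\<^bsub>U\<^esub> u i) J) \<in> lhom F A U"
    by (intro lhom_finsum_fun[OF vs U] lhom_comp[OF d_lhom bilin_left[OF smult_bilin[OF U]]] u)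
  show "finsum U (\<lambda>i. d i (e j) \<odot>\<^bsub>U\<^esub> u i) J = u j" if j: "j \<in> J" for j
  proof -
    have "finsum U (\<lambda>i. d i (e j) \<odot>\<^bsub>U\<^esub> u i) J
        = finsum U (\<lambda>i. (if i = j then \<one>\<^bsub>F\<^esub> else \<zero>\<^bsub>F\<^esub>) \<odot>\<^bsub>U\<^esub> u i) J"
      using u j by (intro U.M.finsum_cong') (auto simp: d_e)
    also have "\<dots> = u j" by (rule finsum_delta[OF U fin j u])
    finally show ?thesis .
  qed
qed

lemma eval_lin:
  assumes "a \<in> carrier A" shows "eval_bidual F A a \<in> lin F (dual F A) (ground F)"
proof -
  have "(\<lambda>\<phi>. \<phi> a) \<in> lhom F (dual F A) (ground F)"
    using assms by (intro lhomI) (auto simp: dual_simps[OF F] lin_def dest: lhom_closed)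
  from lin_restrict[OF dual_vs[OF vs] this] show ?thesis using assms by (simp add: eval_bidual_def)
qed

lemma eval_apply:
  "a \<in> carrier A \<Longrightarrow> \<phi> \<in> carrier (dual F A) \<Longrightarrow> eval_bidual F A a \<phi> = \<phi> a"
  by (simp add: eval_bidual_def)

lemma d_dual: "i \<in> J \<Longrightarrow> d i \<in> carrier (dual F A)"
  using d_lin by (simp add: dual_simps[OF F])

lemma dual_lhom: "\<phi> \<in> carrier (dual F A) \<longleftrightarrow> \<phi> \<in> lin F A (ground F)"
  by (simp add: dual_simps[OF F])

lemma dual_eqI:
  assumes "\<phi> \<in> carrier (dual F A)" "\<psi> \<in> carrier (dual F A)" "\<And>i. i \<in> J \<Longrightarrow> \<phi> (e i) = \<psi> (e i)"
  shows "\<phi> = \<psi>"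
proof -
  have l: "\<phi> \<in> lin F A (ground F)" "\<psi> \<in> lin F A (ground F)"
    using assms(1,2) by (simp_all only: dual_lhom)
  show ?thesis
    by (rule lin_eqI[OF l]) (rule lhom_eqI[OF ground_vs[OF F] linD[OF l(1)] linD[OF l(2)] assms(3)])
qed

lemma dual_apply_lhom: "a \<in> carrier A \<Longrightarrow> (\<lambda>\<phi>. \<phi> a) \<in> lhom F (dual F A) (ground F)"
  by (intro lhomI) (auto simp: dual_simps[OF F] lin_def dest: lhom_closed)

text \<open>Vectors and functionals exchange roles: a functional equals the combination of the
  \<open>d i\<close> with its values at the \<open>e i\<close>, because both agree on the basis.
  Everything proved in the locale thereby also holds for the dual.\<close>

lemma dual: "dual_bases F (dual F A) J d (\<lambda>i. eval_bidual F A (e i))"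
proof -
  let ?D = "dual F A"
  interpret D: vectorspace F ?D by (rule dual_vs[OF vs])
  interpret G: vectorspace F "ground F" by (rule ground_vs[OF F])
  show ?thesis
  proof (rule dual_bases.intro, goal_cases)
    case (6 \<phi>)
    have \<phi>: "\<phi> \<in> lhom F A (ground F)" using 6 by (simp add: dual_lhom lin_def)
    have c: "eval_bidual F A (e i) \<phi> = \<phi> (e i)" "\<phi> (e i) \<in> carrier F" if "i \<in> J" for i
      using eval_apply[OF e_closed[OF that] 6] lhom_closed[OF \<phi> e_closed[OF that]] by simp_all
    have sc: "(\<lambda>i. eval_bidual F A (e i) \<phi> \<odot>\<^bsub>?D\<^esub> d i) \<in> J \<rightarrow> carrier ?D"
      by (intro Pi_I D.smult_closed d_dual) (simp_all add: c)
    show ?case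
    proof (rule dual_eqI[OF 6 D.M.finsum_closed[OF sc]])
      fix j assume j: "j \<in> J"
      have "finsum ?D (\<lambda>i. eval_bidual F A (e i) \<phi> \<odot>\<^bsub>?D\<^esub> d i) J (e j)
          = finsum (ground F) (\<lambda>i. (eval_bidual F A (e i) \<phi> \<odot>\<^bsub>?D\<^esub> d i) (e j)) J"
        using sc by (intro lhom_finsum[OF D.vectorspace_axioms G.vectorspace_axioms dual_apply_lhom[OF e_closed[OF j]]]) auto
      also have "\<dots> = finsum (ground F) (\<lambda>i. (if i = j then \<one>\<^bsub>F\<^esub> else \<zero>\<^bsub>F\<^esub>) \<odot>\<^bsub>ground F\<^esub> \<phi> (e i)) J"
        using c j e_closed
        by (intro G.M.finsum_cong') (auto simp: dual_simps[OF F] d_e simp del: G.smult_closed)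
      also have "\<dots> = \<phi> (e j)" using c by (intro finsum_delta[OF G.vectorspace_axioms fin j]) simp
      finally show "\<phi> (e j) = finsum ?D (\<lambda>i. eval_bidual F A (e i) \<phi> \<odot>\<^bsub>?D\<^esub> d i) J (e j)" by simp
    qed
  next
    case 1 show ?case by (rule D.vectorspace_axioms)
  next
    case 2 show ?case by (rule fin)
  next
    case (3 i) then show ?case by (rule d_dual)
  next
    case (4 i) show ?case by (rule eval_lin[OF e_closed[OF 4]])
  next
    case (5 i j)
    show ?case
      using d_e[OF 5(2,1)] by (simp add: eval_apply[OF e_closed[OF 5(1)] d_dual[OF 5(2)]] eq_commute)
  qed
qed

end

section \<open>Coordinates in a tensor product\<close>

text \<open>This is \<open>\<phi> \<otimes> id\<close> followed by the identification of
  \<open>F \<otimes> Q\<close> with \<open>Q\<close>. For \<open>\<phi> = d i\<close> it extracts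
  the coefficient in \<open>Q\<close> of the basis vector \<open>e i\<close>.\<close>

definition contract ::
  "('f, 'm) ring_scheme \<Rightarrow> ('f, 'a, 'n) module_scheme \<Rightarrow> ('f, 'q, 'k) module_scheme
    \<Rightarrow> ('a \<Rightarrow> 'f) \<Rightarrow> ('f, 'a, 'q) tensor_elem \<Rightarrow> 'q"
  where "contract F A Q \<phi> = tensor_lift F A Q Q (\<lambda>a q. \<phi> a \<odot>\<^bsub>Q\<^esub> q)"

lemma contract:
  assumes A: "vectorspace F A" and Q: "vectorspace F Q" and \<phi>: "\<phi> \<in> lhom F A (ground F)"
  shows contract_lhom: "contract F A Q \<phi> \<in> lhom F (tensor F A Q) Q"
    and contract_pure: "\<And>a q. a \<in> carrier A \<Longrightarrow> q \<in> carrier Q \<Longrightarrow>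
      contract F A Q \<phi> (pure_tensor F A Q a q) = \<phi> a \<odot>\<^bsub>Q\<^esub> q"
proof -
  note b = bilin_comp[OF smult_bilin[OF Q] \<phi> lhom_id lhom_id]
  show "contract F A Q \<phi> \<in> lhom F (tensor F A Q) Q"
    unfolding contract_def by (rule tensor_lift_lhom[OF A Q Q b])
  show "contract F A Q \<phi> (pure_tensor F A Q a q) = \<phi> a \<odot>\<^bsub>Q\<^esub> q"
    if "a \<in> carrier A" "q \<in> carrier Q" for a q
    unfolding contract_def by (rule tensor_lift_pure[OF A Q Q b that])
qed

lemma contract_closed:
  assumes "vectorspace F A" "vectorspace F Q" "\<phi> \<in> lhom F A (ground F)" "z \<in> carrier (tensor F A Q)"
  shows "contract F A Q \<phi> z \<in> carrier Q"
  by (rule lhom_closed[OF contract_lhom[OF assms(1-3)] assms(4)])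

text \<open>Naturality in both factors: the map on the first factor is absorbed by the functional,
  the map on the second is applied to the result. By linearity in \<open>z\<close>, pure tensors
  decide.\<close>

lemma contract_map:
  assumes A: "vectorspace F A" and A': "vectorspace F A'" and Q: "vectorspace F Q" and Q': "vectorspace F Q'"
    and f: "f \<in> lhom F A A'" and g: "g \<in> lhom F Q Q'" and \<phi>: "\<phi> \<in> lhom F A' (ground F)"
    and z: "z \<in> carrier (tensor F A Q)"
  shows "contract F A' Q' \<phi> (tensor_map F A Q A' Q' f g z) = g (contract F A Q (\<lambda>a. \<phi> (f a)) z)"
proof (rule tensor_eqI[OF A Q Q' _ _ _ z])
  note t = tensor_map_lhom[OF A Q A' Q' f g] and t' = tensor_map_pure[OF A Q A' Q' f g]
  note f\<phi> = lhom_comp[OF f \<phi>]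
  show "(\<lambda>z. contract F A' Q' \<phi> (tensor_map F A Q A' Q' f g z)) \<in> lhom F (tensor F A Q) Q'"
    by (rule lhom_comp[OF t contract_lhom[OF A' Q' \<phi>]])
  show "(\<lambda>z. g (contract F A Q (\<lambda>a. \<phi> (f a)) z)) \<in> lhom F (tensor F A Q) Q'"
    by (rule lhom_comp[OF contract_lhom[OF A Q f\<phi>] g])
  fix a q assume a: "a \<in> carrier A" and q: "q \<in> carrier Q"
  have c: "\<phi> (f a) \<in> carrier F" using lhom_closed[OF f\<phi> a] by simp
  have "contract F A' Q' \<phi> (tensor_map F A Q A' Q' f g (pure_tensor F A Q a q)) = \<phi> (f a) \<odot>\<^bsub>Q'\<^esub> g q"
    unfolding t'[OF a q] by (rule contract_pure[OF A' Q' \<phi> lhom_closed[OF f a] lhom_closed[OF g q]])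
  also have "\<dots> = g (\<phi> (f a) \<odot>\<^bsub>Q\<^esub> q)" by (rule module_hom_smult[OF g c q, symmetric])
  finally show "contract F A' Q' \<phi> (tensor_map F A Q A' Q' f g (pure_tensor F A Q a q))
      = g (contract F A Q (\<lambda>a. \<phi> (f a)) (pure_tensor F A Q a q))"
    by (simp only: contract_pure[OF A Q f\<phi> a q])
qed

context dual_bases
begin

abbreviation coord where "coord Q i \<equiv> contract F A Q (d i)"

text \<open>The functional is the combination of the \<open>d i\<close> with coefficients
  \<open>\<phi> (e i)\<close>, and contraction is linear in the functional.\<close>

lemma contract_expand:
  assumes Q: "vectorspace F Q" and \<phi>: "\<phi> \<in> lhom F A (ground F)" and z: "z \<in> carrier (tensor F A Q)"
  shows "contract F A Q \<phi> z = finsum Q (\<lambda>i. \<phi> (e i) \<odot>\<^bsub>Q\<^esub> coord Q i z) J"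
proof (rule tensor_eqI[OF vs Q Q contract_lhom[OF vs Q \<phi>] _ _ z])
  interpret Q: vectorspace F Q by (rule Q)
  interpret G: vectorspace F "ground F" by (rule ground_vs[OF F])
  have \<phi>e: "\<phi> (e i) \<in> carrier F" if "i \<in> J" for i using lhom_closed[OF \<phi> e_closed[OF that]] by simp
  show "(\<lambda>z. finsum Q (\<lambda>i. \<phi> (e i) \<odot>\<^bsub>Q\<^esub> coord Q i z) J) \<in> lhom F (tensor F A Q) Q"
    by (intro lhom_finsum_fun[OF tensor_vs[OF vs Q] Q] lhom_smult_fun[OF Q] contract_lhom[OF vs Q] d_lhom \<phi>e)
  fix a q assume a: "a \<in> carrier A" and q: "q \<in> carrier Q"
  have "contract F A Q \<phi> (pure_tensor F A Q a q) = \<phi> a \<odot>\<^bsub>Q\<^esub> q" by (rule contract_pure[OF vs Q \<phi> a q])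
  also have "\<phi> a \<odot>\<^bsub>Q\<^esub> q = finsum F (\<lambda>i. d i a \<otimes>\<^bsub>F\<^esub> \<phi> (e i)) J \<odot>\<^bsub>Q\<^esub> q"
    using lhom_expand[OF G.vectorspace_axioms \<phi> a] by simp
  also have "\<dots> = finsum Q (\<lambda>i. (d i a \<otimes>\<^bsub>F\<^esub> \<phi> (e i)) \<odot>\<^bsub>Q\<^esub> q) J"
    using d_closed[OF _ a] \<phi>e q by (intro Q.finsum_smult_r) auto
  also have "\<dots> = finsum Q (\<lambda>i. \<phi> (e i) \<odot>\<^bsub>Q\<^esub> coord Q i (pure_tensor F A Q a q)) J"
  proof (intro Q.M.finsum_cong' refl)
    fix i assume i: "i \<in> J"
    show "(d i a \<otimes>\<^bsub>F\<^esub> \<phi> (e i)) \<odot>\<^bsub>Q\<^esub> q = \<phi> (e i) \<odot>\<^bsub>Q\<^esub> coord Q i (pure_tensor F A Q a q)"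
      using d_closed[OF i a] \<phi>e[OF i] q
      by (simp only: contract_pure[OF vs Q d_lhom[OF i] a q] Q.smult_assoc1[symmetric] Q.R.m_comm)
  qed (use d_closed[OF _ a] \<phi>e q in \<open>auto simp: contract_pure[OF vs Q d_lhom _ q] a\<close>)
  finally show "contract F A Q \<phi> (pure_tensor F A Q a q)
      = finsum Q (\<lambda>i. \<phi> (e i) \<odot>\<^bsub>Q\<^esub> coord Q i (pure_tensor F A Q a q)) J" .
qed

text \<open>On a pure tensor, \<open>a\<close> is expanded in the basis and the scalars
  \<open>d i a\<close> are moved across the tensor sign into \<open>Q\<close>.\<close>

lemma tensor_expand:
  assumes Q: "vectorspace F Q" and z: "z \<in> carrier (tensor F A Q)"
  shows "z = finsum (tensor F A Q) (\<lambda>i. pure_tensor F A Q (e i) (coord Q i z)) J"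
proof (rule tensor_eqI[OF vs Q tensor_vs[OF vs Q] lhom_id _ _ z])
  note T = tensor_vs[OF vs Q]
  interpret T: vectorspace F "tensor F A Q" by (rule T)
  note b = pure_tensor_bilin[OF vs Q]
  show "(\<lambda>z. finsum (tensor F A Q) (\<lambda>i. pure_tensor F A Q (e i) (coord Q i z)) J)
      \<in> lhom F (tensor F A Q) (tensor F A Q)"
    by (intro lhom_finsum_fun[OF T T] lhom_comp[OF contract_lhom[OF vs Q d_lhom] bilin_right[OF b]] e_closed)
  fix a q assume a: "a \<in> carrier A" and q: "q \<in> carrier Q"
  have "pure_tensor F A Q a q = finsum (tensor F A Q) (\<lambda>i. d i a \<odot>\<^bsub>tensor F A Q\<^esub> pure_tensor F A Q (e i) q) J"
    by (rule lhom_expand[OF T bilin_left[OF b q] a])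
  also have "\<dots> = finsum (tensor F A Q) (\<lambda>i. pure_tensor F A Q (e i) (coord Q i (pure_tensor F A Q a q))) J"
  proof (intro T.M.finsum_cong' refl)
    fix i assume i: "i \<in> J"
    show "d i a \<odot>\<^bsub>tensor F A Q\<^esub> pure_tensor F A Q (e i) q
        = pure_tensor F A Q (e i) (coord Q i (pure_tensor F A Q a q))"
      by (simp only: contract_pure[OF vs Q d_lhom[OF i] a q]
          module_hom_smult[OF bilin_right[OF b e_closed[OF i]] d_closed[OF i a] q])
  qed (auto intro!: pure_tensor_closed[OF vs Q] e_closed contract_closed[OF vs Q d_lhom] a q)
  finally show "pure_tensor F A Q a q
    = finsum (tensor F A Q) (\<lambda>i. pure_tensor F A Q (e i) (coord Q i (pure_tensor F A Q a q))) J" .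
qed

text \<open>Coordinates determine a tensor, by the expansion just proved. This is what allows
  identities in \<open>A \<otimes> Q\<close> to be replaced by identities between entries in
  \<open>Q\<close>.\<close>

lemma tensor_coord_eqI:
  assumes Q: "vectorspace F Q" and z: "z \<in> carrier (tensor F A Q)" "z' \<in> carrier (tensor F A Q)"
    and eq: "\<And>i. i \<in> J \<Longrightarrow> coord Q i z = coord Q i z'"
  shows "z = z'"
proof -
  interpret T: vectorspace F "tensor F A Q" by (rule tensor_vs[OF vs Q])
  have "finsum (tensor F A Q) (\<lambda>i. pure_tensor F A Q (e i) (coord Q i z)) J
      = finsum (tensor F A Q) (\<lambda>i. pure_tensor F A Q (e i) (coord Q i z')) J"
    by (intro T.M.finsum_cong')
       (auto intro!: pure_tensor_closed[OF vs Q] e_closed contract_closed[OF vs Q d_lhom] z simp: eq)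
  then show ?thesis using tensor_expand[OF Q z(1)] tensor_expand[OF Q z(2)] by simp
qed

lemma coord_sum:
  assumes Q: "vectorspace F Q" and i: "i \<in> J" and q: "\<And>j. j \<in> J \<Longrightarrow> q j \<in> carrier Q"
  shows "coord Q i (finsum (tensor F A Q) (\<lambda>j. pure_tensor F A Q (e j) (q j)) J) = q i"
proof -
  interpret Q: vectorspace F Q by (rule Q)
  have "coord Q i (finsum (tensor F A Q) (\<lambda>j. pure_tensor F A Q (e j) (q j)) J)
      = finsum Q (\<lambda>j. coord Q i (pure_tensor F A Q (e j) (q j))) J"
    by (intro lhom_finsum[OF tensor_vs[OF vs Q] Q contract_lhom[OF vs Q d_lhom[OF i]]]
        pure_tensor_closed[OF vs Q] e_closed q)
  also have "\<dots> = finsum Q (\<lambda>j. (if j = i then \<one>\<^bsub>F\<^esub> else \<zero>\<^bsub>F\<^esub>) \<odot>\<^bsub>Q\<^esub> q j) J"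
    using q i by (intro Q.M.finsum_cong')
      (auto simp: contract_pure[OF vs Q d_lhom[OF i] e_closed q] d_e)
  also have "\<dots> = q i" by (rule finsum_delta[OF Q fin i q])
  finally show ?thesis .
qed

end

section \<open>Multilinear maps in coordinates\<close>

lemma multilin_0_iff: "multilin F A 0 U \<mu> \<longleftrightarrow> \<mu> [] \<in> carrier U"
  by (simp add: multilin_def words_0)

text \<open>Splits off the first letter. The definition of \<open>multilin\<close> varies an
  arbitrary slot, whereas \<open>rho_word\<close> and the inductions below recurse on the head of
  the word.\<close>

lemma multilin_Suc_iff:
  "multilin F A (Suc n) U \<mu> \<longleftrightarrow> (\<forall>as\<in>words A n. (\<lambda>a. \<mu> (a # as)) \<in> lhom F A U) \<and>
    (\<forall>a\<in>carrier A. multilin F A n U (\<lambda>as. \<mu> (a # as)))" (is "?l \<longleftrightarrow> ?r1 \<and> ?r2")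
proof (intro iffI conjI)
  assume l: ?l
  have lin: "(\<lambda>a. \<mu> (xs @ a # ys)) \<in> lhom F A U"
    if "xs \<in> lists (carrier A)" "ys \<in> lists (carrier A)" "length xs + length ys = n" for xs ys
    using l that unfolding multilin_def by blast
  show ?r1
  proof
    fix as assume "as \<in> words A n"
    then show "(\<lambda>a. \<mu> (a # as)) \<in> lhom F A U" using lin[of "[]" as] by (simp add: words_def)
  qed
  show ?r2 unfolding multilin_def
  proof (intro ballI conjI allI impI)
    fix a as assume "a \<in> carrier A" "as \<in> words A n"
    then show "\<mu> (a # as) \<in> carrier U"
      using l by (intro multilin_closed[OF l]) (simp add: words_Cons_iff)
  next
    fix a xs ys assume "a \<in> carrier A" "xs \<in> lists (carrier A)" "ys \<in> lists (carrier A)"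
      "Suc (length xs + length ys) = n"
    then show "(\<lambda>b. \<mu> (a # xs @ b # ys)) \<in> lhom F A U" using lin[of "a # xs" ys] by simp
  qed
next
  assume r: "?r1 \<and> ?r2"
  show ?l unfolding multilin_def
  proof (intro ballI conjI allI impI)
    fix as assume "as \<in> words A (Suc n)"
    then obtain a as' where "as = a # as'" "a \<in> carrier A" "as' \<in> words A n" by (auto simp: words_Suc)
    then show "\<mu> as \<in> carrier U" using r by (auto simp: multilin_def)
  next
    fix xs ys assume xs: "xs \<in> lists (carrier A)" and ys: "ys \<in> lists (carrier A)"
      and len: "Suc (length xs + length ys) = Suc n"
    show "(\<lambda>b. \<mu> (xs @ b # ys)) \<in> lhom F A U"
    proof (cases xs)
      case Nil
      then have "ys \<in> words A n" using ys len by (simp add: words_def)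
      then show ?thesis using r Nil by simp
    next
      case (Cons a xs')
      then have a: "a \<in> carrier A" and xs': "xs' \<in> lists (carrier A)" using xs by simp_all
      have "multilin F A n U (\<lambda>as. \<mu> (a # as))" using r a by blast
      then show ?thesis using xs' ys len Cons unfolding multilin_def by simp
    qed
  qed
qed

lemma multilin_comp:
  assumes \<mu>: "multilin F A n U \<mu>" and h: "h \<in> lhom F U U'"
  shows "multilin F A n U' (\<lambda>as. h (\<mu> as))"
  unfolding multilin_def
proof (intro conjI ballI allI impI)
  fix as assume "as \<in> words A n"
  then show "h (\<mu> as) \<in> carrier U'" by (intro lhom_closed[OF h] multilin_closed[OF \<mu>])
next
  fix xs ys assume "xs \<in> lists (carrier A)" "ys \<in> lists (carrier A)" "Suc (length xs + length ys) = n"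
  then have "(\<lambda>a. \<mu> (xs @ a # ys)) \<in> lhom F A U" using \<mu> unfolding multilin_def by blast
  then show "(\<lambda>a. h (\<mu> (xs @ a # ys))) \<in> lhom F A U'" by (rule lhom_comp[OF _ h])
qed

lemma multilin_cong:
  assumes A: "vectorspace F A" and eq: "\<And>as. as \<in> words A n \<Longrightarrow> \<mu> as = \<nu> as"
    and \<nu>: "multilin F A n U \<nu>"
  shows "multilin F A n U \<mu>"
  unfolding multilin_def
proof (intro conjI ballI allI impI)
  fix as assume "as \<in> words A n"
  then show "\<mu> as \<in> carrier U" using multilin_closed[OF \<nu>] eq by simp
next
  fix xs ys assume *: "xs \<in> lists (carrier A)" "ys \<in> lists (carrier A)" "Suc (length xs + length ys) = n"
  then have l: "(\<lambda>a. \<nu> (xs @ a # ys)) \<in> lhom F A U" using \<nu> unfolding multilin_def by blast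
  have "\<mu> (xs @ a # ys) = \<nu> (xs @ a # ys)" if "a \<in> carrier A" for a
    using that * by (intro eq) (simp add: words_mid_iff)
  then show "(\<lambda>a. \<mu> (xs @ a # ys)) \<in> lhom F A U"
    using lhom_cong[OF A, of "\<lambda>a. \<mu> (xs @ a # ys)" "\<lambda>a. \<nu> (xs @ a # ys)" U] l by simp
qed

text \<open>Literally the expression inside \<open>tpower_dual\<close>, named so that it can be
  folded there. It is the pairing of words of functionals with words of vectors.\<close>

definition word_eval :: "('f, 'm) ring_scheme \<Rightarrow> ('a \<Rightarrow> 'f) list \<Rightarrow> 'a list \<Rightarrow> 'f"
  where "word_eval F fs as = foldr (\<lambda>(f, a) r. f a \<otimes>\<^bsub>F\<^esub> r) (zip fs as) \<one>\<^bsub>F\<^esub>"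

lemma word_eval_simps [simp]:
  "word_eval F [] as = \<one>\<^bsub>F\<^esub>" "word_eval F (f # fs) (a # as) = f a \<otimes>\<^bsub>F\<^esub> word_eval F fs as"
  by (simp_all add: word_eval_def)

lemma word_eval_multilin:
  assumes A: "vectorspace F A" and fs: "set fs \<subseteq> lhom F A (ground F)"
  shows "multilin F A (length fs) (ground F) (word_eval F fs)"
  using fs
proof (induct fs)
  case Nil
  interpret field F by (rule field_vectorspace[OF A])
  show ?case by (simp add: multilin_0_iff)
next
  case (Cons f fs)
  note b = smult_bilin[OF ground_vs[OF field_vectorspace[OF A]]]
  have f: "f \<in> lhom F A (ground F)" using Cons.prems by simp
  have m: "multilin F A (length fs) (ground F) (word_eval F fs)" using Cons by simp
  have "(\<lambda>a. f a \<otimes>\<^bsub>F\<^esub> word_eval F fs as) \<in> lhom F A (ground F)" if "as \<in> words A (length fs)" for as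
    using lhom_comp[OF f bilin_left[OF b multilin_closed[OF m that]]] by simp
  moreover have "multilin F A (length fs) (ground F) (\<lambda>as. f a \<otimes>\<^bsub>F\<^esub> word_eval F fs as)"
    if "a \<in> carrier A" for a
    using multilin_comp[OF m bilin_right[OF b lhom_closed[OF f that]]] by simp
  ultimately show ?case by (simp add: multilin_Suc_iff)
qed

text \<open>The pairing is symmetric once vectors are read as functionals on the dual.
  Multilinearity in the functionals is thereby reduced to multilinearity in the vectors, applied to
  the dual space.\<close>

lemma word_eval_eval_bidual:
  assumes "fs \<in> words (dual F A) n" "as \<in> words A n"
  shows "word_eval F (map (eval_bidual F A) as) fs = word_eval F fs as"
  using assms
proof (induct n arbitrary: fs as)
  case (Suc n)
  then obtain f fs' a as' where "fs = f # fs'" "as = a # as'" "f \<in> carrier (dual F A)" "a \<in> carrier A"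
      "fs' \<in> words (dual F A) n" "as' \<in> words A n"
    by (auto simp: words_Suc)
  then show ?case using Suc.hyps[of fs' as'] by (simp add: eval_bidual_def)
qed (simp add: words_0)

section \<open>Multi-indices and the induced bases of the tensor powers\<close>

abbreviation idx :: "'i set \<Rightarrow> nat \<Rightarrow> 'i list set"
  where "idx J n \<equiv> {I \<in> lists J. length I = n}"

lemma idx_0: "idx J 0 = {[]}" by auto

lemma idx_Suc: "idx J (Suc n) = (\<Union>i\<in>J. (\<lambda>I. i # I) ` idx J n)"
  by (force simp: length_Suc_conv)

lemma idx_finite: "finite J \<Longrightarrow> finite (idx J n)"
  using finite_lists_length_eq[of J n] by (simp add: lists_eq_set)

lemma finsum_idx_Suc:
  assumes U: "vectorspace F U" and J: "finite J" and f: "\<And>I. I \<in> idx J (Suc n) \<Longrightarrow> f I \<in> carrier U"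
  shows "finsum U f (idx J (Suc n)) = finsum U (\<lambda>i. finsum U (\<lambda>I. f (i # I)) (idx J n)) J"
proof -
  interpret U: vectorspace F U by (rule U)
  have c: "f (i # I) \<in> carrier U" if "i \<in> J" "I \<in> idx J n" for i I using that by (intro f) simp
  have "finsum U f (idx J (Suc n)) = finsum U (\<lambda>i. finsum U f ((\<lambda>I. i # I) ` idx J n)) J"
    unfolding idx_Suc
  proof (rule U.M.add.finprod_UN_disjoint[OF J])
    show "finite ((\<lambda>I. i # I) ` idx J n)" for i using idx_finite[OF J] by blast
    show "pairwise (\<lambda>i j. disjnt ((\<lambda>I. i # I) ` idx J n) ((\<lambda>I. j # I) ` idx J n)) J"
      by (auto simp: pairwise_def disjnt_def)
    show "f x \<in> carrier U" if "i \<in> J" "x \<in> (\<lambda>I. i # I) ` idx J n" for i x using that c by blast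
  qed
  also have "\<dots> = finsum U (\<lambda>i. finsum U (\<lambda>I. f (i # I)) (idx J n)) J"
  proof (rule U.M.finsum_cong'[OF refl])
    show "(\<lambda>i. finsum U (\<lambda>I. f (i # I)) (idx J n)) \<in> J \<rightarrow> carrier U"
      by (intro Pi_I U.M.finsum_closed c)
    show "finsum U f ((\<lambda>I. i # I) ` idx J n) = finsum U (\<lambda>I. f (i # I)) (idx J n)" if "i \<in> J" for i
      using c[OF that] by (intro U.M.finsum_reindex) (auto simp: inj_on_def)
  qed
  finally show ?thesis .
qed

context dual_bases
begin

lemma map_e_words: "I \<in> idx J n \<Longrightarrow> map e I \<in> words A n"
  using e_closed by (auto simp: words_def)

lemma map_d_words: "I \<in> idx J n \<Longrightarrow> map d I \<in> words (dual F A) n"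
  using d_dual by (auto simp: words_def)

lemma word_eval_d_multilin: "I \<in> idx J n \<Longrightarrow> multilin F A n (ground F) (word_eval F (map d I))"
  using word_eval_multilin[OF vs, of "map d I"] d_lhom by (simp add: image_subset_iff in_lists_conv_set)

lemma word_eval_d_closed: "I \<in> idx J n \<Longrightarrow> as \<in> words A n \<Longrightarrow> word_eval F (map d I) as \<in> carrier F"
  using multilin_closed[OF word_eval_d_multilin] by simp

text \<open>The first letter is expanded by \<open>lhom_expand\<close>, the remaining ones by
  induction; the coordinates of the letters multiply up to \<open>word_eval\<close>.\<close>

lemma multilin_expand:
  assumes U: "vectorspace F U" and \<mu>: "multilin F A n U \<mu>" and as: "as \<in> words A n"
  shows "\<mu> as = finsum U (\<lambda>I. word_eval F (map d I) as \<odot>\<^bsub>U\<^esub> \<mu> (map e I)) (idx J n)"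
  using \<mu> as
proof (induct n arbitrary: \<mu> as)
  case 0
  interpret U: vectorspace F U by (rule U)
  have "as = []" "\<mu> [] \<in> carrier U" using 0 by (simp_all add: words_0 multilin_0_iff)
  then show ?case unfolding idx_0 by simp
next
  case (Suc n)
  interpret U: vectorspace F U by (rule U)
  obtain a as' where as: "as = a # as'" and a: "a \<in> carrier A" and as': "as' \<in> words A n"
    using Suc.prems(2) by (auto simp: words_Suc)
  have lin: "(\<lambda>a. \<mu> (a # as')) \<in> lhom F A U" using Suc.prems(1) as' by (simp add: multilin_Suc_iff)
  have mul: "multilin F A n U (\<lambda>as. \<mu> (e i # as))" if "i \<in> J" for i
    using Suc.prems(1) e_closed[OF that] by (simp add: multilin_Suc_iff)
  have c: "\<mu> (e i # map e I) \<in> carrier U" if "i \<in> J" "I \<in> idx J n" for i I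
    by (rule multilin_closed[OF mul[OF that(1)] map_e_words[OF that(2)]])
  note w = word_eval_d_closed[OF _ as']
  have "\<mu> as = finsum U (\<lambda>i. d i a \<odot>\<^bsub>U\<^esub> \<mu> (e i # as')) J"
    unfolding as by (rule lhom_expand[OF U lin a])
  also have "\<dots> = finsum U (\<lambda>i. finsum U (\<lambda>I. word_eval F (map d (i # I)) as \<odot>\<^bsub>U\<^esub> \<mu> (map e (i # I))) (idx J n)) J"
  proof (rule U.M.finsum_cong'[OF refl])
    show "(\<lambda>i. finsum U (\<lambda>I. word_eval F (map d (i # I)) as \<odot>\<^bsub>U\<^esub> \<mu> (map e (i # I))) (idx J n)) \<in> J \<rightarrow> carrier U"
      unfolding as using c w d_closed[OF _ a] by (intro Pi_I U.M.finsum_closed) simp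
    fix i assume i: "i \<in> J"
    have "d i a \<odot>\<^bsub>U\<^esub> \<mu> (e i # as')
        = d i a \<odot>\<^bsub>U\<^esub> finsum U (\<lambda>I. word_eval F (map d I) as' \<odot>\<^bsub>U\<^esub> \<mu> (e i # map e I)) (idx J n)"
      using Suc.hyps[OF mul[OF i] as'] by (rule arg_cong)
    also have "\<dots> = finsum U (\<lambda>I. d i a \<odot>\<^bsub>U\<^esub> (word_eval F (map d I) as' \<odot>\<^bsub>U\<^esub> \<mu> (e i # map e I))) (idx J n)"
      by (intro U.finsum_smult d_closed i a Pi_I U.smult_closed w c)
    also have "\<dots> = finsum U (\<lambda>I. word_eval F (map d (i # I)) as \<odot>\<^bsub>U\<^esub> \<mu> (map e (i # I))) (idx J n)"
      unfolding as using w c[OF i] d_closed[OF i a]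
      by (intro U.M.finsum_cong' refl Pi_I) (simp_all add: U.smult_assoc1)
    finally show "d i a \<odot>\<^bsub>U\<^esub> \<mu> (e i # as')
        = finsum U (\<lambda>I. word_eval F (map d (i # I)) as \<odot>\<^bsub>U\<^esub> \<mu> (map e (i # I))) (idx J n)" .
  qed
  also have "\<dots> = finsum U (\<lambda>I. word_eval F (map d I) as \<odot>\<^bsub>U\<^esub> \<mu> (map e I)) (idx J (Suc n))"
    by (rule finsum_idx_Suc[OF U fin, symmetric])
      (intro U.smult_closed word_eval_d_closed[OF _ Suc.prems(2)] multilin_closed[OF Suc.prems(1)] map_e_words)
  finally show ?case .
qed

definition tcoord :: "nat \<Rightarrow> 'i list \<Rightarrow> ('f, 'a) tpower_elem \<Rightarrow> 'f"
  where "tcoord n I = tpower_lift F A n (ground F) (word_eval F (map d I))"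

definition tbase :: "'i list \<Rightarrow> ('f, 'a) tpower_elem"
  where "tbase I = pure_word F A (map e I)"

lemma tcoord_pure:
  "I \<in> idx J n \<Longrightarrow> as \<in> words A n \<Longrightarrow> tcoord n I (pure_word F A as) = word_eval F (map d I) as"
  unfolding tcoord_def by (rule tpower_lift_pure[OF vs ground_vs[OF F] word_eval_d_multilin])

lemma word_eval_d_e:
  "I \<in> idx J n \<Longrightarrow> K \<in> idx J n \<Longrightarrow>
    word_eval F (map d I) (map e K) = (if I = K then \<one>\<^bsub>F\<^esub> else \<zero>\<^bsub>F\<^esub>)"
proof (induct n arbitrary: I K)
  case (Suc n)
  interpret F: field F by (rule F)
  obtain i I' where I: "I = i # I'" "i \<in> J" "I' \<in> idx J n" using Suc.prems(1) unfolding idx_Suc by blast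
  obtain k K' where K: "K = k # K'" "k \<in> J" "K' \<in> idx J n" using Suc.prems(2) unfolding idx_Suc by blast
  show ?case using Suc.hyps[OF I(3) K(3)] by (simp add: I(1) K(1) d_e[OF I(2) K(2)])
qed simp

text \<open>The expansion axiom is \<open>multilin_expand\<close> for the universal multilinear map
  \<open>pure_word\<close>. As an instance of the locale, every tensor power now has coordinates,
  linear extension and coefficients in a tensor product with \<open>Q\<close>.\<close>

lemma tpower_dual_bases: "dual_bases F (tpower F A n) (idx J n) tbase (tcoord n)"
proof (rule dual_bases.intro)
  note T = tpower_vs[OF vs, of n]
  interpret T: vectorspace F "tpower F A n" by (rule T)
  note m = word_eval_d_multilin and G = ground_vs[OF F]
  show "vectorspace F (tpower F A n)" by (rule T)
  show "finite (idx J n)" by (rule idx_finite[OF fin])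
  fix I assume I: "I \<in> idx J n"
  show "tbase I \<in> carrier (tpower F A n)"
    unfolding tbase_def by (rule pure_word_closed[OF vs map_e_words[OF I]])
  show "tcoord n I \<in> lin F (tpower F A n) (ground F)"
    unfolding tcoord_def by (rule tpower_lift_lin[OF vs G m[OF I]])
  fix K assume K: "K \<in> idx J n"
  show "tcoord n I (tbase K) = (if I = K then \<one>\<^bsub>F\<^esub> else \<zero>\<^bsub>F\<^esub>)"
    unfolding tbase_def tcoord_pure[OF I map_e_words[OF K]] by (rule word_eval_d_e[OF I K])
next
  note T = tpower_vs[OF vs, of n]
  interpret T: vectorspace F "tpower F A n" by (rule T)
  note m = word_eval_d_multilin and G = ground_vs[OF F]
  have tb: "tbase I \<in> carrier (tpower F A n)" if "I \<in> idx J n" for I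
    unfolding tbase_def by (rule pure_word_closed[OF vs map_e_words[OF that]])
  fix x assume x: "x \<in> carrier (tpower F A n)"
  show "x = finsum (tpower F A n) (\<lambda>I. tcoord n I x \<odot>\<^bsub>tpower F A n\<^esub> tbase I) (idx J n)"
  proof (rule tpower_eqI[OF vs T lhom_id _ _ x])
    show "(\<lambda>x. finsum (tpower F A n) (\<lambda>I. tcoord n I x \<odot>\<^bsub>tpower F A n\<^esub> tbase I) (idx J n))
        \<in> lhom F (tpower F A n) (tpower F A n)"
      unfolding tcoord_def
      by (intro lhom_finsum_fun[OF T T] lhom_comp[OF tpower_lift_lhom[OF vs G m] bilin_left[OF smult_bilin[OF T]]] tb)
    fix as assume as: "as \<in> words A n"
    have "pure_word F A as = finsum (tpower F A n)
        (\<lambda>I. word_eval F (map d I) as \<odot>\<^bsub>tpower F A n\<^esub> pure_word F A (map e I)) (idx J n)"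
      by (rule multilin_expand[OF T pure_word_multilin[OF vs] as])
    also have "\<dots> = finsum (tpower F A n) (\<lambda>I. tcoord n I (pure_word F A as) \<odot>\<^bsub>tpower F A n\<^esub> tbase I) (idx J n)"
      using word_eval_d_closed[OF _ as] tb
      by (intro T.M.finsum_cong' refl Pi_I) (simp_all add: tcoord_pure[OF _ as] tbase_def)
    finally show "pure_word F A as
      = finsum (tpower F A n) (\<lambda>I. tcoord n I (pure_word F A as) \<odot>\<^bsub>tpower F A n\<^esub> tbase I) (idx J n)" .
  qed
qed

text \<open>Serves for maps defined through \<open>inv_into\<close>, such as \<open>dual_ops\<close>
  and \<open>sharp\<close>, whose values are known only through their coordinates.\<close>

lemma lhom_coordI:
  assumes P: "vectorspace F P" and g: "\<And>x. x \<in> carrier P \<Longrightarrow> g x \<in> carrier A"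
    and dg: "\<And>i. i \<in> J \<Longrightarrow> (\<lambda>x. d i (g x)) \<in> lhom F P (ground F)"
  shows "g \<in> lhom F P A"
proof -
  interpret A: vectorspace F A by (rule vs)
  interpret P: vectorspace F P by (rule P)
  show ?thesis
  proof (rule lhomI)
    fix x y assume x: "x \<in> carrier P" and y: "y \<in> carrier P"
    show "g (x \<oplus>\<^bsub>P\<^esub> y) = g x \<oplus>\<^bsub>A\<^esub> g y"
    proof (rule eqI)
      show "g (x \<oplus>\<^bsub>P\<^esub> y) \<in> carrier A" "g x \<oplus>\<^bsub>A\<^esub> g y \<in> carrier A" using x y g by simp_all
      show "d i (g (x \<oplus>\<^bsub>P\<^esub> y)) = d i (g x \<oplus>\<^bsub>A\<^esub> g y)" if i: "i \<in> J" for i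
        using module_hom_add[OF dg[OF i] x y] module_hom_add[OF d_lhom[OF i] g[OF x] g[OF y]] by simp
    qed
  next
    fix c x assume c: "c \<in> carrier F" and x: "x \<in> carrier P"
    show "g (c \<odot>\<^bsub>P\<^esub> x) = c \<odot>\<^bsub>A\<^esub> g x"
    proof (rule eqI)
      show "g (c \<odot>\<^bsub>P\<^esub> x) \<in> carrier A" "c \<odot>\<^bsub>A\<^esub> g x \<in> carrier A" using x c g by simp_all
      show "d i (g (c \<odot>\<^bsub>P\<^esub> x)) = d i (c \<odot>\<^bsub>A\<^esub> g x)" if i: "i \<in> J" for i
        using module_hom_smult[OF dg[OF i] c x] module_hom_smult[OF d_lhom[OF i] c g[OF x]] by simp
    qed
  qed (rule g)
qed

end

lemma lhom_dualI:
  assumes V: "vectorspace F V" and P: "vectorspace F P"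
    and g: "\<And>p. p \<in> carrier P \<Longrightarrow> g p \<in> lin F V (ground F)"
    and gv: "\<And>v. v \<in> carrier V \<Longrightarrow> (\<lambda>p. g p v) \<in> lhom F P (ground F)"
  shows "g \<in> lhom F P (dual F V)"
proof -
  note F = field_vectorspace[OF V]
  interpret P: vectorspace F P by (rule P)
  interpret D: vectorspace F "dual F V" by (rule dual_vs[OF V])
  have gD: "g p \<in> carrier (dual F V)" if "p \<in> carrier P" for p using g[OF that] by (simp add: dual_simps[OF F])
  have eqI: "\<phi> = \<psi>" if "\<phi> \<in> carrier (dual F V)" "\<psi> \<in> carrier (dual F V)" "\<And>v. v \<in> carrier V \<Longrightarrow> \<phi> v = \<psi> v" for \<phi> \<psi>
    using that unfolding dual_simps(1)[OF F] by (rule lin_eqI)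
  show ?thesis
  proof (rule lhomI[OF gD])
    fix x y assume x: "x \<in> carrier P" and y: "y \<in> carrier P"
    show "g (x \<oplus>\<^bsub>P\<^esub> y) = g x \<oplus>\<^bsub>dual F V\<^esub> g y"
    proof (rule eqI)
      show "g (x \<oplus>\<^bsub>P\<^esub> y) \<in> carrier (dual F V)" "g x \<oplus>\<^bsub>dual F V\<^esub> g y \<in> carrier (dual F V)"
        using gD x y by simp_all
      show "g (x \<oplus>\<^bsub>P\<^esub> y) v = (g x \<oplus>\<^bsub>dual F V\<^esub> g y) v" if v: "v \<in> carrier V" for v
        using module_hom_add[OF gv[OF v] x y] v by (simp add: dual_simps[OF F])
    qed
  next
    fix c x assume c: "c \<in> carrier F" and x: "x \<in> carrier P"
    show "g (c \<odot>\<^bsub>P\<^esub> x) = c \<odot>\<^bsub>dual F V\<^esub> g x"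
    proof (rule eqI)
      show "g (c \<odot>\<^bsub>P\<^esub> x) \<in> carrier (dual F V)" "c \<odot>\<^bsub>dual F V\<^esub> g x \<in> carrier (dual F V)"
        using gD x c by simp_all
      show "g (c \<odot>\<^bsub>P\<^esub> x) v = (c \<odot>\<^bsub>dual F V\<^esub> g x) v" if v: "v \<in> carrier V" for v
        using module_hom_smult[OF gv[OF v] c x] v by (simp add: dual_simps[OF F])
    qed
  qed
qed

section \<open>The dual of an Omega-algebra in coordinates\<close>

context dual_bases
begin

interpretation D: dual_bases F "dual F A" J d "\<lambda>i. eval_bidual F A (e i)"
  by (rule dual)

lemma word_eval_dual_multilin:
  assumes "fs \<in> words (dual F A) n" shows "multilin F A n (ground F) (word_eval F fs)"
  using word_eval_multilin[OF vs, of fs] assms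
  by (auto simp: words_def dual_simps[OF F] dest: linD)

lemma tpower_dual_multilin:
  "multilin F (dual F A) n (dual F (tpower F A n)) (\<lambda>fs. tpower_lift F A n (ground F) (word_eval F fs))"
  unfolding multilin_def
proof (intro conjI ballI allI impI)
  note G = ground_vs[OF F] and T = tpower_vs[OF vs, of n]
  fix fs assume "fs \<in> words (dual F A) n"
  from tpower_lift_lin[OF vs G word_eval_dual_multilin[OF this]]
  show "tpower_lift F A n (ground F) (word_eval F fs) \<in> carrier (dual F (tpower F A n))"
    by (simp add: dual_simps[OF F])
next
  note G = ground_vs[OF F] and T = tpower_vs[OF vs, of n]
  interpret T: dual_bases F "tpower F A n" "idx J n" tbase "tcoord n" by (rule tpower_dual_bases)
  fix xs ys assume *: "xs \<in> lists (carrier (dual F A))" "ys \<in> lists (carrier (dual F A))"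
    "Suc (length xs + length ys) = n"
  have w: "xs @ f # ys \<in> words (dual F A) n" if "f \<in> carrier (dual F A)" for f
    using that * by (simp add: words_mid_iff)
  note m = word_eval_dual_multilin[OF w]
  show "(\<lambda>f. tpower_lift F A n (ground F) (word_eval F (xs @ f # ys))) \<in> lhom F (dual F A) (dual F (tpower F A n))"
  proof (rule lhom_dualI[OF T D.vs])
    show "tpower_lift F A n (ground F) (word_eval F (xs @ f # ys)) \<in> lin F (tpower F A n) (ground F)"
      if "f \<in> carrier (dual F A)" for f
      by (rule tpower_lift_lin[OF vs G m[OF that]])
    fix x assume x: "x \<in> carrier (tpower F A n)"
    \<comment> \<open>Expanding the fixed tensor \<open>x\<close> in basis words turns the lift into
      a finite combination of values of the pairing. Linearity of these in \<open>f\<close> is the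
      symmetry of the pairing.\<close>
    let ?g = "\<lambda>f. finsum (ground F) (\<lambda>I. tcoord n I x \<odot>\<^bsub>ground F\<^esub> word_eval F (xs @ f # ys) (map e I)) (idx J n)"
    have eq: "tpower_lift F A n (ground F) (word_eval F (xs @ f # ys)) x = ?g f"
      if f: "f \<in> carrier (dual F A)" for f
    proof -
      interpret G: vectorspace F "ground F" by (rule G)
      have "tpower_lift F A n (ground F) (word_eval F (xs @ f # ys)) x
        = finsum (ground F) (\<lambda>I. tcoord n I x \<odot>\<^bsub>ground F\<^esub>
            tpower_lift F A n (ground F) (word_eval F (xs @ f # ys)) (tbase I)) (idx J n)"
        by (rule T.lhom_expand[OF G tpower_lift_lhom[OF vs G m[OF f]] x])
      also have "\<dots> = ?g f"
      proof (rule G.M.finsum_cong'[OF refl])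
        show "(\<lambda>I. tcoord n I x \<odot>\<^bsub>ground F\<^esub> word_eval F (xs @ f # ys) (map e I)) \<in> idx J n \<rightarrow> carrier (ground F)"
          using T.d_closed[OF _ x] multilin_closed[OF m[OF f] map_e_words]
          by (intro Pi_I G.smult_closed)
        show "tcoord n I x \<odot>\<^bsub>ground F\<^esub> tpower_lift F A n (ground F) (word_eval F (xs @ f # ys)) (tbase I)
          = tcoord n I x \<odot>\<^bsub>ground F\<^esub> word_eval F (xs @ f # ys) (map e I)" if I: "I \<in> idx J n" for I
          unfolding tbase_def tpower_lift_pure[OF vs G m[OF f] map_e_words[OF I]] by (rule refl)
      qed
      finally show ?thesis .
    qed
    have "(\<lambda>f. word_eval F (xs @ f # ys) (map e I)) \<in> lhom F (dual F A) (ground F)" if I: "I \<in> idx J n" for I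
    proof -
      have "multilin F (dual F A) n (ground F) (word_eval F (map (\<lambda>i. eval_bidual F A (e i)) I))"
        by (rule D.word_eval_d_multilin[OF I])
      then have l: "(\<lambda>f. word_eval F (map (\<lambda>i. eval_bidual F A (e i)) I) (xs @ f # ys)) \<in> lhom F (dual F A) (ground F)"
        using * unfolding multilin_def by blast
      have "word_eval F (map (\<lambda>i. eval_bidual F A (e i)) I) (xs @ f # ys) = word_eval F (xs @ f # ys) (map e I)"
        if "f \<in> carrier (dual F A)" for f
        using word_eval_eval_bidual[OF w[OF that] map_e_words[OF I]] by (simp add: comp_def)
      from iffD1[OF lhom_cong[OF D.vs this] l] show ?thesis .
    qed
    then have "?g \<in> lhom F (dual F A) (ground F)"
      by (intro lhom_finsum_fun[OF D.vs G] lhom_smult_fun[OF G] T.d_closed[OF _ x])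
    from iffD2[OF lhom_cong[OF D.vs eq] this]
    show "(\<lambda>f. tpower_lift F A n (ground F) (word_eval F (xs @ f # ys)) x) \<in> lhom F (dual F A) (ground F)" .
  qed
qed

lemma tpower_dual_lhom: "tpower_dual F A n \<in> lhom F (tpower F (dual F A) n) (dual F (tpower F A n))"
  and tpower_dual_pure: "fs \<in> words (dual F A) n \<Longrightarrow>
    tpower_dual F A n (pure_word F (dual F A) fs) = tpower_lift F A n (ground F) (word_eval F fs)"
  unfolding tpower_dual_def word_eval_def[symmetric]
  by (rule tpower_lift_lhom[OF D.vs dual_vs[OF tpower_vs[OF vs]] tpower_dual_multilin],
      rule tpower_lift_pure[OF D.vs dual_vs[OF tpower_vs[OF vs]] tpower_dual_multilin])

lemma tpower_dual_tbase: "I \<in> idx J n \<Longrightarrow> tpower_dual F A n (D.tbase I) = tcoord n I"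
  unfolding D.tbase_def tcoord_def by (rule tpower_dual_pure[OF map_d_words])

text \<open>Both sides are linear in \<open>\<xi>\<close> and agree on the words in the
  \<open>d i\<close>. So the values on basis words of the functional attached to
  \<open>\<xi>\<close> are the coordinates of \<open>\<xi>\<close>, which makes the canonical map
  bijective.\<close>

lemma tpower_dual_apply:
  assumes I: "I \<in> idx J n" and \<xi>: "\<xi> \<in> carrier (tpower F (dual F A) n)"
  shows "tpower_dual F A n \<xi> (tbase I) = D.tcoord n I \<xi>"
proof -
  interpret T: dual_bases F "tpower F A n" "idx J n" tbase "tcoord n" by (rule tpower_dual_bases)
  interpret DT: dual_bases F "tpower F (dual F A) n" "idx J n" D.tbase "D.tcoord n" by (rule D.tpower_dual_bases)
  note G = ground_vs[OF F]
  show ?thesis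
  proof (rule DT.lhom_eqI[OF G _ DT.d_lhom[OF I] _ \<xi>])
    show "(\<lambda>\<xi>. tpower_dual F A n \<xi> (tbase I)) \<in> lhom F (tpower F (dual F A) n) (ground F)"
      by (rule lhom_comp[OF tpower_dual_lhom T.dual_apply_lhom[OF T.e_closed[OF I]]])
    fix K assume K: "K \<in> idx J n"
    show "tpower_dual F A n (D.tbase K) (tbase I) = D.tcoord n I (D.tbase K)"
      unfolding tpower_dual_tbase[OF K] T.d_e[OF K I] DT.d_e[OF I K] by (simp only: eq_commute)
  qed
qed

lemma tpower_dual_bij:
  "bij_betw (tpower_dual F A n) (carrier (tpower F (dual F A) n)) (carrier (dual F (tpower F A n)))"
proof -
  interpret T: dual_bases F "tpower F A n" "idx J n" tbase "tcoord n" by (rule tpower_dual_bases)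
  interpret DT: dual_bases F "tpower F (dual F A) n" "idx J n" D.tbase "D.tcoord n" by (rule D.tpower_dual_bases)
  note closed = lhom_closed[OF tpower_dual_lhom]
  show ?thesis
  proof (rule bij_betw_imageI)
    show "inj_on (tpower_dual F A n) (carrier (tpower F (dual F A) n))"
    proof (rule inj_onI)
      fix \<xi> \<eta> assume \<xi>: "\<xi> \<in> carrier (tpower F (dual F A) n)" and \<eta>: "\<eta> \<in> carrier (tpower F (dual F A) n)"
        and eq: "tpower_dual F A n \<xi> = tpower_dual F A n \<eta>"
      show "\<xi> = \<eta>"
      proof (rule DT.eqI[OF \<xi> \<eta>])
        fix I assume I: "I \<in> idx J n"
        show "D.tcoord n I \<xi> = D.tcoord n I \<eta>"
          by (simp only: tpower_dual_apply[OF I \<xi>, symmetric] tpower_dual_apply[OF I \<eta>, symmetric] eq)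
      qed
    qed
    show "tpower_dual F A n ` carrier (tpower F (dual F A) n) = carrier (dual F (tpower F A n))"
    proof (intro equalityI subsetI)
      fix \<phi> assume \<phi>: "\<phi> \<in> carrier (dual F (tpower F A n))"
      have c: "\<phi> (tbase I) \<in> carrier F" if "I \<in> idx J n" for I
        using lhom_closed[OF linD[OF iffD1[OF T.dual_lhom \<phi>]] T.e_closed[OF that]] by simp
      \<comment> \<open>The preimage is dictated by \<open>tpower_dual_apply\<close>: its
        coordinates must be the values of \<open>\<phi>\<close> on basis words.\<close>
      let ?\<xi> = "finsum (tpower F (dual F A) n) (\<lambda>I. \<phi> (tbase I) \<odot>\<^bsub>tpower F (dual F A) n\<^esub> D.tbase I) (idx J n)"
      have \<xi>: "?\<xi> \<in> carrier (tpower F (dual F A) n)" by (rule DT.sum_closed[OF c])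
      have "tpower_dual F A n ?\<xi> = \<phi>"
      proof (rule T.dual_eqI[OF closed[OF \<xi>] \<phi>])
        fix I assume I: "I \<in> idx J n"
        show "tpower_dual F A n ?\<xi> (tbase I) = \<phi> (tbase I)"
          unfolding tpower_dual_apply[OF I \<xi>] by (rule DT.d_sum[OF I c])
      qed
      then show "\<phi> \<in> tpower_dual F A n ` carrier (tpower F (dual F A) n)"
        using \<xi> by (intro image_eqI[of _ _ ?\<xi>]) simp_all
    qed (use closed in blast)
  qed
qed

context
  fixes \<Omega> :: "'w set" and s t :: "'w \<Rightarrow> nat"
    and ops :: "'w \<Rightarrow> ('f, 'a) tpower_elem \<Rightarrow> ('f, 'a) tpower_elem" and w :: 'w
  assumes ops: "ops w \<in> lhom F (tpower F A (s w)) (tpower F A (t w))"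
begin

text \<open>Surjectivity of the canonical map makes \<open>inv_into\<close> a genuine preimage of
  the pulled back functional. Its coordinates are the values of that functional on basis
  words.\<close>

lemma dual_ops_char:
  assumes \<xi>: "\<xi> \<in> carrier (tpower F (dual F A) (t w))"
  shows "dual_ops F s t A ops w \<xi> \<in> carrier (tpower F (dual F A) (s w))" (is ?a)
    and "I \<in> idx J (s w) \<Longrightarrow>
      D.tcoord (s w) I (dual_ops F s t A ops w \<xi>) = tpower_dual F A (t w) \<xi> (ops w (tbase I))"
      (is "_ \<Longrightarrow> ?b")
proof -
  interpret T: dual_bases F "tpower F A (s w)" "idx J (s w)" tbase "tcoord (s w)" by (rule tpower_dual_bases)
  interpret T': dual_bases F "tpower F A (t w)" "idx J (t w)" tbase "tcoord (t w)" by (rule tpower_dual_bases)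
  let ?\<phi> = "dual_map F (tpower F A (s w)) (tpower F A (t w)) (ops w) (tpower_dual F A (t w) \<xi>)"
  have x: "tpower_dual F A (t w) \<xi> \<in> carrier (dual F (tpower F A (t w)))"
    by (rule lhom_closed[OF tpower_dual_lhom \<xi>])
  then have eq: "?\<phi> = restrict (\<lambda>a. tpower_dual F A (t w) \<xi> (ops w a)) (carrier (tpower F A (s w)))"
    by (simp add: dual_map_def compose_def)
  have "(\<lambda>a. tpower_dual F A (t w) \<xi> (ops w a)) \<in> lhom F (tpower F A (s w)) (ground F)"
    using x by (intro lhom_comp[OF ops] linD) (simp only: T'.dual_lhom)
  from lin_restrict[OF T.vs this] have "?\<phi> \<in> carrier (dual F (tpower F A (s w)))"
    by (simp only: eq T.dual_lhom)
  then have im: "?\<phi> \<in> tpower_dual F A (s w) ` carrier (tpower F (dual F A) (s w))"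
    using bij_betw_imp_surj_on[OF tpower_dual_bij] by simp
  have d: "dual_ops F s t A ops w \<xi>
      = inv_into (carrier (tpower F (dual F A) (s w))) (tpower_dual F A (s w)) ?\<phi>"
    using \<xi> by (simp add: dual_ops_def)
  show a: ?a unfolding d by (rule inv_into_into[OF im])
  have "tpower_dual F A (s w) (dual_ops F s t A ops w \<xi>) = ?\<phi>" unfolding d by (rule f_inv_into_f[OF im])
  then show ?b if I: "I \<in> idx J (s w)"
    using tpower_dual_apply[OF I a] T.e_closed[OF I] by (simp add: eq)
qed

lemma dual_ops_lhom:
  "dual_ops F s t A ops w \<in> lhom F (tpower F (dual F A) (t w)) (tpower F (dual F A) (s w))"
proof -
  interpret T: dual_bases F "tpower F A (s w)" "idx J (s w)" tbase "tcoord (s w)" by (rule tpower_dual_bases)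
  interpret T': dual_bases F "tpower F A (t w)" "idx J (t w)" tbase "tcoord (t w)" by (rule tpower_dual_bases)
  interpret DT: dual_bases F "tpower F (dual F A) (s w)" "idx J (s w)" D.tbase "D.tcoord (s w)" by (rule D.tpower_dual_bases)
  interpret DT': dual_bases F "tpower F (dual F A) (t w)" "idx J (t w)" D.tbase "D.tcoord (t w)" by (rule D.tpower_dual_bases)
  show ?thesis
  proof (rule DT.lhom_coordI[OF DT'.vs dual_ops_char(1)])
    fix I assume I: "I \<in> idx J (s w)"
    have l: "(\<lambda>\<xi>. tpower_dual F A (t w) \<xi> (ops w (tbase I))) \<in> lhom F (tpower F (dual F A) (t w)) (ground F)"
      by (rule lhom_comp[OF tpower_dual_lhom T'.dual_apply_lhom[OF lhom_closed[OF ops T.e_closed[OF I]]]])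
    show "(\<lambda>\<xi>. D.tcoord (s w) I (dual_ops F s t A ops w \<xi>)) \<in> lhom F (tpower F (dual F A) (t w)) (ground F)"
      by (rule iffD2[OF lhom_cong[OF DT'.vs dual_ops_char(2)[OF _ I]] l])
  qed
qed

text \<open>The matrix of the dual operation is the transpose of the matrix of the operation. Only
  this fact about \<open>dual_ops\<close> enters the transposition of the comeasuring
  equations.\<close>

lemma dual_ops_tcoord:
  assumes "I \<in> idx J (s w)" "K \<in> idx J (t w)"
  shows "D.tcoord (s w) I (dual_ops F s t A ops w (D.tbase K)) = tcoord (t w) K (ops w (tbase I))"
proof -
  interpret DT': dual_bases F "tpower F (dual F A) (t w)" "idx J (t w)" D.tbase "D.tcoord (t w)" by (rule D.tpower_dual_bases)
  show ?thesis
    unfolding dual_ops_char(2)[OF DT'.e_closed[OF assms(2)] assms(1)] tpower_dual_tbase[OF assms(2)] by (rule refl)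
qed

end

end

text \<open>The common shape of \<open>rho_join\<close> and of the product in
  \<open>tensor_algebra\<close>. The outer lift is meaningful only if the inner one is bilinear in
  the outer variables, which is what \<open>tensor_lift_param\<close> supplies.\<close>

lemma tensor_lift_nested:
  assumes V: "vectorspace F V" and W: "vectorspace F W" and V': "vectorspace F V'" and W': "vectorspace F W'"
    and T: "vectorspace F T"
    and b1: "\<And>v w. v \<in> carrier V \<Longrightarrow> w \<in> carrier W \<Longrightarrow> bilin F V' W' T (\<beta> v w)"
    and b2: "\<And>v' w'. v' \<in> carrier V' \<Longrightarrow> w' \<in> carrier W' \<Longrightarrow> bilin F V W T (\<lambda>v w. \<beta> v w v' w')"
  shows tensor_lift_nested_bilin: "bilin F (tensor F V W) (tensor F V' W') T
      (\<lambda>x y. tensor_lift F V W T (\<lambda>v w. tensor_lift F V' W' T (\<beta> v w) y) x)"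
    and tensor_lift_nested_pure: "\<And>v w v' w'. v \<in> carrier V \<Longrightarrow> w \<in> carrier W \<Longrightarrow> v' \<in> carrier V' \<Longrightarrow>
      w' \<in> carrier W' \<Longrightarrow>
      tensor_lift F V W T (\<lambda>v w. tensor_lift F V' W' T (\<beta> v w) (pure_tensor F V' W' v' w')) (pure_tensor F V W v w)
        = \<beta> v w v' w'"
proof -
  have inner: "bilin F V W T (\<lambda>v w. tensor_lift F V' W' T (\<beta> v w) y)" if y: "y \<in> carrier (tensor F V' W')" for y
  proof (rule bilinI)
    fix v assume v: "v \<in> carrier V"
    show "(\<lambda>w. tensor_lift F V' W' T (\<beta> v w) y) \<in> lhom F W T"
      by (rule tensor_lift_param[OF V' W' T W b1[OF v] bilin_right[OF b2 v] y])
  next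
    fix w assume w: "w \<in> carrier W"
    show "(\<lambda>v. tensor_lift F V' W' T (\<beta> v w) y) \<in> lhom F V T"
      by (rule tensor_lift_param[OF V' W' T V b1[OF _ w] bilin_left[OF b2 w] y])
  qed
  show "bilin F (tensor F V W) (tensor F V' W') T
      (\<lambda>x y. tensor_lift F V W T (\<lambda>v w. tensor_lift F V' W' T (\<beta> v w) y) x)"
  proof (rule bilinI)
    fix x assume x: "x \<in> carrier (tensor F V W)"
    show "(\<lambda>y. tensor_lift F V W T (\<lambda>v w. tensor_lift F V' W' T (\<beta> v w) y) x) \<in> lhom F (tensor F V' W') T"
      by (rule tensor_lift_param[OF V W T tensor_vs[OF V' W'] inner tensor_lift_lhom[OF V' W' T b1] x])
  next
    fix y assume y: "y \<in> carrier (tensor F V' W')"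
    show "(\<lambda>x. tensor_lift F V W T (\<lambda>v w. tensor_lift F V' W' T (\<beta> v w) y) x) \<in> lhom F (tensor F V W) T"
      by (rule tensor_lift_lhom[OF V W T inner[OF y]])
  qed
  show "tensor_lift F V W T (\<lambda>v w. tensor_lift F V' W' T (\<beta> v w) (pure_tensor F V' W' v' w')) (pure_tensor F V W v w)
        = \<beta> v w v' w'"
    if v: "v \<in> carrier V" and w: "w \<in> carrier W" and v': "v' \<in> carrier V'" and w': "w' \<in> carrier W'"
    for v w v' w'
    unfolding tensor_lift_pure[OF V W T inner[OF pure_tensor_closed[OF V' W' v' w']] v w]
      tensor_lift_pure[OF V' W' T b1[OF v w] v' w'] by (rule refl)
qed

section \<open>Comeasurings as matrices\<close>

lemma unital_algebra_vs: "unital_algebra F Q \<Longrightarrow> vectorspace F Q"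
  by (simp add: unital_algebra_def)

lemma mult_bilin:
  assumes "unital_algebra F Q" shows "bilin F Q Q Q (mult Q)"
proof -
  interpret Q: unital_algebra F Q by fact
  show ?thesis
    by (intro bilinI lhomI)
       (simp_all add: Q.l_distr Q.r_distr Q.smult_mult_left Q.smult_mult_right)
qed

definition mat_word :: "('f, 'q, 'k) module_scheme \<Rightarrow> ('i \<Rightarrow> 'j \<Rightarrow> 'q) \<Rightarrow> 'i list \<Rightarrow> 'j list \<Rightarrow> 'q"
  where "mat_word Q m I K = foldr (\<lambda>(i, k) r. m i k \<otimes>\<^bsub>Q\<^esub> r) (zip I K) \<one>\<^bsub>Q\<^esub>"

lemma mat_word_simps [simp]:
  "mat_word Q m [] K = \<one>\<^bsub>Q\<^esub>"
  "mat_word Q m (i # I) (k # K) = m i k \<otimes>\<^bsub>Q\<^esub> mat_word Q m I K"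
  by (simp_all add: mat_word_def)

lemma mat_word_closed:
  assumes "ring Q" "\<And>i k. i \<in> J \<Longrightarrow> k \<in> J \<Longrightarrow> m i k \<in> carrier Q" "I \<in> lists J" "K \<in> lists J"
  shows "mat_word Q m I K \<in> carrier Q"
proof -
  interpret ring Q by fact
  show ?thesis using assms(3,4)
  proof (induct I arbitrary: K)
    case (Cons i I)
    then show ?case by (cases K) (auto simp: assms(2) mat_word_def)
  qed simp
qed

lemma mat_word_cong:
  assumes "\<And>i k. i \<in> J \<Longrightarrow> k \<in> J \<Longrightarrow> m i k = m' i k" "I \<in> lists J" "K \<in> lists J"
  shows "mat_word Q m I K = mat_word Q m' I K"
  using assms(2,3)
proof (induct I arbitrary: K)
  case (Cons i I)
  note hyps = Cons.hyps and prems = Cons.prems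
  show ?case
  proof (cases K)
    case (Cons k K')
    then show ?thesis using hyps prems assms(1) by simp
  qed (simp add: mat_word_def)
qed simp

text \<open>The factor at each position is the same element on both sides, so the order of
  multiplication in the noncommutative \<open>Q\<close> is untouched. \<open>zip\<close> truncates,
  so words of different lengths cause no exception.\<close>

lemma mat_word_transpose: "mat_word Q (\<lambda>i j. m j i) I K = mat_word Q m K I"
proof (induct I arbitrary: K)
  case Nil then show ?case by (simp add: mat_word_def)
next
  case (Cons i I)
  then show ?case by (cases K) (simp_all add: mat_word_def)
qed

text \<open>Here \<open>c w I K\<close> stands for the coefficient of the basis word
  \<open>I\<close> in the value of the operation \<open>w\<close> at the basis word
  \<open>K\<close>. The two sides are the coefficients at \<open>I\<close> obtained by applying
  first the operation and then the coaction to \<open>K\<close>, and in the opposite order.\<close>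

definition mat_eqs ::
  "'i set \<Rightarrow> 'w set \<Rightarrow> ('w \<Rightarrow> nat) \<Rightarrow> ('w \<Rightarrow> nat) \<Rightarrow> ('w \<Rightarrow> 'i list \<Rightarrow> 'i list \<Rightarrow> 'f)
    \<Rightarrow> ('f, 'q, 'k) module_scheme \<Rightarrow> ('i \<Rightarrow> 'i \<Rightarrow> 'q) \<Rightarrow> bool"
  where "mat_eqs J \<Omega> s t c Q m \<longleftrightarrow> (\<forall>w\<in>\<Omega>. \<forall>K\<in>idx J (s w). \<forall>I\<in>idx J (t w).
    finsum Q (\<lambda>L. c w L K \<odot>\<^bsub>Q\<^esub> mat_word Q m I L) (idx J (t w)) =
    finsum Q (\<lambda>L. c w I L \<odot>\<^bsub>Q\<^esub> mat_word Q m L K) (idx J (s w)))"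

text \<open>Transposing \<open>m\<close> and \<open>c\<close> exchanges the two sides of each
  equation together with the roles of the two multi-indices, which is why the arities are exchanged
  and each case ends with symmetry.\<close>

lemma mat_eqs_transpose:
  assumes "vectorspace F Q" "ring Q" "\<And>i j. i \<in> J \<Longrightarrow> j \<in> J \<Longrightarrow> m i j \<in> carrier Q"
    and c: "\<And>w I K. w \<in> \<Omega> \<Longrightarrow> I \<in> idx J (t w) \<Longrightarrow> K \<in> idx J (s w) \<Longrightarrow> c w I K \<in> carrier F"
    and c': "\<And>w I K. w \<in> \<Omega> \<Longrightarrow> I \<in> idx J (s w) \<Longrightarrow> K \<in> idx J (t w) \<Longrightarrow> c' w I K = c w K I"
  shows "mat_eqs J \<Omega> t s c' Q (\<lambda>i j. m j i) \<longleftrightarrow> mat_eqs J \<Omega> s t c Q m"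
proof -
  interpret Q: vectorspace F Q by fact
  have mw: "mat_word Q m I K \<in> carrier Q" if "I \<in> lists J" "K \<in> lists J" for I K
    by (rule mat_word_closed[OF assms(2,3) that])
  have 1: "finsum Q (\<lambda>L. c' w L K \<odot>\<^bsub>Q\<^esub> mat_word Q (\<lambda>i j. m j i) I L) (idx J (s w))
      = finsum Q (\<lambda>L. c w K L \<odot>\<^bsub>Q\<^esub> mat_word Q m L I) (idx J (s w))"
    if "w \<in> \<Omega>" "K \<in> idx J (t w)" "I \<in> idx J (s w)" for w K I
    using that by (intro Q.M.finsum_cong' refl Pi_I Q.smult_closed mw) (simp_all add: mat_word_transpose[of Q m] c c')
  have 2: "finsum Q (\<lambda>L. c' w I L \<odot>\<^bsub>Q\<^esub> mat_word Q (\<lambda>i j. m j i) L K) (idx J (t w))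
      = finsum Q (\<lambda>L. c w L I \<odot>\<^bsub>Q\<^esub> mat_word Q m K L) (idx J (t w))"
    if "w \<in> \<Omega>" "K \<in> idx J (t w)" "I \<in> idx J (s w)" for w K I
    using that by (intro Q.M.finsum_cong' refl Pi_I Q.smult_closed mw) (simp_all add: mat_word_transpose[of Q m] c c')
  show ?thesis unfolding mat_eqs_def
  proof (rule ball_cong[OF refl])
    fix w assume w: "w \<in> \<Omega>"
    show "(\<forall>K\<in>idx J (t w). \<forall>I\<in>idx J (s w).
        finsum Q (\<lambda>L. c' w L K \<odot>\<^bsub>Q\<^esub> mat_word Q (\<lambda>i j. m j i) I L) (idx J (s w)) =
        finsum Q (\<lambda>L. c' w I L \<odot>\<^bsub>Q\<^esub> mat_word Q (\<lambda>i j. m j i) L K) (idx J (t w))) \<longleftrightarrow>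
      (\<forall>K\<in>idx J (s w). \<forall>I\<in>idx J (t w).
        finsum Q (\<lambda>L. c w L K \<odot>\<^bsub>Q\<^esub> mat_word Q m I L) (idx J (t w)) =
        finsum Q (\<lambda>L. c w I L \<odot>\<^bsub>Q\<^esub> mat_word Q m L K) (idx J (s w)))" (is "?l \<longleftrightarrow> ?r")
    proof (intro iffI ballI)
      fix K I assume l: ?l and K: "K \<in> idx J (s w)" and I: "I \<in> idx J (t w)"
      from l I K have "finsum Q (\<lambda>L. c' w L I \<odot>\<^bsub>Q\<^esub> mat_word Q (\<lambda>i j. m j i) K L) (idx J (s w)) =
        finsum Q (\<lambda>L. c' w K L \<odot>\<^bsub>Q\<^esub> mat_word Q (\<lambda>i j. m j i) L I) (idx J (t w))" by blast
      then show "finsum Q (\<lambda>L. c w L K \<odot>\<^bsub>Q\<^esub> mat_word Q m I L) (idx J (t w)) =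
        finsum Q (\<lambda>L. c w I L \<odot>\<^bsub>Q\<^esub> mat_word Q m L K) (idx J (s w))"
        unfolding 1[OF w I K] 2[OF w I K] by (rule sym)
    next
      fix K I assume r: ?r and K: "K \<in> idx J (t w)" and I: "I \<in> idx J (s w)"
      from r I K have "finsum Q (\<lambda>L. c w L I \<odot>\<^bsub>Q\<^esub> mat_word Q m K L) (idx J (t w)) =
        finsum Q (\<lambda>L. c w K L \<odot>\<^bsub>Q\<^esub> mat_word Q m L I) (idx J (s w))" by blast
      then show "finsum Q (\<lambda>L. c' w L K \<odot>\<^bsub>Q\<^esub> mat_word Q (\<lambda>i j. m j i) I L) (idx J (s w)) =
        finsum Q (\<lambda>L. c' w I L \<odot>\<^bsub>Q\<^esub> mat_word Q (\<lambda>i j. m j i) L K) (idx J (t w))"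
        unfolding 1[OF w K I] 2[OF w K I] by (rule sym)
    qed
  qed
qed

section \<open>Coefficients of the powers of a coaction\<close>

context dual_bases
begin

abbreviation tcons where "tcons n a \<equiv> tpower_lift F A n (tpower F A (Suc n)) (\<lambda>as. pure_word F A (a # as))"

lemma tcons_multilin:
  assumes "a \<in> carrier A" shows "multilin F A n (tpower F A (Suc n)) (\<lambda>as. pure_word F A (a # as))"
  using pure_word_multilin[OF vs, of "Suc n"] assms unfolding multilin_Suc_iff by blast

lemma tcons_lhom: "a \<in> carrier A \<Longrightarrow> tcons n a \<in> lhom F (tpower F A n) (tpower F A (Suc n))"
  by (rule tpower_lift_lhom[OF vs tpower_vs[OF vs] tcons_multilin])

lemma tcons_pure: "a \<in> carrier A \<Longrightarrow> as \<in> words A n \<Longrightarrow> tcons n a (pure_word F A as) = pure_word F A (a # as)"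
  by (rule tpower_lift_pure[OF vs tpower_vs[OF vs] tcons_multilin])

text \<open>Linearity in the tensor comes with the lift, linearity in the prepended letter does not.
  Expanding \<open>x\<close> in basis words reduces the latter to multilinearity of
  \<open>pure_word\<close>.\<close>

lemma tcons_bilin: "bilin F A (tpower F A n) (tpower F A (Suc n)) (tcons n)"
proof (rule bilinI)
  fix x assume x: "x \<in> carrier (tpower F A n)"
  interpret T: dual_bases F "tpower F A n" "idx J n" tbase "tcoord n" by (rule tpower_dual_bases)
  note S = tpower_vs[OF vs, of "Suc n"]
  interpret S: vectorspace F "tpower F A (Suc n)" by (rule S)
  let ?g = "\<lambda>a. finsum (tpower F A (Suc n)) (\<lambda>I. tcoord n I x \<odot>\<^bsub>tpower F A (Suc n)\<^esub> pure_word F A (a # map e I)) (idx J n)"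
  have l: "(\<lambda>a. pure_word F A (a # map e I)) \<in> lhom F A (tpower F A (Suc n))" if "I \<in> idx J n" for I
    using pure_word_multilin[OF vs, of "Suc n"] map_e_words[OF that] unfolding multilin_Suc_iff by blast
  have eq: "tcons n a x = ?g a" if a: "a \<in> carrier A" for a
  proof -
    have "tcons n a x = finsum (tpower F A (Suc n)) (\<lambda>I. tcoord n I x \<odot>\<^bsub>tpower F A (Suc n)\<^esub> tcons n a (tbase I)) (idx J n)"
      by (rule T.lhom_expand[OF S tcons_lhom[OF a] x])
    also have "\<dots> = ?g a"
    proof (rule S.M.finsum_cong'[OF refl])
      show "(\<lambda>I. tcoord n I x \<odot>\<^bsub>tpower F A (Suc n)\<^esub> pure_word F A (a # map e I)) \<in> idx J n \<rightarrow> carrier (tpower F A (Suc n))"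
        by (intro Pi_I S.smult_closed T.d_closed[OF _ x] lhom_closed[OF l a])
      show "tcoord n I x \<odot>\<^bsub>tpower F A (Suc n)\<^esub> tcons n a (tbase I)
          = tcoord n I x \<odot>\<^bsub>tpower F A (Suc n)\<^esub> pure_word F A (a # map e I)" if I: "I \<in> idx J n" for I
        unfolding tbase_def tcons_pure[OF a map_e_words[OF I]] by (rule refl)
    qed
    finally show ?thesis .
  qed
  have "?g \<in> lhom F A (tpower F A (Suc n))"
    by (intro lhom_finsum_fun[OF vs S] lhom_smult_fun[OF S] T.d_closed[OF _ x] l)
  from iffD2[OF lhom_cong[OF vs eq] this] show "(\<lambda>a. tcons n a x) \<in> lhom F A (tpower F A (Suc n))" .
qed (rule tcons_lhom)

lemma tcoord_tcons:
  assumes i: "i \<in> J" and I: "I \<in> idx J n" and a: "a \<in> carrier A" and x: "x \<in> carrier (tpower F A n)"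
  shows "tcoord (Suc n) (i # I) (tcons n a x) = d i a \<otimes>\<^bsub>F\<^esub> tcoord n I x"
proof -
  note G = ground_vs[OF F]
  interpret T: dual_bases F "tpower F A n" "idx J n" tbase "tcoord n" by (rule tpower_dual_bases)
  interpret S: dual_bases F "tpower F A (Suc n)" "idx J (Suc n)" tbase "tcoord (Suc n)" by (rule tpower_dual_bases)
  have iI: "i # I \<in> idx J (Suc n)" using i I by simp
  show ?thesis
  proof (rule tpower_eqI[OF vs G _ _ _ x])
    show "(\<lambda>x. tcoord (Suc n) (i # I) (tcons n a x)) \<in> lhom F (tpower F A n) (ground F)"
      by (rule lhom_comp[OF tcons_lhom[OF a] S.d_lhom[OF iI]])
    show "(\<lambda>x. d i a \<otimes>\<^bsub>F\<^esub> tcoord n I x) \<in> lhom F (tpower F A n) (ground F)"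
      using lhom_smult_fun[OF G T.d_lhom[OF I] d_closed[OF i a]] by simp
    fix as assume as: "as \<in> words A n"
    have aas: "a # as \<in> words A (Suc n)" using a as by (simp add: words_Cons_iff)
    show "tcoord (Suc n) (i # I) (tcons n a (pure_word F A as)) = d i a \<otimes>\<^bsub>F\<^esub> tcoord n I (pure_word F A as)"
      unfolding tcons_pure[OF a as] tcoord_pure[OF iI aas] tcoord_pure[OF I as] by simp
  qed
qed

lemma rho_join:
  assumes Q: "unital_algebra F Q"
  shows rho_join_bilin: "bilin F (tensor F A Q) (tensor F (tpower F A n) Q)
      (tensor F (tpower F A (Suc n)) Q) (rho_join F A Q n)"
    and rho_join_pure: "\<And>a q x q'. a \<in> carrier A \<Longrightarrow> q \<in> carrier Q \<Longrightarrow> x \<in> carrier (tpower F A n) \<Longrightarrow>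
      q' \<in> carrier Q \<Longrightarrow> rho_join F A Q n (pure_tensor F A Q a q) (pure_tensor F (tpower F A n) Q x q') =
        pure_tensor F (tpower F A (Suc n)) Q (tcons n a x) (q \<otimes>\<^bsub>Q\<^esub> q')"
proof -
  note Qv = unital_algebra_vs[OF Q]
  let ?T = "tensor F (tpower F A (Suc n)) Q"
  note P = tpower_vs[OF vs, of n] and S = tpower_vs[OF vs, of "Suc n"]
  note T = tensor_vs[OF S Qv]
  note pb = pure_tensor_bilin[OF S Qv]
  define \<beta> where "\<beta> = (\<lambda>a q x q'. pure_tensor F (tpower F A (Suc n)) Q (tcons n a x) (q \<otimes>\<^bsub>Q\<^esub> q'))"
  have b1: "bilin F (tpower F A n) Q ?T (\<beta> a q)" if "a \<in> carrier A" "q \<in> carrier Q" for a q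
    unfolding \<beta>_def
    by (rule bilin_comp[OF pb bilin_right[OF tcons_bilin that(1)] bilin_right[OF mult_bilin[OF Q] that(2)] lhom_id])
  have b2: "bilin F A Q ?T (\<lambda>a q. \<beta> a q x q')" if "x \<in> carrier (tpower F A n)" "q' \<in> carrier Q" for x q'
    unfolding \<beta>_def
    by (rule bilin_comp[OF pb bilin_left[OF tcons_bilin that(1)] bilin_left[OF mult_bilin[OF Q] that(2)] lhom_id])
  have join: "rho_join F A Q n
      = (\<lambda>z y. tensor_lift F A Q ?T (\<lambda>a q. tensor_lift F (tpower F A n) Q ?T (\<beta> a q) y) z)"
    by (simp add: rho_join_def[abs_def] \<beta>_def Let_def)
  show "bilin F (tensor F A Q) (tensor F (tpower F A n) Q) ?T (rho_join F A Q n)"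
    unfolding join by (rule tensor_lift_nested_bilin[OF vs Qv P Qv T b1 b2])
  show "rho_join F A Q n (pure_tensor F A Q a q) (pure_tensor F (tpower F A n) Q x q') =
      pure_tensor F (tpower F A (Suc n)) Q (tcons n a x) (q \<otimes>\<^bsub>Q\<^esub> q')"
    if "a \<in> carrier A" "q \<in> carrier Q" "x \<in> carrier (tpower F A n)" "q' \<in> carrier Q" for a q x q'
  proof -
    have "rho_join F A Q n (pure_tensor F A Q a q) (pure_tensor F (tpower F A n) Q x q') = \<beta> a q x q'"
      unfolding join by (rule tensor_lift_nested_pure[OF vs Qv P Qv T b1 b2 that])
    then show ?thesis by (simp only: \<beta>_def)
  qed
qed

text \<open>Both sides are bilinear in \<open>z\<close> and \<open>y\<close>, and on pure tensors
  both are \<open>q q'\<close> scaled by the two coordinates. Iterated along a word, this produces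
  the products of matrix entries in the order of the letters.\<close>

lemma coord_rho_join:
  assumes Q: "unital_algebra F Q" and i: "i \<in> J" and I: "I \<in> idx J n"
    and z: "z \<in> carrier (tensor F A Q)" and y: "y \<in> carrier (tensor F (tpower F A n) Q)"
  shows "contract F (tpower F A (Suc n)) Q (tcoord (Suc n) (i # I)) (rho_join F A Q n z y) =
    coord Q i z \<otimes>\<^bsub>Q\<^esub> contract F (tpower F A n) Q (tcoord n I) y"
proof -
  note Qv = unital_algebra_vs[OF Q]
  interpret Q: unital_algebra F Q by (rule Q)
  interpret P: dual_bases F "tpower F A n" "idx J n" tbase "tcoord n" by (rule tpower_dual_bases)
  interpret S: dual_bases F "tpower F A (Suc n)" "idx J (Suc n)" tbase "tcoord (Suc n)" by (rule tpower_dual_bases)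
  have iI: "i # I \<in> idx J (Suc n)" using i I by simp
  note mb = mult_bilin[OF Q] and jb = rho_join_bilin[OF Q, of n]
  note cS = contract_lhom[OF S.vs Qv S.d_lhom[OF iI]]
    and cA = contract_lhom[OF vs Qv d_lhom[OF i]] and cP = contract_lhom[OF P.vs Qv P.d_lhom[OF I]]
  show ?thesis
  proof (rule tensor_eqI[OF vs Qv Qv _ _ _ z])
    show "(\<lambda>z. contract F (tpower F A (Suc n)) Q (tcoord (Suc n) (i # I)) (rho_join F A Q n z y))
        \<in> lhom F (tensor F A Q) Q"
      by (rule lhom_comp[OF bilin_left[OF jb y] cS])
    show "(\<lambda>z. coord Q i z \<otimes>\<^bsub>Q\<^esub> contract F (tpower F A n) Q (tcoord n I) y) \<in> lhom F (tensor F A Q) Q"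
      by (rule lhom_comp[OF cA bilin_left[OF mb lhom_closed[OF cP y]]])
    fix a q assume a: "a \<in> carrier A" and q: "q \<in> carrier Q"
    note aq = pure_tensor_closed[OF vs Qv a q]
    show "contract F (tpower F A (Suc n)) Q (tcoord (Suc n) (i # I)) (rho_join F A Q n (pure_tensor F A Q a q) y)
      = coord Q i (pure_tensor F A Q a q) \<otimes>\<^bsub>Q\<^esub> contract F (tpower F A n) Q (tcoord n I) y"
    proof (rule tensor_eqI[OF P.vs Qv Qv _ _ _ y])
      show "(\<lambda>y. contract F (tpower F A (Suc n)) Q (tcoord (Suc n) (i # I)) (rho_join F A Q n (pure_tensor F A Q a q) y))
        \<in> lhom F (tensor F (tpower F A n) Q) Q"
        by (rule lhom_comp[OF bilin_right[OF jb aq] cS])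
      show "(\<lambda>y. coord Q i (pure_tensor F A Q a q) \<otimes>\<^bsub>Q\<^esub> contract F (tpower F A n) Q (tcoord n I) y)
        \<in> lhom F (tensor F (tpower F A n) Q) Q"
        by (rule lhom_comp[OF cP bilin_right[OF mb lhom_closed[OF cA aq]]])
      fix x q' assume x: "x \<in> carrier (tpower F A n)" and q': "q' \<in> carrier Q"
      have qq: "q \<otimes>\<^bsub>Q\<^esub> q' \<in> carrier Q" using q q' by simp
      have "contract F (tpower F A (Suc n)) Q (tcoord (Suc n) (i # I))
          (rho_join F A Q n (pure_tensor F A Q a q) (pure_tensor F (tpower F A n) Q x q'))
        = (d i a \<otimes>\<^bsub>F\<^esub> tcoord n I x) \<odot>\<^bsub>Q\<^esub> (q \<otimes>\<^bsub>Q\<^esub> q')"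
        unfolding rho_join_pure[OF Q a q x q'] contract_pure[OF S.vs Qv S.d_lhom[OF iI] bilin_closed[OF tcons_bilin a x] qq]
          tcoord_tcons[OF i I a x] by (rule refl)
      also have "\<dots> = (d i a \<odot>\<^bsub>Q\<^esub> q) \<otimes>\<^bsub>Q\<^esub> (tcoord n I x \<odot>\<^bsub>Q\<^esub> q')"
        using d_closed[OF i a] P.d_closed[OF I x] q q'
        by (simp only: Q.smult_closed Q.smult_mult_left Q.smult_mult_right[of _ q q'] Q.smult_assoc1 qq)
      finally show "contract F (tpower F A (Suc n)) Q (tcoord (Suc n) (i # I))
          (rho_join F A Q n (pure_tensor F A Q a q) (pure_tensor F (tpower F A n) Q x q'))
        = coord Q i (pure_tensor F A Q a q) \<otimes>\<^bsub>Q\<^esub>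
          contract F (tpower F A n) Q (tcoord n I) (pure_tensor F (tpower F A n) Q x q')"
        unfolding contract_pure[OF vs Qv d_lhom[OF i] a q] contract_pure[OF P.vs Qv P.d_lhom[OF I] x q'] .
    qed
  qed
qed

context
  fixes Q :: "('f, 'q, 'k) module_scheme" and \<rho> :: "'a \<Rightarrow> ('f, 'a, 'q) tensor_elem"
  assumes Q: "unital_algebra F Q" and \<rho>: "\<rho> \<in> lhom F A (tensor F A Q)"
begin

abbreviation mat where "mat i j \<equiv> coord Q i (\<rho> (e j))"

lemma Qv: "vectorspace F Q"
  by (rule unital_algebra_vs[OF Q])

lemma mat_closed: "i \<in> J \<Longrightarrow> j \<in> J \<Longrightarrow> mat i j \<in> carrier Q"
  by (rule contract_closed[OF vs Qv d_lhom lhom_closed[OF \<rho> e_closed]])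

lemma rho_word_multilin: "multilin F A n (tensor F (tpower F A n) Q) (rho_word F A Q \<rho>)"
proof (induct n)
  case 0
  interpret Q: unital_algebra F Q by (rule Q)
  have "pure_tensor F (tpower F A 0) Q (pure_word F A []) \<one>\<^bsub>Q\<^esub> \<in> carrier (tensor F (tpower F A 0) Q)"
    by (intro pure_tensor_closed[OF tpower_vs[OF vs] Qv] pure_word_closed[OF vs]) (simp_all add: words_0)
  then show ?case by (simp add: multilin_0_iff)
next
  case (Suc n)
  note jb = rho_join_bilin[OF Q, of n]
  show ?case unfolding multilin_Suc_iff
  proof (intro conjI ballI)
    fix as assume as: "as \<in> words A n"
    then have "length as = n" by (simp add: words_def)
    then show "(\<lambda>a. rho_word F A Q \<rho> (a # as)) \<in> lhom F A (tensor F (tpower F A (Suc n)) Q)"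
      using lhom_comp[OF \<rho> bilin_left[OF jb multilin_closed[OF Suc as]]] by simp
  next
    fix a assume a: "a \<in> carrier A"
    show "multilin F A n (tensor F (tpower F A (Suc n)) Q) (\<lambda>as. rho_word F A Q \<rho> (a # as))"
    \<comment> \<open>The recursion of \<open>rho_word\<close> joins with exponent
      \<open>length as\<close>, which is the fixed \<open>n\<close> only on words of length
      \<open>n\<close>; hence the replacement on \<open>words A n\<close>.\<close>
    proof (rule multilin_cong[OF vs _ multilin_comp[OF Suc bilin_right[OF jb lhom_closed[OF \<rho> a]]]])
      fix as assume "as \<in> words A n"
      then have "length as = n" by (simp add: words_def)
      then show "rho_word F A Q \<rho> (a # as) = rho_join F A Q n (\<rho> a) (rho_word F A Q \<rho> as)" by simp
    qed
  qed
qed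

lemma coord_rho_word:
  "I \<in> idx J n \<Longrightarrow> K \<in> idx J n \<Longrightarrow>
    contract F (tpower F A n) Q (tcoord n I) (rho_word F A Q \<rho> (map e K)) = mat_word Q mat I K"
proof (induct n arbitrary: I K)
  case 0
  interpret Q: unital_algebra F Q by (rule Q)
  interpret P: dual_bases F "tpower F A 0" "idx J 0" tbase "tcoord 0" by (rule tpower_dual_bases)
  have I: "I = []" "K = []" using 0 by simp_all
  have "[] \<in> idx J 0" "[] \<in> words A 0" by (simp_all add: words_0)
  then have "tcoord 0 [] (pure_word F A []) = \<one>\<^bsub>F\<^esub>" by (simp add: tcoord_pure)
  moreover have "contract F (tpower F A 0) Q (tcoord 0 []) (pure_tensor F (tpower F A 0) Q (pure_word F A []) \<one>\<^bsub>Q\<^esub>)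
      = tcoord 0 [] (pure_word F A []) \<odot>\<^bsub>Q\<^esub> \<one>\<^bsub>Q\<^esub>"
    by (rule contract_pure[OF P.vs Qv P.d_lhom pure_word_closed[OF vs]]) (simp_all add: words_0)
  ultimately show ?case by (simp add: I)
next
  case (Suc n)
  obtain i I' where I: "I = i # I'" "i \<in> J" "I' \<in> idx J n" using Suc.prems(1) unfolding idx_Suc by blast
  obtain k K' where K: "K = k # K'" "k \<in> J" "K' \<in> idx J n" using Suc.prems(2) unfolding idx_Suc by blast
  have len: "length K' = n" using K(3) by simp
  show ?case
    using coord_rho_join[OF Q I(2,3) lhom_closed[OF \<rho> e_closed[OF K(2)]]
        multilin_closed[OF rho_word_multilin map_e_words[OF K(3)]]]
      Suc.hyps[OF I(3) K(3)] by (simp add: I(1) K(1) len)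
qed

lemma rho_power_lhom: "rho_power F A Q \<rho> n \<in> lhom F (tpower F A n) (tensor F (tpower F A n) Q)"
  unfolding rho_power_def by (rule tpower_lift_lhom[OF vs tensor_vs[OF tpower_vs[OF vs] Qv] rho_word_multilin])

lemma coord_rho_power:
  assumes I: "I \<in> idx J n" and K: "K \<in> idx J n"
  shows "contract F (tpower F A n) Q (tcoord n I) (rho_power F A Q \<rho> n (tbase K)) = mat_word Q mat I K"
proof -
  have "rho_power F A Q \<rho> n (tbase K) = rho_word F A Q \<rho> (map e K)"
    unfolding rho_power_def tbase_def
    by (rule tpower_lift_pure[OF vs tensor_vs[OF tpower_vs[OF vs] Qv] rho_word_multilin map_e_words[OF K]])
  then show ?thesis using coord_rho_word[OF I K] by simp
qed

text \<open>Both sides of the comeasuring identity are linear in \<open>x\<close>, so basis words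
  suffice; the resulting tensors are then compared coefficient by coefficient.\<close>

lemma comeasuring_iff:
  fixes ops :: "'w \<Rightarrow> ('f, 'a) tpower_elem \<Rightarrow> ('f, 'a) tpower_elem" and s t :: "'w \<Rightarrow> nat"
  assumes ops: "\<And>w. w \<in> \<Omega> \<Longrightarrow> ops w \<in> lhom F (tpower F A (s w)) (tpower F A (t w))"
  shows "comeasuring F \<Omega> s t A ops Q \<rho> \<longleftrightarrow>
    mat_eqs J \<Omega> s t (\<lambda>w I K. tcoord (t w) I (ops w (tbase K))) Q mat"
proof -
  have *: "(\<forall>x\<in>carrier (tpower F A (s w)). rho_power F A Q \<rho> (t w) (ops w x) =
      tensor_map F (tpower F A (s w)) Q (tpower F A (t w)) Q (ops w) (\<lambda>q. q) (rho_power F A Q \<rho> (s w) x)) \<longleftrightarrow>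
    (\<forall>K\<in>idx J (s w). \<forall>I\<in>idx J (t w).
      finsum Q (\<lambda>L. tcoord (t w) L (ops w (tbase K)) \<odot>\<^bsub>Q\<^esub> mat_word Q mat I L) (idx J (t w)) =
      finsum Q (\<lambda>L. tcoord (t w) I (ops w (tbase L)) \<odot>\<^bsub>Q\<^esub> mat_word Q mat L K) (idx J (s w)))"
    (is "(\<forall>x\<in>_. ?f x = ?g x) \<longleftrightarrow> (\<forall>K\<in>_. \<forall>I\<in>_. ?F I K = ?G I K)")
    if w: "w \<in> \<Omega>" for w
  proof -
    interpret Q: vectorspace F Q by (rule Qv)
    interpret S: dual_bases F "tpower F A (s w)" "idx J (s w)" tbase "tcoord (s w)" by (rule tpower_dual_bases)
    interpret T: dual_bases F "tpower F A (t w)" "idx J (t w)" tbase "tcoord (t w)" by (rule tpower_dual_bases)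
    note o = ops[OF w]
    have f: "?f \<in> lhom F (tpower F A (s w)) (tensor F (tpower F A (t w)) Q)"
      by (rule lhom_comp[OF o rho_power_lhom])
    have g: "?g \<in> lhom F (tpower F A (s w)) (tensor F (tpower F A (t w)) Q)"
      by (rule lhom_comp[OF rho_power_lhom tensor_map_lhom[OF S.vs Qv T.vs Qv o lhom_id]])
    \<comment> \<open>Here the value of the operation at \<open>K\<close> is expanded in basis words
      before the coaction is applied.\<close>
    have F_eq: "contract F (tpower F A (t w)) Q (tcoord (t w) I) (?f (tbase K)) = ?F I K"
      if I: "I \<in> idx J (t w)" and K: "K \<in> idx J (s w)" for I K
    proof -
      note x = lhom_closed[OF o S.e_closed[OF K]]
      have "contract F (tpower F A (t w)) Q (tcoord (t w) I) (?f (tbase K))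
        = finsum Q (\<lambda>L. tcoord (t w) L (ops w (tbase K)) \<odot>\<^bsub>Q\<^esub>
          contract F (tpower F A (t w)) Q (tcoord (t w) I) (rho_power F A Q \<rho> (t w) (tbase L))) (idx J (t w))"
        by (rule T.lhom_expand[OF Qv lhom_comp[OF rho_power_lhom contract_lhom[OF T.vs Qv T.d_lhom[OF I]]] x])
      also have "\<dots> = ?F I K"
      proof (rule Q.M.finsum_cong'[OF refl])
        fix L assume L: "L \<in> idx J (t w)"
        show "tcoord (t w) L (ops w (tbase K)) \<odot>\<^bsub>Q\<^esub>
            contract F (tpower F A (t w)) Q (tcoord (t w) I) (rho_power F A Q \<rho> (t w) (tbase L))
          = tcoord (t w) L (ops w (tbase K)) \<odot>\<^bsub>Q\<^esub> mat_word Q mat I L"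
          unfolding coord_rho_power[OF I L] by (rule refl)
      next
        show "(\<lambda>L. tcoord (t w) L (ops w (tbase K)) \<odot>\<^bsub>Q\<^esub> mat_word Q mat I L) \<in> idx J (t w) \<rightarrow> carrier Q"
        proof (rule Pi_I)
          fix L assume L: "L \<in> idx J (t w)"
          have "mat_word Q mat I L \<in> carrier Q"
            unfolding coord_rho_power[OF I L, symmetric]
            by (rule contract_closed[OF T.vs Qv T.d_lhom[OF I] lhom_closed[OF rho_power_lhom T.e_closed[OF L]]])
          then show "tcoord (t w) L (ops w (tbase K)) \<odot>\<^bsub>Q\<^esub> mat_word Q mat I L \<in> carrier Q"
            by (rule Q.smult_closed[OF T.d_closed[OF L x]])
        qed
      qed
      finally show ?thesis .
    qed
    \<comment> \<open>Here naturality moves the operation into the functional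
      \<open>tcoord (t w) I\<close>, and the composite functional is expanded in the coordinates of
      the source power.\<close>
    have G_eq: "contract F (tpower F A (t w)) Q (tcoord (t w) I) (?g (tbase K)) = ?G I K"
      if I: "I \<in> idx J (t w)" and K: "K \<in> idx J (s w)" for I K
    proof -
      note x = lhom_closed[OF rho_power_lhom S.e_closed[OF K]]
      note oI = lhom_comp[OF o T.d_lhom[OF I]]
      have "contract F (tpower F A (t w)) Q (tcoord (t w) I) (?g (tbase K))
        = contract F (tpower F A (s w)) Q (\<lambda>x. tcoord (t w) I (ops w x)) (rho_power F A Q \<rho> (s w) (tbase K))"
        by (rule contract_map[OF S.vs T.vs Qv Qv o lhom_id T.d_lhom[OF I] x])
      also have "\<dots> = finsum Q (\<lambda>L. tcoord (t w) I (ops w (tbase L)) \<odot>\<^bsub>Q\<^esub>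
          contract F (tpower F A (s w)) Q (tcoord (s w) L) (rho_power F A Q \<rho> (s w) (tbase K))) (idx J (s w))"
        by (rule S.contract_expand[OF Qv oI x])
      also have "\<dots> = ?G I K"
      proof (rule Q.M.finsum_cong'[OF refl])
        fix L assume L: "L \<in> idx J (s w)"
        show "tcoord (t w) I (ops w (tbase L)) \<odot>\<^bsub>Q\<^esub>
            contract F (tpower F A (s w)) Q (tcoord (s w) L) (rho_power F A Q \<rho> (s w) (tbase K))
          = tcoord (t w) I (ops w (tbase L)) \<odot>\<^bsub>Q\<^esub> mat_word Q mat L K"
          unfolding coord_rho_power[OF L K] by (rule refl)
      next
        show "(\<lambda>L. tcoord (t w) I (ops w (tbase L)) \<odot>\<^bsub>Q\<^esub> mat_word Q mat L K) \<in> idx J (s w) \<rightarrow> carrier Q"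
        proof (rule Pi_I)
          fix L assume L: "L \<in> idx J (s w)"
          have "mat_word Q mat L K \<in> carrier Q"
            unfolding coord_rho_power[OF L K, symmetric]
            by (rule contract_closed[OF S.vs Qv S.d_lhom[OF L] x])
          then show "tcoord (t w) I (ops w (tbase L)) \<odot>\<^bsub>Q\<^esub> mat_word Q mat L K \<in> carrier Q"
            by (rule Q.smult_closed[OF T.d_closed[OF I lhom_closed[OF o S.e_closed[OF L]]]])
        qed
      qed
      finally show ?thesis .
    qed
    show ?thesis
    proof (intro iffI ballI)
      fix K I assume l: "\<forall>x\<in>carrier (tpower F A (s w)). ?f x = ?g x"
        and K: "K \<in> idx J (s w)" and I: "I \<in> idx J (t w)"
      have "?f (tbase K) = ?g (tbase K)" by (rule bspec[OF l S.e_closed[OF K]])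
      then show "?F I K = ?G I K" by (simp only: F_eq[OF I K, symmetric] G_eq[OF I K, symmetric])
    next
      fix x assume r: "\<forall>K\<in>idx J (s w). \<forall>I\<in>idx J (t w). ?F I K = ?G I K"
        and x: "x \<in> carrier (tpower F A (s w))"
      show "?f x = ?g x"
      proof (rule S.lhom_eqI[OF tensor_vs[OF T.vs Qv] f g _ x])
        fix K assume K: "K \<in> idx J (s w)"
        show "?f (tbase K) = ?g (tbase K)"
        proof (rule T.tensor_coord_eqI[OF Qv lhom_closed[OF f S.e_closed[OF K]] lhom_closed[OF g S.e_closed[OF K]]])
          fix I assume I: "I \<in> idx J (t w)"
          show "contract F (tpower F A (t w)) Q (tcoord (t w) I) (?f (tbase K))
            = contract F (tpower F A (t w)) Q (tcoord (t w) I) (?g (tbase K))"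
            unfolding F_eq[OF I K] G_eq[OF I K] by (rule bspec[OF bspec[OF r K] I])
        qed
      qed
    qed
  qed
  show ?thesis
    unfolding comeasuring_def mat_eqs_def using * Q \<rho> by (simp cong: ball_cong)
qed

end

subsection \<open>Cosupports\<close>

text \<open>Column \<open>j\<close> holds the coordinates of the image of \<open>e j\<close>, the
  same convention as for the coefficient matrix of a coaction.\<close>

definition mat_op :: "('i \<Rightarrow> 'i \<Rightarrow> 'f) \<Rightarrow> 'a \<Rightarrow> 'a"
  where "mat_op M = (\<lambda>a\<in>carrier A. finsum A (\<lambda>j. d j a \<odot>\<^bsub>A\<^esub> finsum A (\<lambda>i. M i j \<odot>\<^bsub>A\<^esub> e i) J) J)"

lemma mat_op:
  assumes M: "\<And>i j. i \<in> J \<Longrightarrow> j \<in> J \<Longrightarrow> M i j \<in> carrier F"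
  shows mat_op_lin: "mat_op M \<in> lin F A A"
    and mat_op_entry: "\<And>i j. i \<in> J \<Longrightarrow> j \<in> J \<Longrightarrow> d i (mat_op M (e j)) = M i j"
proof -
  note x = extend_lhom[where u = "\<lambda>j. finsum A (\<lambda>i. M i j \<odot>\<^bsub>A\<^esub> e i) J", OF vs sum_closed[OF M]]
  show "mat_op M \<in> lin F A A" unfolding mat_op_def by (rule lin_restrict[OF vs x(1)])
  show "d i (mat_op M (e j)) = M i j" if i: "i \<in> J" and j: "j \<in> J" for i j
  proof -
    have "mat_op M (e j) = finsum A (\<lambda>i. M i j \<odot>\<^bsub>A\<^esub> e i) J"
      using x(2)[OF _ _ j] e_closed[OF j] by (simp add: mat_op_def)
    then show ?thesis using d_sum[OF i M[OF _ j]] by simp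
  qed
qed

lemma mat_op_unique:
  assumes f: "f \<in> lin F A A" and M: "\<And>i j. i \<in> J \<Longrightarrow> j \<in> J \<Longrightarrow> d i (f (e j)) = M i j"
  shows "f = mat_op M"
proof -
  have MF: "M i j \<in> carrier F" if "i \<in> J" "j \<in> J" for i j
    using d_closed[OF that(1) lhom_closed[OF linD[OF f] e_closed[OF that(2)]]] M[OF that] by simp
  have g: "mat_op M \<in> lin F A A" by (intro mat_op_lin MF)
  have g': "d i (mat_op M (e j)) = M i j" if "i \<in> J" "j \<in> J" for i j by (intro mat_op_entry MF that)
  show ?thesis
  proof (rule lin_eqI[OF f g], rule lhom_eqI[OF vs linD[OF f] linD[OF g]])
    fix j assume j: "j \<in> J"
    show "f (e j) = mat_op M (e j)"
    proof (rule eqI[OF lhom_closed[OF linD[OF f] e_closed[OF j]] lhom_closed[OF linD[OF g] e_closed[OF j]]])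
      show "d i (f (e j)) = d i (mat_op M (e j))" if i: "i \<in> J" for i
        by (simp only: M[OF i j] g'[OF i j])
    qed
  qed
qed

text \<open>Applying \<open>d i\<close> to the first factor and \<open>\<theta>\<close> to the
  second commute: on a pure tensor either order gives the product of the two scalars. Hence the
  entries of an operator in the cosupport are \<open>\<theta>\<close> of the coefficients.\<close>

lemma contract_functional:
  assumes Q: "vectorspace F Q" and \<theta>: "\<theta> \<in> lhom F Q (ground F)"
  shows contract_functional_lhom: "tensor_lift F A Q A (\<lambda>b q. \<theta> q \<odot>\<^bsub>A\<^esub> b) \<in> lhom F (tensor F A Q) A"
    and d_contract_functional: "\<And>i z. i \<in> J \<Longrightarrow> z \<in> carrier (tensor F A Q) \<Longrightarrow>
      d i (tensor_lift F A Q A (\<lambda>b q. \<theta> q \<odot>\<^bsub>A\<^esub> b) z) = \<theta> (coord Q i z)"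
proof -
  note G = ground_vs[OF F]
  interpret F: field F by (rule F)
  let ?\<beta> = "\<lambda>b q. \<theta> q \<odot>\<^bsub>A\<^esub> b"
  note b = bilin_comp[OF smult_bilin'[OF vs] lhom_id \<theta> lhom_id]
  show l: "tensor_lift F A Q A ?\<beta> \<in> lhom F (tensor F A Q) A" by (rule tensor_lift_lhom[OF vs Q vs b])
  fix i z assume i: "i \<in> J" and z: "z \<in> carrier (tensor F A Q)"
  show "d i (tensor_lift F A Q A ?\<beta> z) = \<theta> (coord Q i z)"
  proof (rule tensor_eqI[OF vs Q G lhom_comp[OF l d_lhom[OF i]] lhom_comp[OF contract_lhom[OF vs Q d_lhom[OF i]] \<theta>] _ z])
    fix a q assume a: "a \<in> carrier A" and q: "q \<in> carrier Q"
    have c: "\<theta> q \<in> carrier F" using lhom_closed[OF \<theta> q] by simp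
    have "d i (tensor_lift F A Q A ?\<beta> (pure_tensor F A Q a q)) = d i (\<theta> q \<odot>\<^bsub>A\<^esub> a)"
      unfolding tensor_lift_pure[OF vs Q vs b a q] by (rule refl)
    also have "\<dots> = \<theta> q \<otimes>\<^bsub>F\<^esub> d i a" using module_hom_smult[OF d_lhom[OF i] c a] by simp
    also have "\<dots> = d i a \<otimes>\<^bsub>F\<^esub> \<theta> q" by (rule F.m_comm[OF c d_closed[OF i a]])
    also have "\<dots> = \<theta> (d i a \<odot>\<^bsub>Q\<^esub> q)" using module_hom_smult[OF \<theta> d_closed[OF i a] q] by simp
    finally show "d i (tensor_lift F A Q A ?\<beta> (pure_tensor F A Q a q)) = \<theta> (coord Q i (pure_tensor F A Q a q))"
      unfolding contract_pure[OF vs Q d_lhom[OF i] a q] .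
  qed
qed

lemma cosupp_eq:
  assumes Q: "vectorspace F Q" and \<rho>: "\<rho> \<in> lhom F A (tensor F A Q)"
  shows "cosupp F A Q \<rho> = (\<lambda>\<theta>. mat_op (\<lambda>i j. \<theta> (coord Q i (\<rho> (e j))))) ` carrier (dual F Q)"
  unfolding cosupp_def
proof (rule image_cong[OF refl])
  fix \<theta> assume \<theta>: "\<theta> \<in> carrier (dual F Q)"
  have \<theta>l: "\<theta> \<in> lhom F Q (ground F)" using \<theta> by (simp add: dual_simps[OF F] linD)
  note l = contract_functional_lhom[OF Q \<theta>l]
  show "(\<lambda>a\<in>carrier A. tensor_lift F A Q A (\<lambda>b q. \<theta> q \<odot>\<^bsub>A\<^esub> b) (\<rho> a)) = mat_op (\<lambda>i j. \<theta> (coord Q i (\<rho> (e j))))"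
  proof (rule mat_op_unique)
    show "(\<lambda>a\<in>carrier A. tensor_lift F A Q A (\<lambda>b q. \<theta> q \<odot>\<^bsub>A\<^esub> b) (\<rho> a)) \<in> lin F A A"
      by (rule lin_restrict[OF vs lhom_comp[OF \<rho> l]])
    show "d i ((\<lambda>a\<in>carrier A. tensor_lift F A Q A (\<lambda>b q. \<theta> q \<odot>\<^bsub>A\<^esub> b) (\<rho> a)) (e j)) = \<theta> (coord Q i (\<rho> (e j)))"
      if i: "i \<in> J" and j: "j \<in> J" for i j
      using d_contract_functional[OF Q \<theta>l i lhom_closed[OF \<rho> e_closed[OF j]]] e_closed[OF j] by simp
  qed
qed

end

section \<open>Extension of functionals\<close>

text \<open>The space may be infinite dimensional, so Zorn's lemma is used: a maximal subspace
  meeting \<open>S\<close> only in zero is a complement.\<close>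

lemma subspace_complement:
  assumes V: "vectorspace F V" and S: "LinearCombinations.submodule F S V"
  obtains T where "LinearCombinations.submodule F T V" "S \<inter> T = {\<zero>\<^bsub>V\<^esub>}"
    "\<And>x. x \<in> carrier V \<Longrightarrow> \<exists>s\<in>S. \<exists>t\<in>T. x = s \<oplus>\<^bsub>V\<^esub> t"
proof -
  interpret V: vectorspace F V by (rule V)
  interpret S: LinearCombinations.submodule F S V by (rule S)
  let ?A = "{T. LinearCombinations.submodule F T V \<and> S \<inter> T = {\<zero>\<^bsub>V\<^esub>}}"
  have submodI: "LinearCombinations.submodule F T V"
    if "T \<subseteq> carrier V" "\<zero>\<^bsub>V\<^esub> \<in> T" "\<And>x y. x \<in> T \<Longrightarrow> y \<in> T \<Longrightarrow> x \<oplus>\<^bsub>V\<^esub> y \<in> T"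
      "\<And>c x. c \<in> carrier F \<Longrightarrow> x \<in> T \<Longrightarrow> c \<odot>\<^bsub>V\<^esub> x \<in> T" for T
    using that V.module_axioms by (simp add: LinearCombinations.submodule_def)
  have "LinearCombinations.submodule F {\<zero>\<^bsub>V\<^esub>} V" by (rule submodI) simp_all
  then have ne: "?A \<noteq> {}" using S.zero_closed by blast
  have "\<exists>M\<in>?A. \<forall>X\<in>?A. M \<subseteq> X \<longrightarrow> X = M"
  proof (rule subset_Zorn_nonempty[OF ne])
    fix C assume C: "C \<noteq> {}" and ch: "subset.chain ?A C"
    have sub: "LinearCombinations.submodule F T V" "S \<inter> T = {\<zero>\<^bsub>V\<^esub>}" if "T \<in> C" for T
    proof -
      have "T \<in> ?A" using ch that unfolding subset.chain_def by (elim conjE subsetD)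
      then show "LinearCombinations.submodule F T V" "S \<inter> T = {\<zero>\<^bsub>V\<^esub>}" by simp_all
    qed
    note T = LinearCombinations.submodule.subset[OF sub(1)] LinearCombinations.submodule.zero_closed[OF sub(1)]
      LinearCombinations.submodule.m_closed[OF sub(1)] LinearCombinations.submodule.smult_closed[OF sub(1)]
    have "LinearCombinations.submodule F (\<Union>C) V"
    proof (rule submodI)
      show "\<Union>C \<subseteq> carrier V" by (rule Union_least) (rule T(1))
      obtain X where X: "X \<in> C" using C by blast
      show "\<zero>\<^bsub>V\<^esub> \<in> \<Union>C" by (rule UnionI[OF X T(2)[OF X]])
      show "c \<odot>\<^bsub>V\<^esub> x \<in> \<Union>C" if c: "c \<in> carrier F" and x: "x \<in> \<Union>C" for c x
      proof -
        obtain X where X: "X \<in> C" "x \<in> X" using x by (rule UnionE)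
        show ?thesis by (rule UnionI[OF X(1) T(4)[OF X(1) c X(2)]])
      qed
      fix x y assume "x \<in> \<Union>C" "y \<in> \<Union>C"
      then obtain X Y where XY: "X \<in> C" "Y \<in> C" "x \<in> X" "y \<in> Y" by blast
      have "X \<subseteq> Y \<or> Y \<subseteq> X" using ch XY(1,2) unfolding subset.chain_def by blast
      then show "x \<oplus>\<^bsub>V\<^esub> y \<in> \<Union>C"
      proof
        assume "X \<subseteq> Y"
        then have "x \<in> Y" using XY(3) by (rule subsetD)
        then show ?thesis by (rule UnionI[OF XY(2) T(3)[OF XY(2) _ XY(4)]])
      next
        assume "Y \<subseteq> X"
        then have "y \<in> X" using XY(4) by (rule subsetD)
        then show ?thesis by (rule UnionI[OF XY(1) T(3)[OF XY(1) XY(3)]])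
      qed
    qed
    moreover have "S \<inter> \<Union>C = {\<zero>\<^bsub>V\<^esub>}"
    proof -
      have "S \<inter> \<Union>C = (\<Union>T\<in>C. S \<inter> T)" by blast
      also have "\<dots> = {\<zero>\<^bsub>V\<^esub>}" using C sub(2) by simp
      finally show ?thesis .
    qed
    ultimately show "\<Union>C \<in> ?A" by simp
  qed
  then obtain M where M: "LinearCombinations.submodule F M V" "S \<inter> M = {\<zero>\<^bsub>V\<^esub>}"
    and max: "\<And>X. LinearCombinations.submodule F X V \<Longrightarrow> S \<inter> X = {\<zero>\<^bsub>V\<^esub>} \<Longrightarrow> M \<subseteq> X \<Longrightarrow> X = M"
    by (elim bexE CollectE conjE) (simp only: mem_Collect_eq Ball_def)
  interpret M: LinearCombinations.submodule F M V by (rule M)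
  have SV: "x \<in> carrier V" if "x \<in> S" for x using S.subset that by blast
  have MV: "x \<in> carrier V" if "x \<in> M" for x using M.subset that by blast
  have "\<exists>s\<in>S. \<exists>t\<in>M. x = s \<oplus>\<^bsub>V\<^esub> t" if x: "x \<in> carrier V" for x
  proof (rule ccontr)
    assume no: "\<not> (\<exists>s\<in>S. \<exists>t\<in>M. x = s \<oplus>\<^bsub>V\<^esub> t)"
    \<comment> \<open>\<open>M\<close> enlarged by the line through \<open>x\<close>. If
      \<open>m + c x\<close> lies in \<open>S\<close> with \<open>c\<close> nonzero, dividing by
      \<open>c\<close> writes \<open>x\<close> as a sum from \<open>S\<close> and \<open>M\<close>,
      which was excluded; so the enlargement still meets \<open>S\<close> trivially, and maximality
      puts \<open>x\<close> into \<open>M\<close>, again a contradiction.\<close>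
    let ?X = "{m \<oplus>\<^bsub>V\<^esub> c \<odot>\<^bsub>V\<^esub> x | m c. m \<in> M \<and> c \<in> carrier F}"
    have mem: "m \<oplus>\<^bsub>V\<^esub> c \<odot>\<^bsub>V\<^esub> x \<in> ?X" if "m \<in> M" "c \<in> carrier F" for m c using that by blast
    have "LinearCombinations.submodule F ?X V"
    proof (rule submodI)
      show "?X \<subseteq> carrier V" using MV x by auto
      show "\<zero>\<^bsub>V\<^esub> \<in> ?X" using mem[of "\<zero>\<^bsub>V\<^esub>" "\<zero>\<^bsub>F\<^esub>"] x by simp
    next
      fix y z assume "y \<in> ?X" "z \<in> ?X"
      then obtain m c m' c' where *: "y = m \<oplus>\<^bsub>V\<^esub> c \<odot>\<^bsub>V\<^esub> x" "z = m' \<oplus>\<^bsub>V\<^esub> c' \<odot>\<^bsub>V\<^esub> x"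
        "m \<in> M" "m' \<in> M" "c \<in> carrier F" "c' \<in> carrier F" by blast
      have "y \<oplus>\<^bsub>V\<^esub> z = (m \<oplus>\<^bsub>V\<^esub> m') \<oplus>\<^bsub>V\<^esub> (c \<oplus>\<^bsub>F\<^esub> c') \<odot>\<^bsub>V\<^esub> x"
        using * MV x by (simp add: V.smult_l_distr V.M.a_ac)
      then show "y \<oplus>\<^bsub>V\<^esub> z \<in> ?X" using mem[of "m \<oplus>\<^bsub>V\<^esub> m'" "c \<oplus>\<^bsub>F\<^esub> c'"] * by simp
    next
      fix a y assume a: "a \<in> carrier F" and "y \<in> ?X"
      then obtain m c where *: "y = m \<oplus>\<^bsub>V\<^esub> c \<odot>\<^bsub>V\<^esub> x" "m \<in> M" "c \<in> carrier F" by blast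
      have "a \<odot>\<^bsub>V\<^esub> y = a \<odot>\<^bsub>V\<^esub> m \<oplus>\<^bsub>V\<^esub> (a \<otimes>\<^bsub>F\<^esub> c) \<odot>\<^bsub>V\<^esub> x"
        using * MV x a by (simp add: V.smult_r_distr V.smult_assoc1)
      then show "a \<odot>\<^bsub>V\<^esub> y \<in> ?X" using mem[of "a \<odot>\<^bsub>V\<^esub> m" "a \<otimes>\<^bsub>F\<^esub> c"] * a by simp
    qed
    moreover have "S \<inter> ?X = {\<zero>\<^bsub>V\<^esub>}"
    proof (intro equalityI subsetI)
      fix y assume "y \<in> S \<inter> ?X"
      then obtain m c where y: "y \<in> S" "y = m \<oplus>\<^bsub>V\<^esub> c \<odot>\<^bsub>V\<^esub> x" and m: "m \<in> M" and c: "c \<in> carrier F" by blast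
      have "c = \<zero>\<^bsub>F\<^esub>"
      proof (rule ccontr)
        assume "c \<noteq> \<zero>\<^bsub>F\<^esub>"
        then have "c \<in> Units F" using c V.field_Units by blast
        then have i: "inv\<^bsub>F\<^esub> c \<in> carrier F" "inv\<^bsub>F\<^esub> c \<otimes>\<^bsub>F\<^esub> c = \<one>\<^bsub>F\<^esub>" by simp_all
        have xc: "c \<odot>\<^bsub>V\<^esub> x \<in> carrier V" "\<ominus>\<^bsub>V\<^esub> m \<in> carrier V" using c x MV[OF m] by simp_all
        have mM: "\<ominus>\<^bsub>V\<^esub> m \<in> M"
          using M.smult_closed[of "\<ominus>\<^bsub>F\<^esub> \<one>\<^bsub>F\<^esub>" m] m MV[OF m] by (simp add: V.smult_minus_1)
        have "c \<odot>\<^bsub>V\<^esub> x = y \<oplus>\<^bsub>V\<^esub> \<ominus>\<^bsub>V\<^esub> m"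
          unfolding y(2) using xc MV[OF m] by (simp add: V.M.a_ac V.M.r_neg1 V.M.r_neg2)
        then have "inv\<^bsub>F\<^esub> c \<odot>\<^bsub>V\<^esub> (c \<odot>\<^bsub>V\<^esub> x) = inv\<^bsub>F\<^esub> c \<odot>\<^bsub>V\<^esub> y \<oplus>\<^bsub>V\<^esub> inv\<^bsub>F\<^esub> c \<odot>\<^bsub>V\<^esub> (\<ominus>\<^bsub>V\<^esub> m)"
          using V.smult_r_distr[OF i(1) SV[OF y(1)] xc(2)] by simp
        then have "x = inv\<^bsub>F\<^esub> c \<odot>\<^bsub>V\<^esub> y \<oplus>\<^bsub>V\<^esub> inv\<^bsub>F\<^esub> c \<odot>\<^bsub>V\<^esub> (\<ominus>\<^bsub>V\<^esub> m)"
          using V.smult_assoc1[OF i(1) c x] i(2) x by simp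
        then have "\<exists>s\<in>S. \<exists>t\<in>M. x = s \<oplus>\<^bsub>V\<^esub> t"
          by (rule bexI[OF bexI[OF _ M.smult_closed[OF i(1) mM]] S.smult_closed[OF i(1) y(1)]])
        then show False by (rule notE[OF no])
      qed
      then have "y = m" using y(2) x MV[OF m] by simp
      then have "y \<in> S \<inter> M" using y m by simp
      then show "y \<in> {\<zero>\<^bsub>V\<^esub>}" using M(2) by simp
    next
      fix y assume "y \<in> {\<zero>\<^bsub>V\<^esub>}"
      then show "y \<in> S \<inter> ?X" using mem[of "\<zero>\<^bsub>V\<^esub>" "\<zero>\<^bsub>F\<^esub>"] x by simp
    qed
    moreover have "M \<subseteq> ?X"
    proof
      fix m assume m: "m \<in> M"
      show "m \<in> ?X" using mem[OF m, of "\<zero>\<^bsub>F\<^esub>"] x MV[OF m] by simp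
    qed
    ultimately have "?X = M" by (rule max)
    then have "x \<in> M" using mem[of "\<zero>\<^bsub>V\<^esub>" "\<one>\<^bsub>F\<^esub>"] x by simp
    moreover have "x = \<zero>\<^bsub>V\<^esub> \<oplus>\<^bsub>V\<^esub> x" using x by simp
    ultimately have "\<exists>s\<in>S. \<exists>t\<in>M. x = s \<oplus>\<^bsub>V\<^esub> t" by (intro bexI[OF bexI[OF _ _] S.zero_closed])
    then show False by (rule notE[OF no])
  qed
  then show ?thesis by (rule that[OF M])
qed

text \<open>Compose \<open>\<theta>\<close> with the projection onto \<open>S\<close> along a
  complement. This is what transfers a cosupport condition from an algebra to its
  subalgebras.\<close>

lemma extend_functional:
  assumes V: "vectorspace F V" and S: "LinearCombinations.submodule F S V"
    and closed: "\<And>x. x \<in> S \<Longrightarrow> \<theta> x \<in> carrier F"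
    and add: "\<And>x y. x \<in> S \<Longrightarrow> y \<in> S \<Longrightarrow> \<theta> (x \<oplus>\<^bsub>V\<^esub> y) = \<theta> x \<oplus>\<^bsub>F\<^esub> \<theta> y"
    and smult: "\<And>c x. c \<in> carrier F \<Longrightarrow> x \<in> S \<Longrightarrow> \<theta> (c \<odot>\<^bsub>V\<^esub> x) = c \<otimes>\<^bsub>F\<^esub> \<theta> x"
  obtains \<theta>' where "\<theta>' \<in> carrier (dual F V)" "\<And>x. x \<in> S \<Longrightarrow> \<theta>' x = \<theta> x"
proof -
  interpret V: vectorspace F V by (rule V)
  interpret S: LinearCombinations.submodule F S V by (rule S)
  obtain T where T: "LinearCombinations.submodule F T V" "S \<inter> T = {\<zero>\<^bsub>V\<^esub>}"
    and dec: "\<And>x. x \<in> carrier V \<Longrightarrow> \<exists>s\<in>S. \<exists>t\<in>T. x = s \<oplus>\<^bsub>V\<^esub> t"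
    using subspace_complement[OF V S] by metis
  interpret T: LinearCombinations.submodule F T V by (rule T)
  have SV: "x \<in> carrier V" if "x \<in> S" for x using S.subset that by blast
  have TV: "x \<in> carrier V" if "x \<in> T" for x using T.subset that by blast
  have Sneg: "\<ominus>\<^bsub>V\<^esub> x \<in> S" if "x \<in> S" for x
    using S.smult_closed[of "\<ominus>\<^bsub>F\<^esub> \<one>\<^bsub>F\<^esub>" x] that SV[OF that] by (simp add: V.smult_minus_1)
  have Tneg: "\<ominus>\<^bsub>V\<^esub> x \<in> T" if "x \<in> T" for x
    using T.smult_closed[of "\<ominus>\<^bsub>F\<^esub> \<one>\<^bsub>F\<^esub>" x] that TV[OF that] by (simp add: V.smult_minus_1)
  define p where "p x = (SOME s. s \<in> S \<and> (\<exists>t\<in>T. x = s \<oplus>\<^bsub>V\<^esub> t))" for x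
  \<comment> \<open>The component chosen by \<open>SOME\<close> is the only one: two decompositions
    of the same vector differ by an element of both \<open>S\<close> and \<open>T\<close>, hence by
    zero.\<close>
  have p: "p (s \<oplus>\<^bsub>V\<^esub> t) = s" if s: "s \<in> S" and t: "t \<in> T" for s t
  proof -
    have "\<exists>s'. s' \<in> S \<and> (\<exists>t'\<in>T. s \<oplus>\<^bsub>V\<^esub> t = s' \<oplus>\<^bsub>V\<^esub> t')" using s t by blast
    from someI_ex[OF this] obtain t' where s': "p (s \<oplus>\<^bsub>V\<^esub> t) \<in> S" and t': "t' \<in> T"
      and eq: "s \<oplus>\<^bsub>V\<^esub> t = p (s \<oplus>\<^bsub>V\<^esub> t) \<oplus>\<^bsub>V\<^esub> t'" unfolding p_def by blast
    let ?s = "p (s \<oplus>\<^bsub>V\<^esub> t)"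
    note c = SV[OF s] SV[OF s'] TV[OF t] TV[OF t']
    have "?s \<oplus>\<^bsub>V\<^esub> \<ominus>\<^bsub>V\<^esub> s = t \<oplus>\<^bsub>V\<^esub> \<ominus>\<^bsub>V\<^esub> t'"
    proof -
      have "?s \<oplus>\<^bsub>V\<^esub> \<ominus>\<^bsub>V\<^esub> s = (?s \<oplus>\<^bsub>V\<^esub> t') \<oplus>\<^bsub>V\<^esub> \<ominus>\<^bsub>V\<^esub> t' \<oplus>\<^bsub>V\<^esub> \<ominus>\<^bsub>V\<^esub> s"
        using c by (simp add: V.M.a_assoc V.M.r_neg)
      also have "\<dots> = (s \<oplus>\<^bsub>V\<^esub> t) \<oplus>\<^bsub>V\<^esub> \<ominus>\<^bsub>V\<^esub> t' \<oplus>\<^bsub>V\<^esub> \<ominus>\<^bsub>V\<^esub> s" by (simp only: eq[symmetric])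
      also have "\<dots> = \<ominus>\<^bsub>V\<^esub> s \<oplus>\<^bsub>V\<^esub> (s \<oplus>\<^bsub>V\<^esub> (t \<oplus>\<^bsub>V\<^esub> \<ominus>\<^bsub>V\<^esub> t'))"
        using c by (simp add: V.M.a_ac)
      also have "\<dots> = t \<oplus>\<^bsub>V\<^esub> \<ominus>\<^bsub>V\<^esub> t'" using c by (intro V.M.r_neg1) simp_all
      finally show ?thesis .
    qed
    then have "?s \<oplus>\<^bsub>V\<^esub> \<ominus>\<^bsub>V\<^esub> s \<in> S \<inter> T"
      using S.m_closed[OF s' Sneg[OF s]] T.m_closed[OF t Tneg[OF t']] by simp
    then have "?s \<ominus>\<^bsub>V\<^esub> s = \<zero>\<^bsub>V\<^esub>" using T(2) by (simp add: a_minus_def)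
    then show ?thesis using c by simp
  qed
  have "(\<lambda>x. \<theta> (p x)) \<in> lhom F V (ground F)"
  proof (rule lhomI)
    fix x assume "x \<in> carrier V"
    then obtain s t where x: "s \<in> S" "t \<in> T" "x = s \<oplus>\<^bsub>V\<^esub> t" using dec by blast
    then show "\<theta> (p x) \<in> carrier (ground F)" using closed by (simp add: p)
    fix y assume "y \<in> carrier V"
    then obtain s' t' where y: "s' \<in> S" "t' \<in> T" "y = s' \<oplus>\<^bsub>V\<^esub> t'" using dec by blast
    have "x \<oplus>\<^bsub>V\<^esub> y = (s \<oplus>\<^bsub>V\<^esub> s') \<oplus>\<^bsub>V\<^esub> (t \<oplus>\<^bsub>V\<^esub> t')"
      using SV[OF x(1)] SV[OF y(1)] TV[OF x(2)] TV[OF y(2)] by (simp add: x(3) y(3) V.M.a_ac)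
    then have "p (x \<oplus>\<^bsub>V\<^esub> y) = s \<oplus>\<^bsub>V\<^esub> s'" using p[OF S.m_closed[OF x(1) y(1)] T.m_closed[OF x(2) y(2)]] by simp
    then show "\<theta> (p (x \<oplus>\<^bsub>V\<^esub> y)) = \<theta> (p x) \<oplus>\<^bsub>ground F\<^esub> \<theta> (p y)"
      using x y by (simp add: p add)
  next
    fix c x assume c: "c \<in> carrier F" and "x \<in> carrier V"
    then obtain s t where x: "s \<in> S" "t \<in> T" "x = s \<oplus>\<^bsub>V\<^esub> t" using dec by blast
    have "c \<odot>\<^bsub>V\<^esub> x = c \<odot>\<^bsub>V\<^esub> s \<oplus>\<^bsub>V\<^esub> c \<odot>\<^bsub>V\<^esub> t"
      unfolding x(3) by (rule V.smult_r_distr[OF c SV[OF x(1)] TV[OF x(2)]])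
    then have "p (c \<odot>\<^bsub>V\<^esub> x) = c \<odot>\<^bsub>V\<^esub> s" using p[OF S.smult_closed[OF c x(1)] T.smult_closed[OF c x(2)]] by simp
    then show "\<theta> (p (c \<odot>\<^bsub>V\<^esub> x)) = c \<odot>\<^bsub>ground F\<^esub> \<theta> (p x)"
      using x c by (simp add: p smult)
  qed
  from lin_restrict[OF V this] have "(\<lambda>x\<in>carrier V. \<theta> (p x)) \<in> carrier (dual F V)"
    by (simp add: dual_simps[OF field_vectorspace[OF V]])
  moreover have "(\<lambda>x\<in>carrier V. \<theta> (p x)) x = \<theta> x" if x: "x \<in> S" for x
    using p[OF x T.zero_closed] SV[OF x] by simp
  ultimately show ?thesis by (rule that)
qed

section \<open>Subalgebras\<close>

text \<open>Besides shrinking the carrier this drops all further record fields. So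
  \<open>sub_algebra B (carrier B)\<close> is \<open>B\<close> as a plain \<open>module\<close>, the
  kind of record over which initiality quantifies.\<close>

definition sub_algebra :: "('f, 'q, 'k) module_scheme \<Rightarrow> 'q set \<Rightarrow> ('f, 'q) module"
  where "sub_algebra Q S = \<lparr>carrier = S, mult = mult Q, one = one Q, zero = zero Q, add = add Q, smult = smult Q\<rparr>"

lemma sub_algebra_simps [simp]:
  "carrier (sub_algebra Q S) = S" "mult (sub_algebra Q S) = mult Q" "one (sub_algebra Q S) = one Q"
  "zero (sub_algebra Q S) = zero Q" "add (sub_algebra Q S) = add Q" "smult (sub_algebra Q S) = smult Q"
  by (simp_all add: sub_algebra_def)

lemma lhom_sub_algebra_carrier: "lhom F P (sub_algebra Q (carrier Q)) = lhom F P Q"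
  by (simp add: module_hom_def)

lemma algebra_hom_sub_algebra_carrier:
  "algebra_hom F P (sub_algebra Q (carrier Q)) = algebra_hom F P Q"
  by (simp add: algebra_hom_def lin_def lhom_sub_algebra_carrier ring_hom_def)

definition closed_subalgebra ::
  "('f, 'm) ring_scheme \<Rightarrow> ('f, 'q, 'k) module_scheme \<Rightarrow> 'q set \<Rightarrow> bool"
  where "closed_subalgebra F Q S \<longleftrightarrow> LinearCombinations.submodule F S Q \<and> \<one>\<^bsub>Q\<^esub> \<in> S \<and>
    (\<forall>x\<in>S. \<forall>y\<in>S. x \<otimes>\<^bsub>Q\<^esub> y \<in> S)"

lemma closed_subalgebraD:
  assumes "closed_subalgebra F Q S"
  shows "LinearCombinations.submodule F S Q" "S \<subseteq> carrier Q" "\<one>\<^bsub>Q\<^esub> \<in> S"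
    "\<And>x y. x \<in> S \<Longrightarrow> y \<in> S \<Longrightarrow> x \<otimes>\<^bsub>Q\<^esub> y \<in> S"
  using assms by (auto simp: closed_subalgebra_def dest: LinearCombinations.submodule.subset)

lemma closed_subalgebra_carrier:
  assumes "unital_algebra F Q" shows "closed_subalgebra F Q (carrier Q)"
proof -
  interpret Q: unital_algebra F Q by fact
  show ?thesis
    unfolding closed_subalgebra_def LinearCombinations.submodule_def using Q.module_axioms by simp
qed

text \<open>The target is an arbitrary record. Thus \<open>tensor_algebra\<close> can take the place
  of \<open>T\<close> while only its operations, and no algebra laws for it, are at hand.\<close>

lemma closed_subalgebra_equalizer:
  assumes B: "unital_algebra F B"
    and f: "f \<in> lhom F B T" "f \<in> ring_hom B T" and g: "g \<in> lhom F B T" "g \<in> ring_hom B T"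
  shows "closed_subalgebra F B {b \<in> carrier B. f b = g b}"
proof -
  interpret B: unital_algebra F B by fact
  \<comment> \<open>No law about the zero of \<open>T\<close> is available. Writing zero as the
    scalar zero times the unit sends it under both maps to the same element of
    \<open>T\<close>.\<close>
  have "f \<zero>\<^bsub>B\<^esub> = g \<zero>\<^bsub>B\<^esub>"
  proof -
    have "\<zero>\<^bsub>B\<^esub> = \<zero>\<^bsub>F\<^esub> \<odot>\<^bsub>B\<^esub> \<one>\<^bsub>B\<^esub>" by simp
    then show ?thesis
      using module_hom_smult[OF f(1), of "\<zero>\<^bsub>F\<^esub>" "\<one>\<^bsub>B\<^esub>"] module_hom_smult[OF g(1), of "\<zero>\<^bsub>F\<^esub>" "\<one>\<^bsub>B\<^esub>"]
        ring_hom_one[OF f(2)] ring_hom_one[OF g(2)] by simp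
  qed
  then show ?thesis
    unfolding closed_subalgebra_def LinearCombinations.submodule_def
    using B.module_axioms ring_hom_one[OF f(2)] ring_hom_one[OF g(2)]
    by (auto simp: module_hom_add[OF f(1)] module_hom_add[OF g(1)] module_hom_smult[OF f(1)]
        module_hom_smult[OF g(1)] ring_hom_mult[OF f(2)] ring_hom_mult[OF g(2)])
qed

lemma sub_algebra_inclusion:
  assumes "S \<subseteq> carrier Q" shows "(\<lambda>x. x) \<in> lhom F (sub_algebra Q S) Q"
  using assms by (intro lhomI) auto

lemma sub_algebra_unital:
  assumes Q: "unital_algebra F Q" and S: "closed_subalgebra F Q S"
  shows "unital_algebra F (sub_algebra Q S)"
proof -
  interpret Q: unital_algebra F Q by (rule Q)
  note c = closed_subalgebraD[OF S]
  interpret M: module F "Q\<lparr>carrier := S\<rparr>" by (rule Q.submodule_is_module[OF c(1)])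
  have SV: "x \<in> carrier Q" if "x \<in> S" for x using c(2) that by blast
  note sm = LinearCombinations.submodule.m_closed[OF c(1)] LinearCombinations.submodule.zero_closed[OF c(1)]
    LinearCombinations.submodule.smult_closed[OF c(1)]
  have neg: "\<ominus>\<^bsub>Q\<^esub> x \<in> S" if "x \<in> S" for x
    using sm(3)[of "\<ominus>\<^bsub>F\<^esub> \<one>\<^bsub>F\<^esub>" x] that SV[OF that] by (simp add: Q.smult_minus_1)
  have grp: "abelian_group (sub_algebra Q S)"
  proof (rule abelian_groupI, goal_cases)
    case (6 x)
    then show ?case using neg SV[of x] by (intro bexI[of _ "\<ominus>\<^bsub>Q\<^esub> x"]) (simp_all add: Q.M.l_neg)
  qed (simp_all add: sm SV Q.M.a_ac)
  have mon: "monoid (sub_algebra Q S)"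
    by (rule monoidI) (simp_all add: c SV Q.m_assoc)
  have rng: "ring (sub_algebra Q S)"
    by (rule ringI[OF grp mon]) (simp_all add: SV Q.l_distr Q.r_distr)
  have md: "module F (sub_algebra Q S)"
    by (rule moduleI[OF Q.R.is_cring grp])
      (simp_all add: sm SV Q.smult_l_distr Q.smult_r_distr Q.smult_assoc1)
  show ?thesis
    unfolding unital_algebra_def unital_algebra_axioms_def vectorspace_def
    using rng md Q.field_axioms by (simp add: SV Q.smult_mult_left Q.smult_mult_right)
qed

lemma finsum_sub_algebra:
  assumes Q: "unital_algebra F Q" and S: "closed_subalgebra F Q S" and g: "\<And>i. i \<in> I \<Longrightarrow> g i \<in> S"
  shows "finsum (sub_algebra Q S) g I = finsum Q g I"
  using lhom_finsum[OF unital_algebra_vs[OF sub_algebra_unital[OF Q S]] unital_algebra_vs[OF Q]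
    sub_algebra_inclusion[OF closed_subalgebraD(2)[OF S]], of I g] g by simp

lemma mat_word_sub_algebra [simp]: "mat_word (sub_algebra Q S) m I K = mat_word Q m I K"
  by (simp add: mat_word_def)

lemma mat_eqs_sub_algebra:
  assumes Q: "unital_algebra F Q" and S: "closed_subalgebra F Q S"
    and m: "\<And>i j. i \<in> J \<Longrightarrow> j \<in> J \<Longrightarrow> m i j \<in> S"
    and c: "\<And>w I K. w \<in> \<Omega> \<Longrightarrow> I \<in> idx J (t w) \<Longrightarrow> K \<in> idx J (s w) \<Longrightarrow> c w I K \<in> carrier F"
  shows "mat_eqs J \<Omega> s t c (sub_algebra Q S) m \<longleftrightarrow> mat_eqs J \<Omega> s t c Q m"
proof -
  interpret S: unital_algebra F "sub_algebra Q S" by (rule sub_algebra_unital[OF Q S])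
  have mw: "mat_word Q m I K \<in> S" if "I \<in> lists J" "K \<in> lists J" for I K
    using mat_word_closed[OF S.Q.ring_axioms, of J m I K] m that by simp
  have sm: "a \<odot>\<^bsub>Q\<^esub> x \<in> S" if "a \<in> carrier F" "x \<in> S" for a x
    using S.smult_closed[of a x] that by simp
  have 1: "finsum (sub_algebra Q S) (\<lambda>L. c w L K \<odot>\<^bsub>Q\<^esub> mat_word Q m I L) (idx J (t w))
      = finsum Q (\<lambda>L. c w L K \<odot>\<^bsub>Q\<^esub> mat_word Q m I L) (idx J (t w))"
    if "w \<in> \<Omega>" "K \<in> idx J (s w)" "I \<in> idx J (t w)" for w K I
    using that by (intro finsum_sub_algebra[OF Q S] sm mw c) simp_all
  have 2: "finsum (sub_algebra Q S) (\<lambda>L. c w I L \<odot>\<^bsub>Q\<^esub> mat_word Q m L K) (idx J (s w))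
      = finsum Q (\<lambda>L. c w I L \<odot>\<^bsub>Q\<^esub> mat_word Q m L K) (idx J (s w))"
    if "w \<in> \<Omega>" "K \<in> idx J (s w)" "I \<in> idx J (t w)" for w K I
    using that by (intro finsum_sub_algebra[OF Q S] sm mw c) simp_all
  show ?thesis
    unfolding mat_eqs_def sub_algebra_simps mat_word_sub_algebra
    by (intro ball_cong refl) (simp only: 1 2)
qed

section \<open>Universal matrices\<close>

lemma lin_End:
  assumes "unital_subalgebra F V (End_algebra F A)" shows "V \<subseteq> lin F A A"
proof -
  have "LinearCombinations.submodule F V (End_algebra F A)"
    using assms by (simp only: unital_subalgebra_def subspace_def)
  from LinearCombinations.submodule.subset[OF this] show ?thesis by (simp add: End_algebra_def)
qed

context dual_bases
begin

definition mat_coact :: "('f, 'q, 'k) module_scheme \<Rightarrow> ('i \<Rightarrow> 'i \<Rightarrow> 'q) \<Rightarrow> 'a \<Rightarrow> ('f, 'a, 'q) tensor_elem"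
  where "mat_coact Q m a = finsum (tensor F A Q) (\<lambda>j. d j a \<odot>\<^bsub>tensor F A Q\<^esub>
    finsum (tensor F A Q) (\<lambda>i. pure_tensor F A Q (e i) (m i j)) J) J"

lemma mat_coact:
  assumes Q: "vectorspace F Q" and m: "\<And>i j. i \<in> J \<Longrightarrow> j \<in> J \<Longrightarrow> m i j \<in> carrier Q"
  shows mat_coact_lhom: "mat_coact Q m \<in> lhom F A (tensor F A Q)"
    and coord_mat_coact: "\<And>i j. i \<in> J \<Longrightarrow> j \<in> J \<Longrightarrow> coord Q i (mat_coact Q m (e j)) = m i j"
proof -
  interpret T: vectorspace F "tensor F A Q" by (rule tensor_vs[OF vs Q])
  let ?u = "\<lambda>j. finsum (tensor F A Q) (\<lambda>i. pure_tensor F A Q (e i) (m i j)) J"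
  have u: "?u j \<in> carrier (tensor F A Q)" if j: "j \<in> J" for j
    by (intro T.M.finsum_closed Pi_I pure_tensor_closed[OF vs Q] e_closed m j)
  note x = extend_lhom[where u = ?u, OF T.vectorspace_axioms u]
  show "mat_coact Q m \<in> lhom F A (tensor F A Q)" unfolding mat_coact_def by (rule x(1))
  show "coord Q i (mat_coact Q m (e j)) = m i j" if i: "i \<in> J" and j: "j \<in> J" for i j
  proof -
    have "mat_coact Q m (e j) = ?u j" unfolding mat_coact_def by (rule x(2)[OF _ j])
    then show ?thesis using coord_sum[OF Q i, of "\<lambda>i. m i j"] m[OF _ j] by simp
  qed
qed

text \<open>By naturality of contraction the coefficients of the transported coaction are the images
  under \<open>\<phi>\<close> of the old ones. Morphisms of comeasurings thus become algebra maps
  carrying one matrix to the other.\<close>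

lemma tensor_map_hom_iff:
  assumes P: "vectorspace F P" and Q: "vectorspace F Q" and \<phi>: "\<phi> \<in> lhom F P Q"
    and \<rho>: "\<rho> \<in> lhom F A (tensor F A P)" and \<sigma>: "\<sigma> \<in> lhom F A (tensor F A Q)"
  shows "(\<forall>a\<in>carrier A. tensor_map F A P A Q (\<lambda>a. a) \<phi> (\<rho> a) = \<sigma> a) \<longleftrightarrow>
    (\<forall>i\<in>J. \<forall>j\<in>J. \<phi> (coord P i (\<rho> (e j))) = coord Q i (\<sigma> (e j)))" (is "?l \<longleftrightarrow> ?r")
proof -
  have h: "(\<lambda>a. tensor_map F A P A Q (\<lambda>a. a) \<phi> (\<rho> a)) \<in> lhom F A (tensor F A Q)"
    by (rule lhom_comp[OF \<rho> tensor_map_lhom[OF vs P vs Q lhom_id \<phi>]])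
  have c: "coord Q i (tensor_map F A P A Q (\<lambda>a. a) \<phi> (\<rho> (e j))) = \<phi> (coord P i (\<rho> (e j)))"
    if i: "i \<in> J" and j: "j \<in> J" for i j
    by (rule contract_map[OF vs vs P Q lhom_id \<phi> d_lhom[OF i] lhom_closed[OF \<rho> e_closed[OF j]]])
  show ?thesis
  proof
    assume l: ?l
    show ?r
    proof (intro ballI)
      fix i j assume i: "i \<in> J" and j: "j \<in> J"
      show "\<phi> (coord P i (\<rho> (e j))) = coord Q i (\<sigma> (e j))"
        unfolding c[OF i j, symmetric] bspec[OF l e_closed[OF j]] by (rule refl)
    qed
  next
    assume r: ?r
    show ?l
    proof
      fix a assume a: "a \<in> carrier A"
      show "tensor_map F A P A Q (\<lambda>a. a) \<phi> (\<rho> a) = \<sigma> a"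
      proof (rule lhom_eqI[OF tensor_vs[OF vs Q] h \<sigma> _ a])
        fix j assume j: "j \<in> J"
        show "tensor_map F A P A Q (\<lambda>a. a) \<phi> (\<rho> (e j)) = \<sigma> (e j)"
        proof (rule tensor_coord_eqI[OF Q lhom_closed[OF h e_closed[OF j]] lhom_closed[OF \<sigma> e_closed[OF j]]])
          show "coord Q i (tensor_map F A P A Q (\<lambda>a. a) \<phi> (\<rho> (e j))) = coord Q i (\<sigma> (e j))" if i: "i \<in> J" for i
            unfolding c[OF i j] by (rule bspec[OF bspec[OF r i] j])
        qed
      qed
    qed
  qed
qed

text \<open>\<open>good_matrix \<dots> Q m\<close> says that \<open>e\<^sub>j \<mapsto> \<Sum>\<^sub>i e\<^sub>i \<otimes> m\<^sub>i\<^sub>j\<close> is a comeasuring with cosupport in \<open>V\<close>.\<close>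

definition good_matrix ::
  "'w set \<Rightarrow> ('w \<Rightarrow> nat) \<Rightarrow> ('w \<Rightarrow> nat) \<Rightarrow> ('w \<Rightarrow> ('f, 'a) tpower_elem \<Rightarrow> ('f, 'a) tpower_elem)
    \<Rightarrow> ('a \<Rightarrow> 'a) set \<Rightarrow> ('f, 'q, 'k) module_scheme \<Rightarrow> ('i \<Rightarrow> 'i \<Rightarrow> 'q) \<Rightarrow> bool"
  where "good_matrix \<Omega> s t ops V Q m \<longleftrightarrow> unital_algebra F Q \<and> (\<forall>i\<in>J. \<forall>j\<in>J. m i j \<in> carrier Q) \<and>
    mat_eqs J \<Omega> s t (\<lambda>w I K. tcoord (t w) I (ops w (tbase K))) Q m \<and>
    (\<forall>\<theta>\<in>carrier (dual F Q). mat_op (\<lambda>i j. \<theta> (m i j)) \<in> V)"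

lemma good_matrixD:
  assumes "good_matrix \<Omega> s t ops V Q m"
  shows "unital_algebra F Q" "\<And>i j. i \<in> J \<Longrightarrow> j \<in> J \<Longrightarrow> m i j \<in> carrier Q"
    "mat_eqs J \<Omega> s t (\<lambda>w I K. tcoord (t w) I (ops w (tbase K))) Q m"
    "\<And>\<theta>. \<theta> \<in> carrier (dual F Q) \<Longrightarrow> mat_op (\<lambda>i j. \<theta> (m i j)) \<in> V"
  using assms unfolding good_matrix_def by simp_all

lemma ops_tcoord_closed:
  assumes ops: "\<And>w. w \<in> \<Omega> \<Longrightarrow> ops w \<in> lhom F (tpower F A (s w)) (tpower F A (t w))"
    and "w \<in> \<Omega>" "I \<in> idx J (t w)" "K \<in> idx J (s w)"
  shows "tcoord (t w) I (ops w (tbase K)) \<in> carrier F"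
  by (rule dual_bases.d_closed[OF tpower_dual_bases assms(3)
      lhom_closed[OF ops[OF assms(2)] dual_bases.e_closed[OF tpower_dual_bases assms(4)]]])

lemma mat_op_cong:
  assumes "\<And>i j. i \<in> J \<Longrightarrow> j \<in> J \<Longrightarrow> M i j = M' i j" "\<And>i j. i \<in> J \<Longrightarrow> j \<in> J \<Longrightarrow> M' i j \<in> carrier F"
  shows "mat_op M = mat_op M'"
proof -
  have M: "M i j \<in> carrier F" if "i \<in> J" "j \<in> J" for i j using assms that by simp
  have "mat_op M \<in> lin F A A" by (intro mat_op_lin M)
  moreover have "d i (mat_op M (e j)) = M' i j" if "i \<in> J" "j \<in> J" for i j
  proof -
    have "d i (mat_op M (e j)) = M i j" by (intro mat_op_entry M that)
    then show ?thesis using assms(1)[OF that] by simp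
  qed
  ultimately show ?thesis by (rule mat_op_unique)
qed

lemma dual_functional_closed:
  assumes "\<theta> \<in> carrier (dual F Q)" "x \<in> carrier Q" shows "\<theta> x \<in> carrier F"
  using lhom_closed[OF linD[of \<theta> F Q "ground F"] assms(2)] assms(1) by (simp add: dual_simps[OF F])

text \<open>A matrix is a HOL function on the whole index type, but only its entries over
  \<open>J\<close> count. The matrix recovered from \<open>mat_coact\<close> is the original one
  only there.\<close>

lemma good_matrix_cong:
  assumes g: "good_matrix \<Omega> s t ops V Q m" and eq: "\<And>i j. i \<in> J \<Longrightarrow> j \<in> J \<Longrightarrow> m' i j = m i j"
    and ops: "\<And>w. w \<in> \<Omega> \<Longrightarrow> ops w \<in> lhom F (tpower F A (s w)) (tpower F A (t w))"
  shows "good_matrix \<Omega> s t ops V Q m'"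
proof -
  note D = good_matrixD[OF g]
  interpret Q: unital_algebra F Q by (rule D(1))
  have mw: "mat_word Q m' I K = mat_word Q m I K" if "I \<in> lists J" "K \<in> lists J" for I K
    by (rule mat_word_cong[OF eq that])
  have mc: "mat_word Q m I K \<in> carrier Q" if "I \<in> lists J" "K \<in> lists J" for I K
    by (rule mat_word_closed[OF Q.Q.ring_axioms D(2) that])
  have 1: "finsum Q (\<lambda>L. c L \<odot>\<^bsub>Q\<^esub> mat_word Q m' I L) (idx J n) = finsum Q (\<lambda>L. c L \<odot>\<^bsub>Q\<^esub> mat_word Q m I L) (idx J n)"
    if "I \<in> lists J" "\<And>L. L \<in> idx J n \<Longrightarrow> c L \<in> carrier F" for c I n
    using that by (intro Q.M.finsum_cong' refl Pi_I Q.smult_closed mc) (simp_all add: mw)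
  have 2: "finsum Q (\<lambda>L. c L \<odot>\<^bsub>Q\<^esub> mat_word Q m' L I) (idx J n) = finsum Q (\<lambda>L. c L \<odot>\<^bsub>Q\<^esub> mat_word Q m L I) (idx J n)"
    if "I \<in> lists J" "\<And>L. L \<in> idx J n \<Longrightarrow> c L \<in> carrier F" for c I n
    using that by (intro Q.M.finsum_cong' refl Pi_I Q.smult_closed mc) (simp_all add: mw)
  have oc: "tcoord (t w) I (ops w (tbase K)) \<in> carrier F"
    if "w \<in> \<Omega>" "I \<in> idx J (t w)" "K \<in> idx J (s w)" for w I K
    by (rule ops_tcoord_closed[where \<Omega> = \<Omega> and ops = ops and s = s and t = t, OF ops that])
  have "mat_eqs J \<Omega> s t (\<lambda>w I K. tcoord (t w) I (ops w (tbase K))) Q m'"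
    unfolding mat_eqs_def
  proof (intro ballI)
    fix w K I assume w: "w \<in> \<Omega>" and K: "K \<in> idx J (s w)" and I: "I \<in> idx J (t w)"
    have KI: "K \<in> lists J" "I \<in> lists J" using K I by simp_all
    have "finsum Q (\<lambda>L. tcoord (t w) L (ops w (tbase K)) \<odot>\<^bsub>Q\<^esub> mat_word Q m' I L) (idx J (t w))
        = finsum Q (\<lambda>L. tcoord (t w) L (ops w (tbase K)) \<odot>\<^bsub>Q\<^esub> mat_word Q m I L) (idx J (t w))"
      by (rule 1[OF KI(2) oc[OF w _ K]])
    also have "\<dots> = finsum Q (\<lambda>L. tcoord (t w) I (ops w (tbase L)) \<odot>\<^bsub>Q\<^esub> mat_word Q m L K) (idx J (s w))"
      using D(3) w K I unfolding mat_eqs_def by blast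
    also have "\<dots> = finsum Q (\<lambda>L. tcoord (t w) I (ops w (tbase L)) \<odot>\<^bsub>Q\<^esub> mat_word Q m' L K) (idx J (s w))"
      by (rule 2[OF KI(1) oc[OF w I], symmetric])
    finally show "finsum Q (\<lambda>L. tcoord (t w) L (ops w (tbase K)) \<odot>\<^bsub>Q\<^esub> mat_word Q m' I L) (idx J (t w)) =
      finsum Q (\<lambda>L. tcoord (t w) I (ops w (tbase L)) \<odot>\<^bsub>Q\<^esub> mat_word Q m' L K) (idx J (s w))" .
  qed
  moreover have "mat_op (\<lambda>i j. \<theta> (m' i j)) \<in> V" if \<theta>: "\<theta> \<in> carrier (dual F Q)" for \<theta>
  proof -
    have "mat_op (\<lambda>i j. \<theta> (m' i j)) = mat_op (\<lambda>i j. \<theta> (m i j))"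
      by (rule mat_op_cong) (simp_all add: eq dual_functional_closed[OF \<theta> D(2)])
    then show ?thesis using D(4)[OF \<theta>] by simp
  qed
  ultimately show ?thesis unfolding good_matrix_def using D(1,2) eq by simp
qed

lemma good_matrix_iff:
  assumes Q: "unital_algebra F Q" and \<rho>: "\<rho> \<in> lhom F A (tensor F A Q)"
    and ops: "\<And>w. w \<in> \<Omega> \<Longrightarrow> ops w \<in> lhom F (tpower F A (s w)) (tpower F A (t w))"
  shows "comeasuring F \<Omega> s t A ops Q \<rho> \<and> cosupp F A Q \<rho> \<subseteq> V \<longleftrightarrow>
    good_matrix \<Omega> s t ops V Q (\<lambda>i j. coord Q i (\<rho> (e j)))"
proof -
  have "comeasuring F \<Omega> s t A ops Q \<rho> \<longleftrightarrow>
      mat_eqs J \<Omega> s t (\<lambda>w I K. tcoord (t w) I (ops w (tbase K))) Q (\<lambda>i j. coord Q i (\<rho> (e j)))"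
    by (rule comeasuring_iff[OF Q \<rho> ops])
  then show ?thesis
    unfolding cosupp_eq[OF unital_algebra_vs[OF Q] \<rho>] good_matrix_def
    using Q mat_closed[OF Q \<rho>] by (simp add: image_subset_iff)
qed

text \<open>The equations only involve sums and products of entries, which may be computed in
  \<open>S\<close>. The cosupport condition now ranges over functionals on \<open>S\<close>; each
  extends to \<open>Q\<close> without changing its values on the entries, so no new operators
  arise.\<close>

lemma good_matrix_sub_algebra:
  assumes g: "good_matrix \<Omega> s t ops V Q m"
    and ops: "\<And>w. w \<in> \<Omega> \<Longrightarrow> ops w \<in> lhom F (tpower F A (s w)) (tpower F A (t w))"
    and S: "closed_subalgebra F Q S" and m: "\<And>i j. i \<in> J \<Longrightarrow> j \<in> J \<Longrightarrow> m i j \<in> S"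
  shows "good_matrix \<Omega> s t ops V (sub_algebra Q S) m"
proof -
  note D = good_matrixD[OF g]
  have oc: "tcoord (t w) I (ops w (tbase K)) \<in> carrier F"
    if "w \<in> \<Omega>" "I \<in> idx J (t w)" "K \<in> idx J (s w)" for w I K
    by (rule ops_tcoord_closed[where \<Omega> = \<Omega> and ops = ops and s = s and t = t, OF ops that])
  have "mat_op (\<lambda>i j. \<theta> (m i j)) \<in> V" if \<theta>: "\<theta> \<in> carrier (dual F (sub_algebra Q S))" for \<theta>
  proof -
    have \<theta>l: "\<theta> \<in> lhom F (sub_algebra Q S) (ground F)" using \<theta> by (simp add: dual_simps[OF F] linD)
    obtain \<theta>' where \<theta>': "\<theta>' \<in> carrier (dual F Q)" "\<And>x. x \<in> S \<Longrightarrow> \<theta>' x = \<theta> x"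
      by (rule extend_functional[OF unital_algebra_vs[OF D(1)] closed_subalgebraD(1)[OF S], of \<theta>])
        (use lhom_closed[OF \<theta>l] module_hom_add[OF \<theta>l] module_hom_smult[OF \<theta>l] in simp_all)
    have "mat_op (\<lambda>i j. \<theta> (m i j)) = mat_op (\<lambda>i j. \<theta>' (m i j))"
    proof (rule mat_op_cong)
      show "\<theta> (m i j) = \<theta>' (m i j)" if "i \<in> J" "j \<in> J" for i j using \<theta>'(2)[OF m[OF that]] by simp
      show "\<theta>' (m i j) \<in> carrier F" if "i \<in> J" "j \<in> J" for i j
        by (rule dual_functional_closed[OF \<theta>'(1) D(2)[OF that]])
    qed
    then show ?thesis using D(4)[OF \<theta>'(1)] by simp
  qed
  moreover have "mat_eqs J \<Omega> s t (\<lambda>w I K. tcoord (t w) I (ops w (tbase K))) (sub_algebra Q S) m"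
    by (rule iffD2[OF mat_eqs_sub_algebra[OF D(1) S m oc] D(3)])
  ultimately show ?thesis
    unfolding good_matrix_def using sub_algebra_unital[OF D(1) S] m by simp
qed

end

subsection \<open>Transposition\<close>

context dual_bases
begin

interpretation D: dual_bases F "dual F A" J d "\<lambda>i. eval_bidual F A (e i)"
  by (rule dual)

lemma eval_bij: "bij_betw (eval_bidual F A) (carrier A) (carrier (dual F (dual F A)))"
proof (rule bij_betw_imageI)
  show "inj_on (eval_bidual F A) (carrier A)"
  proof (rule inj_onI)
    fix a b assume a: "a \<in> carrier A" and b: "b \<in> carrier A" and eq: "eval_bidual F A a = eval_bidual F A b"
    show "a = b"
    proof (rule eqI[OF a b])
      show "d i a = d i b" if i: "i \<in> J" for i
        using eval_apply[OF a d_dual[OF i]] eval_apply[OF b d_dual[OF i]] eq by simp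
    qed
  qed
  show "eval_bidual F A ` carrier A = carrier (dual F (dual F A))"
  proof (intro equalityI subsetI)
    fix \<phi> assume \<phi>: "\<phi> \<in> carrier (dual F (dual F A))"
    have c: "\<phi> (d i) \<in> carrier F" if "i \<in> J" for i by (rule dual_functional_closed[OF \<phi> d_dual[OF that]])
    \<comment> \<open>The preimage must have \<open>\<phi> (d i)\<close> as its coordinates, since
      evaluation at it has to agree with \<open>\<phi>\<close> on each \<open>d i\<close>.\<close>
    let ?a = "finsum A (\<lambda>i. \<phi> (d i) \<odot>\<^bsub>A\<^esub> e i) J"
    have a: "?a \<in> carrier A" by (rule sum_closed[OF c])
    have "eval_bidual F A ?a = \<phi>"
    proof (rule D.dual_eqI[OF _ \<phi>])
      show "eval_bidual F A ?a \<in> carrier (dual F (dual F A))"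
        unfolding D.dual_lhom by (rule eval_lin[OF a])
      show "eval_bidual F A ?a (d i) = \<phi> (d i)" if i: "i \<in> J" for i
        unfolding eval_apply[OF a d_dual[OF i]] by (rule d_sum[OF i c])
    qed
    then show "\<phi> \<in> eval_bidual F A ` carrier A" using a by (intro image_eqI[of _ _ ?a]) simp_all
  next
    fix \<phi> assume "\<phi> \<in> eval_bidual F A ` carrier A"
    then show "\<phi> \<in> carrier (dual F (dual F A))" unfolding D.dual_lhom using eval_lin by (elim imageE) simp
  qed
qed

text \<open>In the basis \<open>d\<close> of the dual, the operator \<open>f\<close> has entry
  \<open>f (d j) (e i)\<close> in row \<open>i\<close> and column \<open>j\<close>; the matrix on
  the right is its transpose.\<close>

lemma sharp_eq:
  assumes V: "V \<subseteq> lin F (dual F A) (dual F A)"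
  shows "sharp F A V = (\<lambda>f. mat_op (\<lambda>i j. f (d i) (e j))) ` V"
  unfolding sharp_def
proof (rule image_cong[OF refl])
  fix f assume "f \<in> V"
  then have f: "f \<in> lhom F (dual F A) (dual F A)" using V linD by blast
  let ?g = "\<lambda>a. inv_into (carrier A) (eval_bidual F A) (dual_map F (dual F A) (dual F A) f (eval_bidual F A a))"
  have eq: "dual_map F (dual F A) (dual F A) f (eval_bidual F A a)
      = (\<lambda>\<phi>\<in>carrier (dual F A). eval_bidual F A a (f \<phi>))" if a: "a \<in> carrier A" for a
  proof -
    have "eval_bidual F A a \<in> carrier (dual F (dual F A))" unfolding D.dual_lhom by (rule eval_lin[OF a])
    then show ?thesis by (simp add: dual_map_def compose_def)
  qed
  have im: "dual_map F (dual F A) (dual F A) f (eval_bidual F A a) \<in> eval_bidual F A ` carrier A"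
    if a: "a \<in> carrier A" for a
    unfolding bij_betw_imp_surj_on[OF eval_bij] eq[OF a] D.dual_lhom
    by (rule lin_restrict[OF D.vs lhom_comp[OF f linD[OF eval_lin[OF a]]]])
  have gA: "?g a \<in> carrier A" if "a \<in> carrier A" for a by (rule inv_into_into[OF im[OF that]])
  \<comment> \<open>The coordinate \<open>d i\<close> of a vector is its evaluation functional
    applied to \<open>d i\<close>. This cancels the inverse of the evaluation isomorphism.\<close>
  have gd: "d i (?g a) = f (d i) a" if i: "i \<in> J" and a: "a \<in> carrier A" for a i
  proof -
    have "d i (?g a) = eval_bidual F A (?g a) (d i)" by (rule eval_apply[OF gA[OF a] d_dual[OF i], symmetric])
    also have "\<dots> = dual_map F (dual F A) (dual F A) f (eval_bidual F A a) (d i)"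
      by (simp only: f_inv_into_f[OF im[OF a]])
    also have "\<dots> = eval_bidual F A a (f (d i))"
      by (simp only: eq[OF a] restrict_apply' d_dual[OF i])
    also have "\<dots> = f (d i) a" by (rule eval_apply[OF a lhom_closed[OF f d_dual[OF i]]])
    finally show ?thesis .
  qed
  show "(\<lambda>a\<in>carrier A. ?g a) = mat_op (\<lambda>i j. f (d i) (e j))"
  proof (rule mat_op_unique)
    have "?g \<in> lhom F A A"
    proof (rule lhom_coordI[OF vs gA])
      fix i assume i: "i \<in> J"
      have l: "(\<lambda>a. f (d i) a) \<in> lhom F A (ground F)"
        using lhom_closed[OF f d_dual[OF i]] by (simp add: dual_lhom linD)
      show "(\<lambda>a. d i (?g a)) \<in> lhom F A (ground F)"
        by (rule iffD2[OF lhom_cong[OF vs gd[OF i]] l])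
    qed
    then show "(\<lambda>a\<in>carrier A. ?g a) \<in> lin F A A" by (rule lin_restrict[OF vs])
    show "d i ((\<lambda>a\<in>carrier A. ?g a) (e j)) = f (d i) (e j)" if i: "i \<in> J" and j: "j \<in> J" for i j
      using gd[OF i e_closed[OF j]] e_closed[OF j] by simp
  qed
qed

lemma dual_mat_op_eq:
  assumes f: "f \<in> lin F (dual F A) (dual F A)"
  shows "f = D.mat_op (\<lambda>i j. f (d j) (e i))"
  by (rule D.mat_op_unique[OF f])
    (rule eval_apply[OF e_closed lhom_closed[OF linD[OF f] d_dual]])

text \<open>Membership in \<open>sharp F A V\<close> only yields some \<open>f\<close> in
  \<open>V\<close> with the right image. Comparing entries identifies \<open>f\<close> with
  \<open>D.mat_op M\<close>, which is the injectivity of passing to the dual operator.\<close>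

lemma mat_op_sharp_iff:
  assumes V: "V \<subseteq> lin F (dual F A) (dual F A)" and M: "\<And>i j. i \<in> J \<Longrightarrow> j \<in> J \<Longrightarrow> M i j \<in> carrier F"
  shows "mat_op (\<lambda>i j. M j i) \<in> sharp F A V \<longleftrightarrow> D.mat_op M \<in> V"
proof
  have M': "M j i \<in> carrier F" if "i \<in> J" "j \<in> J" for i j using M that by simp
  have DM: "D.mat_op M \<in> lin F (dual F A) (dual F A)" by (intro D.mat_op_lin M)
  assume "D.mat_op M \<in> V"
  then have "mat_op (\<lambda>i j. D.mat_op M (d i) (e j)) \<in> sharp F A V" unfolding sharp_eq[OF V] by (rule imageI)
  moreover have "mat_op (\<lambda>i j. D.mat_op M (d i) (e j)) = mat_op (\<lambda>i j. M j i)"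
  proof (rule mat_op_cong[OF _ M'])
    fix i j assume i: "i \<in> J" and j: "j \<in> J"
    have "D.mat_op M (d i) (e j) = eval_bidual F A (e j) (D.mat_op M (d i))"
      by (rule eval_apply[OF e_closed[OF j] lhom_closed[OF linD[OF DM] d_dual[OF i]], symmetric])
    also have "\<dots> = M j i" by (intro D.mat_op_entry M i j)
    finally show "D.mat_op M (d i) (e j) = M j i" .
  qed
  ultimately show "mat_op (\<lambda>i j. M j i) \<in> sharp F A V" by simp
next
  have M': "M j i \<in> carrier F" if "i \<in> J" "j \<in> J" for i j using M that by simp
  assume "mat_op (\<lambda>i j. M j i) \<in> sharp F A V"
  then obtain f where f: "f \<in> V" and eq: "mat_op (\<lambda>i j. M j i) = mat_op (\<lambda>i j. f (d i) (e j))"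
    unfolding sharp_eq[OF V] by (elim imageE)
  have fl: "f \<in> lin F (dual F A) (dual F A)" using f V by blast
  have fF: "f (d i) (e j) \<in> carrier F" if "i \<in> J" "j \<in> J" for i j
    by (rule dual_functional_closed[OF lhom_closed[OF linD[OF fl] d_dual[OF that(1)]] e_closed[OF that(2)]])
  have entry: "f (d j) (e i) = M i j" if i: "i \<in> J" and j: "j \<in> J" for i j
  proof -
    have "M i j = d j (mat_op (\<lambda>i j. M j i) (e i))" by (rule mat_op_entry[OF M' j i, symmetric])
    also have "\<dots> = d j (mat_op (\<lambda>i j. f (d i) (e j)) (e i))" by (simp only: eq)
    also have "\<dots> = f (d j) (e i)" by (rule mat_op_entry[OF fF j i])
    finally show ?thesis by (rule sym)
  qed
  have "f = D.mat_op (\<lambda>i j. f (d j) (e i))" by (rule dual_mat_op_eq[OF fl])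
  also have "\<dots> = D.mat_op M" by (rule D.mat_op_cong[OF entry M])
  finally show "D.mat_op M \<in> V" using f by simp
qed

lemma good_matrix_transpose:
  assumes V: "V \<subseteq> lin F (dual F A) (dual F A)"
    and ops: "\<And>w. w \<in> \<Omega> \<Longrightarrow> ops w \<in> lhom F (tpower F A (s w)) (tpower F A (t w))"
  shows "D.good_matrix \<Omega> t s (dual_ops F s t A ops) V Q (\<lambda>i j. m j i) \<longleftrightarrow>
    good_matrix \<Omega> s t ops (sharp F A V) Q m"
\<comment> \<open>Both predicates contain these conditions, with the indices renamed, so they fail
  together.\<close>
proof (cases "unital_algebra F Q \<and> (\<forall>i\<in>J. \<forall>j\<in>J. m i j \<in> carrier Q)")
  case False
  then show ?thesis unfolding good_matrix_def D.good_matrix_def by blast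
next
  case True
  then have Q: "unital_algebra F Q" and m: "\<And>i j. i \<in> J \<Longrightarrow> j \<in> J \<Longrightarrow> m i j \<in> carrier Q" by simp_all
  interpret Q: unital_algebra F Q by (rule Q)
  have eqs: "mat_eqs J \<Omega> t s (\<lambda>w I K. D.tcoord (s w) I (dual_ops F s t A ops w (D.tbase K))) Q (\<lambda>i j. m j i)
    \<longleftrightarrow> mat_eqs J \<Omega> s t (\<lambda>w I K. tcoord (t w) I (ops w (tbase K))) Q m"
    by (rule mat_eqs_transpose[OF Q.vectorspace_axioms Q.Q.ring_axioms m ops_tcoord_closed[OF ops]
          dual_ops_tcoord[of ops w s t for w, OF ops]])
  have supp: "D.mat_op (\<lambda>i j. \<theta> (m j i)) \<in> V \<longleftrightarrow> mat_op (\<lambda>i j. \<theta> (m i j)) \<in> sharp F A V"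
    if \<theta>: "\<theta> \<in> carrier (dual F Q)" for \<theta>
    by (rule mat_op_sharp_iff[OF V dual_functional_closed[OF \<theta> m], symmetric])
  show ?thesis
    unfolding good_matrix_def D.good_matrix_def eqs using Q m supp by simp
qed

end

section \<open>Universal coacting bialgebras\<close>

lemma is_bialgebraD:
  assumes "is_bialgebra F B"
  shows "unital_algebra F B" "comult B \<in> lhom F B (tensor F B B)" "counit B \<in> lhom F B (ground F)"
    "comult B \<in> ring_hom B (tensor_algebra F B B)" "counit B \<in> ring_hom B F"
  using assms by (simp_all only: is_bialgebra_def)

lemma tensor_assoc:
  assumes U: "vectorspace F U" and V: "vectorspace F V" and W: "vectorspace F W"
  shows tensor_assoc_lhom: "tensor_assoc F U V W
      \<in> lhom F (tensor F (tensor F U V) W) (tensor F U (tensor F V W))"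
    and tensor_assoc_pure: "\<And>u v w. u \<in> carrier U \<Longrightarrow> v \<in> carrier V \<Longrightarrow> w \<in> carrier W \<Longrightarrow>
      tensor_assoc F U V W (pure_tensor F (tensor F U V) W (pure_tensor F U V u v) w)
        = pure_tensor F U (tensor F V W) u (pure_tensor F V W v w)"
proof -
  let ?T = "tensor F U (tensor F V W)"
  note VW = tensor_vs[OF V W] and UV = tensor_vs[OF U V]
  note T = tensor_vs[OF U VW]
  let ?\<beta> = "\<lambda>u v w. pure_tensor F U (tensor F V W) u (pure_tensor F V W v w)"
  note p1 = pure_tensor_bilin[OF U VW] and p2 = pure_tensor_bilin[OF V W]
  have b: "bilin F U V ?T (\<lambda>u v. ?\<beta> u v w)" if w: "w \<in> carrier W" for w
    by (rule bilin_comp[OF p1 lhom_id bilin_left[OF p2 w] lhom_id])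
  have l: "?\<beta> u v \<in> lhom F W ?T" if "u \<in> carrier U" "v \<in> carrier V" for u v
    by (rule lhom_comp[OF bilin_right[OF p2 that(2)] bilin_right[OF p1 that(1)]])
  have outer: "bilin F (tensor F U V) W ?T (\<lambda>x w. tensor_lift F U V ?T (\<lambda>u v. ?\<beta> u v w) x)"
    by (intro bilinI tensor_lift_param[OF U V T W b l] tensor_lift_lhom[OF U V T b])
  show "tensor_assoc F U V W \<in> lhom F (tensor F (tensor F U V) W) ?T"
    unfolding tensor_assoc_def Let_def by (rule tensor_lift_lhom[OF UV W T outer])
  show "tensor_assoc F U V W (pure_tensor F (tensor F U V) W (pure_tensor F U V u v) w) = ?\<beta> u v w"
    if u: "u \<in> carrier U" and v: "v \<in> carrier V" and w: "w \<in> carrier W" for u v w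
    unfolding tensor_assoc_def Let_def
      tensor_lift_pure[OF UV W T outer pure_tensor_closed[OF U V u v] w]
    by (rule tensor_lift_pure[OF U V T b[OF w] u v])
qed

text \<open>Contraction of the first factor does not see how the others are bracketed. It makes the
  coassociativity axiom of a coaction readable in coefficients.\<close>

lemma contract_assoc:
  assumes U: "vectorspace F U" and V: "vectorspace F V" and W: "vectorspace F W"
    and \<phi>: "\<phi> \<in> lhom F U (ground F)" and z: "z \<in> carrier (tensor F (tensor F U V) W)"
  shows "contract F U (tensor F V W) \<phi> (tensor_assoc F U V W z)
    = tensor_map F (tensor F U V) W V W (contract F U V \<phi>) (\<lambda>w. w) z"
proof -
  note UV = tensor_vs[OF U V] and VW = tensor_vs[OF V W]
  note c = contract_lhom[OF U V \<phi>] and c' = contract_lhom[OF U VW \<phi>]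
  note a = tensor_assoc_lhom[OF U V W]
  note t = tensor_map[OF UV W V W c lhom_id]
  show ?thesis
  proof (rule tensor_eqI[OF UV W VW lhom_comp[OF a c'] t(1) _ z])
    fix x w assume x: "x \<in> carrier (tensor F U V)" and w: "w \<in> carrier W"
    show "contract F U (tensor F V W) \<phi> (tensor_assoc F U V W (pure_tensor F (tensor F U V) W x w))
      = tensor_map F (tensor F U V) W V W (contract F U V \<phi>) (\<lambda>w. w) (pure_tensor F (tensor F U V) W x w)"
      unfolding t(2)[OF x w]
    proof (rule tensor_eqI[OF U V VW _ _ _ x])
      show "(\<lambda>x. contract F U (tensor F V W) \<phi> (tensor_assoc F U V W (pure_tensor F (tensor F U V) W x w)))
          \<in> lhom F (tensor F U V) (tensor F V W)"
        by (rule lhom_comp[OF bilin_left[OF pure_tensor_bilin[OF UV W] w] lhom_comp[OF a c']])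
      show "(\<lambda>x. pure_tensor F V W (contract F U V \<phi> x) w) \<in> lhom F (tensor F U V) (tensor F V W)"
        by (rule lhom_comp[OF c bilin_left[OF pure_tensor_bilin[OF V W] w]])
      fix u v assume u: "u \<in> carrier U" and v: "v \<in> carrier V"
      have f: "\<phi> u \<in> carrier F" using lhom_closed[OF \<phi> u] by simp
      show "contract F U (tensor F V W) \<phi> (tensor_assoc F U V W (pure_tensor F (tensor F U V) W (pure_tensor F U V u v) w))
        = pure_tensor F V W (contract F U V \<phi> (pure_tensor F U V u v)) w"
        unfolding tensor_assoc_pure[OF U V W u v w] contract_pure[OF U V \<phi> u v]
          contract_pure[OF U VW \<phi> u pure_tensor_closed[OF V W v w]]
        by (rule module_hom_smult[OF bilin_left[OF pure_tensor_bilin[OF V W] w] f v, symmetric])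
    qed
  qed
qed

text \<open>Interpreted twice in the end: for \<open>A\<close> itself, and for its dual with the
  arities exchanged.\<close>

locale universal_coacting = dual_bases F A J e d
  for F :: "('f, 'm) ring_scheme" and A :: "('f, 'a, 'n) module_scheme"
    and J :: "'i set" and e :: "'i \<Rightarrow> 'a" and d :: "'i \<Rightarrow> 'a \<Rightarrow> 'f" +
  fixes \<Omega> :: "'w set" and s t :: "'w \<Rightarrow> nat"
    and ops :: "'w \<Rightarrow> ('f, 'a) tpower_elem \<Rightarrow> ('f, 'a) tpower_elem" and V :: "('a \<Rightarrow> 'a) set"
    and B :: "('f, 'q) bialgebra" and \<rho> :: "'a \<Rightarrow> ('f, 'a, 'q) tensor_elem"
  assumes ops: "\<And>w. w \<in> \<Omega> \<Longrightarrow> ops w \<in> lhom F (tpower F A (s w)) (tpower F A (t w))"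
    and universal: "universal_coacting_bialgebra F \<Omega> s t A ops V B \<rho>"
begin

lemma coaction: "coaction F \<Omega> s t A ops B \<rho>"
  using universal by (simp only: universal_coacting_bialgebra_def)

lemma bialgebra: "is_bialgebra F B"
  using coaction by (simp only: coaction_def)

lemma unital: "unital_algebra F B"
  by (rule is_bialgebraD(1)[OF bialgebra])

lemma comeasuring: "comeasuring F \<Omega> s t A ops B \<rho>"
  using coaction by (simp only: coaction_def)

lemma \<rho>_lhom: "\<rho> \<in> lhom F A (tensor F A B)"
  using comeasuring by (simp only: comeasuring_def)

abbreviation coeff where "coeff i j \<equiv> coord B i (\<rho> (e j))"

lemma coeff_good: "good_matrix \<Omega> s t ops V B coeff"
  by (rule iffD1[OF good_matrix_iff[OF unital \<rho>_lhom ops]])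
    (use universal comeasuring in \<open>simp_all only: universal_coacting_bialgebra_def\<close>)

lemma coeff_closed: "i \<in> J \<Longrightarrow> j \<in> J \<Longrightarrow> coeff i j \<in> carrier B"
  by (rule mat_closed[OF unital \<rho>_lhom])

text \<open>The coassociativity axiom at \<open>e j\<close>, contracted with \<open>d k\<close>. The
  side with \<open>comult B\<close> gives the left-hand side by naturality; the side with two
  coactions gives the sum, after \<open>\<rho> (e j)\<close> is expanded in the basis.\<close>

lemma comult_coeff:
  assumes k: "k \<in> J" and j: "j \<in> J"
  shows "comult B (coeff k j) =
    finsum (tensor F B B) (\<lambda>i. pure_tensor F B B (coeff k i) (coeff i j)) J"
proof -
  note B = unital_algebra_vs[OF unital]
  note \<Delta> = is_bialgebraD(2)[OF bialgebra]
  note BB = tensor_vs[OF B B] and AB = tensor_vs[OF vs B]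
  interpret BB: vectorspace F "tensor F B B" by (rule BB)
  note z = lhom_closed[OF \<rho>_lhom e_closed[OF j]]
  note dk = d_lhom[OF k]
  note c = contract_lhom[OF vs B dk]
  note t = tensor_map[OF vs B AB B \<rho>_lhom lhom_id]
  note t' = tensor_map[OF AB B B B c lhom_id]
  have ax: "tensor_assoc F A B B (tensor_map F A B (tensor F A B) B \<rho> (\<lambda>b. b) (\<rho> (e j))) =
      tensor_map F A B A (tensor F B B) (\<lambda>a. a) (comult B) (\<rho> (e j))"
    using coaction e_closed[OF j] unfolding coaction_def by blast
  have "comult B (coeff k j) = contract F A (tensor F B B) (d k)
      (tensor_map F A B A (tensor F B B) (\<lambda>a. a) (comult B) (\<rho> (e j)))"
    by (rule contract_map[OF vs vs B BB lhom_id \<Delta> dk z, symmetric])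
  also have "\<dots> = contract F A (tensor F B B) (d k)
      (tensor_assoc F A B B (tensor_map F A B (tensor F A B) B \<rho> (\<lambda>b. b) (\<rho> (e j))))"
    by (simp only: ax)
  also have "\<dots> = tensor_map F (tensor F A B) B B B (coord B k) (\<lambda>w. w)
      (tensor_map F A B (tensor F A B) B \<rho> (\<lambda>b. b) (\<rho> (e j)))"
    by (rule contract_assoc[OF vs B B dk lhom_closed[OF t(1) z]])
  also have "\<dots> = tensor_map F (tensor F A B) B B B (coord B k) (\<lambda>w. w)
      (tensor_map F A B (tensor F A B) B \<rho> (\<lambda>b. b) (finsum (tensor F A B) (\<lambda>i. pure_tensor F A B (e i) (coeff i j)) J))"
    using tensor_expand[OF B z] by simp
  also have "\<dots> = finsum (tensor F B B) (\<lambda>i. tensor_map F (tensor F A B) B B B (coord B k) (\<lambda>w. w)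
      (tensor_map F A B (tensor F A B) B \<rho> (\<lambda>b. b) (pure_tensor F A B (e i) (coeff i j)))) J"
    by (rule lhom_finsum[OF AB BB lhom_comp[OF t(1) t'(1)]])
      (rule pure_tensor_closed[OF vs B e_closed coeff_closed[OF _ j]])
  also have "\<dots> = finsum (tensor F B B) (\<lambda>i. pure_tensor F B B (coeff k i) (coeff i j)) J"
  proof (rule BB.M.finsum_cong'[OF refl])
    show "(\<lambda>i. pure_tensor F B B (coeff k i) (coeff i j)) \<in> J \<rightarrow> carrier (tensor F B B)"
      by (intro Pi_I pure_tensor_closed[OF B B] coeff_closed k j)
    fix i assume i: "i \<in> J"
    show "tensor_map F (tensor F A B) B B B (coord B k) (\<lambda>w. w)
        (tensor_map F A B (tensor F A B) B \<rho> (\<lambda>b. b) (pure_tensor F A B (e i) (coeff i j)))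
      = pure_tensor F B B (coeff k i) (coeff i j)"
      unfolding t(2)[OF e_closed[OF i] coeff_closed[OF i j]]
      by (rule t'(2)[OF lhom_closed[OF \<rho>_lhom e_closed[OF i]] coeff_closed[OF i j]])
  qed
  finally show ?thesis .
qed

text \<open>The counit axiom at \<open>e j\<close>, with the counit in the place of the functional
  \<open>\<theta>\<close> of \<open>d_contract_functional\<close>.\<close>

lemma counit_coeff:
  assumes i: "i \<in> J" and j: "j \<in> J"
  shows "counit B (coeff i j) = (if i = j then \<one>\<^bsub>F\<^esub> else \<zero>\<^bsub>F\<^esub>)"
proof -
  have "tensor_lift F A B A (\<lambda>a' b. counit B b \<odot>\<^bsub>A\<^esub> a') (\<rho> (e j)) = e j"
    using coaction e_closed[OF j] unfolding coaction_def by blast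
  then show ?thesis
    using d_contract_functional[OF unital_algebra_vs[OF unital] is_bialgebraD(3)[OF bialgebra] i
        lhom_closed[OF \<rho>_lhom e_closed[OF j]]] d_e[OF i j] by simp
qed

text \<open>Initiality in the language of matrices: \<open>mat_coact\<close> makes a test
  comeasuring out of \<open>m\<close>, and the morphism condition becomes entrywise.\<close>

lemma hom_exists:
  fixes Q :: "('f, 'q) module"
  assumes g: "good_matrix \<Omega> s t ops V Q m"
  shows "\<exists>!\<phi>. \<phi> \<in> algebra_hom F B Q \<and> (\<forall>i\<in>J. \<forall>j\<in>J. \<phi> (coeff i j) = m i j)"
proof -
  note D = good_matrixD[OF g]
  note Q = unital_algebra_vs[OF D(1)] and B = unital_algebra_vs[OF unital]
  let ?\<sigma> = "mat_coact Q m"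
  have \<sigma>: "?\<sigma> \<in> lhom F A (tensor F A Q)" by (rule mat_coact_lhom[OF Q D(2)])
  have c: "coord Q i (?\<sigma> (e j)) = m i j" if "i \<in> J" "j \<in> J" for i j
    by (rule coord_mat_coact[OF Q D(2) that])
  have "comeasuring F \<Omega> s t A ops Q ?\<sigma> \<and> cosupp F A Q ?\<sigma> \<subseteq> V \<longleftrightarrow>
      good_matrix \<Omega> s t ops V Q (\<lambda>i j. coord Q i (?\<sigma> (e j)))"
    by (rule good_matrix_iff[OF D(1) \<sigma> ops])
  moreover have "good_matrix \<Omega> s t ops V Q (\<lambda>i j. coord Q i (?\<sigma> (e j)))"
    by (rule good_matrix_cong[OF g c ops])
  ultimately have "comeasuring F \<Omega> s t A ops Q ?\<sigma> \<and> cosupp F A Q ?\<sigma> \<subseteq> V" by simp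
  then have ex: "\<exists>!\<phi>. \<phi> \<in> algebra_hom F B Q \<and>
      (\<forall>a\<in>carrier A. tensor_map F A B A Q (\<lambda>a. a) \<phi> (\<rho> a) = ?\<sigma> a)"
    using universal unfolding universal_coacting_bialgebra_def by blast
  have "(\<phi> \<in> algebra_hom F B Q \<and> (\<forall>a\<in>carrier A. tensor_map F A B A Q (\<lambda>a. a) \<phi> (\<rho> a) = ?\<sigma> a)) \<longleftrightarrow>
      (\<phi> \<in> algebra_hom F B Q \<and> (\<forall>i\<in>J. \<forall>j\<in>J. \<phi> (coeff i j) = m i j))" for \<phi>
  proof (rule conj_cong[OF refl])
    assume "\<phi> \<in> algebra_hom F B Q"
    then have \<phi>: "\<phi> \<in> lhom F B Q" by (simp add: algebra_hom_def linD)
    show "(\<forall>a\<in>carrier A. tensor_map F A B A Q (\<lambda>a. a) \<phi> (\<rho> a) = ?\<sigma> a) \<longleftrightarrow>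
        (\<forall>i\<in>J. \<forall>j\<in>J. \<phi> (coeff i j) = m i j)"
      unfolding tensor_map_hom_iff[OF B Q \<phi> \<rho>_lhom \<sigma>] using c by simp
  qed
  then show ?thesis using ex by simp
qed

text \<open>Initiality applied to the subalgebra \<open>S\<close> and to \<open>B\<close> itself: the inclusion of \<open>S\<close> has a section.\<close>

lemma generated:
  assumes S: "closed_subalgebra F B S" and m: "\<And>i j. i \<in> J \<Longrightarrow> j \<in> J \<Longrightarrow> coeff i j \<in> S"
  shows "S = carrier B"
proof -
  let ?B = "sub_algebra B (carrier B)"
  note B = unital
  interpret B: unital_algebra F B by (rule B)
  note SB = closed_subalgebraD(2)[OF S]
  have gS: "good_matrix \<Omega> s t ops V (sub_algebra B S) coeff"
    by (rule good_matrix_sub_algebra[OF coeff_good ops S m])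
  have gB: "good_matrix \<Omega> s t ops V ?B coeff"
    by (rule good_matrix_sub_algebra[OF coeff_good ops closed_subalgebra_carrier[OF B] coeff_closed])
  obtain \<phi> where \<phi>: "\<phi> \<in> algebra_hom F B (sub_algebra B S)" "\<forall>i\<in>J. \<forall>j\<in>J. \<phi> (coeff i j) = coeff i j"
    using ex1_implies_ex[OF hom_exists[OF gS]] by (elim exE conjE)
  have \<phi>S: "\<phi> b \<in> S" if "b \<in> carrier B" for b
    using lhom_closed[of \<phi> F B "sub_algebra B S" b] \<phi>(1) that by (simp add: algebra_hom_def linD)
  \<comment> \<open>The same function, now with the target enlarged to \<open>B\<close>, competes
    with the identity in the uniqueness part of initiality.\<close>
  have \<phi>B: "\<phi> \<in> algebra_hom F B ?B"
    using \<phi>(1) SB unfolding algebra_hom_def lin_def module_hom_def ring_hom_def by (simp add: Pi_iff subset_iff)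
  \<comment> \<open>The identity has to be restricted to the carrier, because
    \<open>algebra_hom\<close> only contains maps that are \<open>undefined\<close> outside
    it.\<close>
  have "(\<lambda>b\<in>carrier B. b) \<in> algebra_hom F B ?B"
    unfolding algebra_hom_def lin_def module_hom_def ring_hom_def by simp
  moreover have "\<forall>i\<in>J. \<forall>j\<in>J. (\<lambda>b\<in>carrier B. b) (coeff i j) = coeff i j"
    using coeff_closed by simp
  ultimately have "\<phi> = (\<lambda>b\<in>carrier B. b)" using hom_exists[OF gB] \<phi>B \<phi>(2) by blast
  then have "b \<in> S" if "b \<in> carrier B" for b using \<phi>S[OF that] that by simp
  then show ?thesis using SB by blast
qed

text \<open>The set where \<open>f\<close> and \<open>g\<close> agree is a closed subalgebra
  containing all coefficients, hence everything. All identities of the final isomorphism are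
  obtained from this.\<close>

lemma hom_ext:
  assumes f: "f \<in> lhom F B T" "f \<in> ring_hom B T" and g: "g \<in> lhom F B T" "g \<in> ring_hom B T"
    and eq: "\<And>i j. i \<in> J \<Longrightarrow> j \<in> J \<Longrightarrow> f (coeff i j) = g (coeff i j)"
    and b: "b \<in> carrier B"
  shows "f b = g b"
proof -
  have "{b \<in> carrier B. f b = g b} = carrier B"
    by (rule generated[OF closed_subalgebra_equalizer[OF unital f g]])
      (simp add: eq coeff_closed)
  then show ?thesis using b by blast
qed

end

section \<open>Multiplicativity in tensor product algebras\<close>

lemma tensor_algebra_simps [simp]:
  "carrier (tensor_algebra F P Q) = carrier (tensor F P Q)" "add (tensor_algebra F P Q) = add (tensor F P Q)"
  "smult (tensor_algebra F P Q) = smult (tensor F P Q)" "zero (tensor_algebra F P Q) = zero (tensor F P Q)"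
  "one (tensor_algebra F P Q) = pure_tensor F P Q \<one>\<^bsub>P\<^esub> \<one>\<^bsub>Q\<^esub>"
  by (simp_all add: tensor_algebra_def)

lemma lhom_tensor_algebra: "lhom F V (tensor_algebra F P Q) = lhom F V (tensor F P Q)"
  by (simp add: module_hom_def)

lemma tensor_algebra_mult:
  assumes P: "unital_algebra F P" and Q: "unital_algebra F Q"
  shows tensor_mult_bilin: "bilin F (tensor F P Q) (tensor F P Q) (tensor F P Q) (mult (tensor_algebra F P Q))"
    and tensor_mult_pure: "\<And>a b c d. a \<in> carrier P \<Longrightarrow> b \<in> carrier Q \<Longrightarrow> c \<in> carrier P \<Longrightarrow> d \<in> carrier Q \<Longrightarrow>
      pure_tensor F P Q a b \<otimes>\<^bsub>tensor_algebra F P Q\<^esub> pure_tensor F P Q c d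
        = pure_tensor F P Q (a \<otimes>\<^bsub>P\<^esub> c) (b \<otimes>\<^bsub>Q\<^esub> d)"
proof -
  note Pv = unital_algebra_vs[OF P] and Qv = unital_algebra_vs[OF Q]
  note T = tensor_vs[OF Pv Qv] and p = pure_tensor_bilin[OF Pv Qv]
  let ?\<beta> = "\<lambda>a b c d. pure_tensor F P Q (a \<otimes>\<^bsub>P\<^esub> c) (b \<otimes>\<^bsub>Q\<^esub> d)"
  have b1: "bilin F P Q (tensor F P Q) (?\<beta> a b)" if "a \<in> carrier P" "b \<in> carrier Q" for a b
    by (rule bilin_comp[OF p bilin_right[OF mult_bilin[OF P] that(1)] bilin_right[OF mult_bilin[OF Q] that(2)] lhom_id])
  have b2: "bilin F P Q (tensor F P Q) (\<lambda>a b. ?\<beta> a b c d)" if "c \<in> carrier P" "d \<in> carrier Q" for c d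
    by (rule bilin_comp[OF p bilin_left[OF mult_bilin[OF P] that(1)] bilin_left[OF mult_bilin[OF Q] that(2)] lhom_id])
  have m: "mult (tensor_algebra F P Q) = (\<lambda>x y. tensor_lift F P Q (tensor F P Q) (\<lambda>a b.
      tensor_lift F P Q (tensor F P Q) (?\<beta> a b) y) x)"
    by (simp add: tensor_algebra_def)
  show "bilin F (tensor F P Q) (tensor F P Q) (tensor F P Q) (mult (tensor_algebra F P Q))"
    unfolding m by (rule tensor_lift_nested_bilin[OF Pv Qv Pv Qv T b1 b2])
  show "pure_tensor F P Q a b \<otimes>\<^bsub>tensor_algebra F P Q\<^esub> pure_tensor F P Q c d = ?\<beta> a b c d"
    if "a \<in> carrier P" "b \<in> carrier Q" "c \<in> carrier P" "d \<in> carrier Q" for a b c d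
    unfolding m by (rule tensor_lift_nested_pure[OF Pv Qv Pv Qv T b1 b2 that])
qed

text \<open>Both sides of the multiplicativity law are bilinear in the two tensors, so it is enough
  to test it on pure tensors in each argument.\<close>

lemma tensor_algebra_hom:
  assumes P: "unital_algebra F P" and Q: "unital_algebra F Q" and P': "unital_algebra F P'" and Q': "unital_algebra F Q'"
    and h: "h \<in> lhom F (tensor F P Q) (tensor F P' Q')"
    and one: "h (pure_tensor F P Q \<one>\<^bsub>P\<^esub> \<one>\<^bsub>Q\<^esub>) = pure_tensor F P' Q' \<one>\<^bsub>P'\<^esub> \<one>\<^bsub>Q'\<^esub>"
    and mult: "\<And>a b c d. a \<in> carrier P \<Longrightarrow> b \<in> carrier Q \<Longrightarrow> c \<in> carrier P \<Longrightarrow> d \<in> carrier Q \<Longrightarrow>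
      h (pure_tensor F P Q (a \<otimes>\<^bsub>P\<^esub> c) (b \<otimes>\<^bsub>Q\<^esub> d))
        = h (pure_tensor F P Q a b) \<otimes>\<^bsub>tensor_algebra F P' Q'\<^esub> h (pure_tensor F P Q c d)"
  shows "h \<in> ring_hom (tensor_algebra F P Q) (tensor_algebra F P' Q')"
proof -
  note Pv = unital_algebra_vs[OF P] and Qv = unital_algebra_vs[OF Q]
  note T' = tensor_vs[OF unital_algebra_vs[OF P'] unital_algebra_vs[OF Q']]
  note m = tensor_mult_bilin[OF P Q] and m' = tensor_mult_bilin[OF P' Q']
  note hc = lhom_closed[OF h]
  have "h (x \<otimes>\<^bsub>tensor_algebra F P Q\<^esub> y) = h x \<otimes>\<^bsub>tensor_algebra F P' Q'\<^esub> h y"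
    if x: "x \<in> carrier (tensor F P Q)" and y: "y \<in> carrier (tensor F P Q)" for x y
  proof (rule tensor_eqI[OF Pv Qv T' _ _ _ x])
    show "(\<lambda>x. h (x \<otimes>\<^bsub>tensor_algebra F P Q\<^esub> y)) \<in> lhom F (tensor F P Q) (tensor F P' Q')"
      by (rule lhom_comp[OF bilin_left[OF m y] h])
    show "(\<lambda>x. h x \<otimes>\<^bsub>tensor_algebra F P' Q'\<^esub> h y) \<in> lhom F (tensor F P Q) (tensor F P' Q')"
      by (rule lhom_comp[OF h bilin_left[OF m' hc[OF y]]])
    fix a b assume a: "a \<in> carrier P" and b: "b \<in> carrier Q"
    note ab = pure_tensor_closed[OF Pv Qv a b]
    show "h (pure_tensor F P Q a b \<otimes>\<^bsub>tensor_algebra F P Q\<^esub> y)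
      = h (pure_tensor F P Q a b) \<otimes>\<^bsub>tensor_algebra F P' Q'\<^esub> h y"
    proof (rule tensor_eqI[OF Pv Qv T' _ _ _ y])
      show "(\<lambda>y. h (pure_tensor F P Q a b \<otimes>\<^bsub>tensor_algebra F P Q\<^esub> y)) \<in> lhom F (tensor F P Q) (tensor F P' Q')"
        by (rule lhom_comp[OF bilin_right[OF m ab] h])
      show "(\<lambda>y. h (pure_tensor F P Q a b) \<otimes>\<^bsub>tensor_algebra F P' Q'\<^esub> h y) \<in> lhom F (tensor F P Q) (tensor F P' Q')"
        by (rule lhom_comp[OF h bilin_right[OF m' hc[OF ab]]])
      show "h (pure_tensor F P Q a b \<otimes>\<^bsub>tensor_algebra F P Q\<^esub> pure_tensor F P Q c d)
          = h (pure_tensor F P Q a b) \<otimes>\<^bsub>tensor_algebra F P' Q'\<^esub> h (pure_tensor F P Q c d)"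
        if c: "c \<in> carrier P" and d: "d \<in> carrier Q" for c d
        unfolding tensor_mult_pure[OF P Q a b c d] by (rule mult[OF a b c d])
    qed
  qed
  then show ?thesis
    by (intro ring_hom_memI) (simp_all add: hc module_hom_add[OF h] one)
qed

lemma tensor_flip_ring_hom:
  assumes P: "unital_algebra F P" and Q: "unital_algebra F Q"
  shows "tensor_flip F P Q \<in> ring_hom (tensor_algebra F P Q) (tensor_algebra F Q P)"
proof -
  interpret P: unital_algebra F P by (rule P)
  interpret Q: unital_algebra F Q by (rule Q)
  note v = P.vectorspace_axioms Q.vectorspace_axioms
  note fp = tensor_flip_pure[OF v]
  show ?thesis
  proof (rule tensor_algebra_hom[OF P Q Q P tensor_flip_lhom[OF v]])
    fix a b c d assume "a \<in> carrier P" "b \<in> carrier Q" "c \<in> carrier P" "d \<in> carrier Q"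
    then show "tensor_flip F P Q (pure_tensor F P Q (a \<otimes>\<^bsub>P\<^esub> c) (b \<otimes>\<^bsub>Q\<^esub> d)) = tensor_flip F P Q (pure_tensor F P Q a b)
        \<otimes>\<^bsub>tensor_algebra F Q P\<^esub> tensor_flip F P Q (pure_tensor F P Q c d)"
      by (simp add: fp tensor_mult_pure[OF Q P])
  qed (simp add: fp)
qed

lemma tensor_map_ring_hom:
  assumes P: "unital_algebra F P" and Q: "unital_algebra F Q"
    and f: "f \<in> lhom F P Q" "f \<in> ring_hom P Q"
  shows "tensor_map F P P Q Q f f \<in> ring_hom (tensor_algebra F P P) (tensor_algebra F Q Q)"
proof -
  interpret P: unital_algebra F P by (rule P)
  interpret Q: unital_algebra F Q by (rule Q)
  note t = tensor_map[OF P.vectorspace_axioms P.vectorspace_axioms Q.vectorspace_axioms Q.vectorspace_axioms f(1) f(1)]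
  show ?thesis
  proof (rule tensor_algebra_hom[OF P P Q Q t(1)])
    fix a b c d assume "a \<in> carrier P" "b \<in> carrier P" "c \<in> carrier P" "d \<in> carrier P"
    then show "tensor_map F P P Q Q f f (pure_tensor F P P (a \<otimes>\<^bsub>P\<^esub> c) (b \<otimes>\<^bsub>P\<^esub> d))
        = tensor_map F P P Q Q f f (pure_tensor F P P a b) \<otimes>\<^bsub>tensor_algebra F Q Q\<^esub>
          tensor_map F P P Q Q f f (pure_tensor F P P c d)"
      by (simp add: t(2) tensor_mult_pure[OF Q Q] ring_hom_mult[OF f(2)] lhom_closed[OF f(1)])
  qed (simp add: t(2) ring_hom_one[OF f(2)])
qed

section \<open>The isomorphism onto the co-opposite bialgebra\<close>

lemma tensor_cop:
  "tensor F (cop F C) (cop F C) = tensor F C C" "pure_tensor F (cop F C) (cop F C) = pure_tensor F C C"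
  by (simp_all add: tensor_def tensor_rels_def cop_def pure_tensor_def[abs_def])

text \<open>Each algebra, with the transposed coefficients of its own coaction, is a test object for
  the other one. Initiality on both sides gives maps in both directions, and generation by
  coefficients does the rest.\<close>

lemma (in dual_bases) universal_dual_iso:
  fixes \<Omega> :: "'w set" and s t :: "'w \<Rightarrow> nat"
    and ops :: "'w \<Rightarrow> ('f, 'a) tpower_elem \<Rightarrow> ('f, 'a) tpower_elem"
    and B C :: "('f, 'q) bialgebra"
  assumes ops: "\<And>w. w \<in> \<Omega> \<Longrightarrow> ops w \<in> lhom F (tpower F A (s w)) (tpower F A (t w))"
    and V: "V \<subseteq> lin F (dual F A) (dual F A)"
    and UB: "universal_coacting_bialgebra F \<Omega> t s (dual F A) (dual_ops F s t A ops) V B \<rho>"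
    and UC: "universal_coacting_bialgebra F \<Omega> s t A ops (sharp F A V) C \<sigma>"
  shows "\<exists>\<phi>. \<phi> \<in> bialgebra_iso F B (cop F C)"
proof -
  have dops: "dual_ops F s t A ops w \<in> lhom F (tpower F (dual F A) (t w)) (tpower F (dual F A) (s w))"
    if "w \<in> \<Omega>" for w
    by (rule dual_ops_lhom[where w = w and ops = ops and s = s and t = t, OF ops[OF that]])
  interpret B: universal_coacting F "dual F A" J d "\<lambda>i. eval_bidual F A (e i)" \<Omega> t s "dual_ops F s t A ops" V B \<rho>
    by (intro universal_coacting.intro dual universal_coacting_axioms.intro dops UB)
  interpret C: universal_coacting F A J e d \<Omega> s t ops "sharp F A V" C \<sigma>
    by (intro universal_coacting.intro dual_bases_axioms universal_coacting_axioms.intro ops UC)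
  \<comment> \<open>Copies of \<open>B\<close> and \<open>C\<close> as plain \<open>module\<close>
    records, in which form they can be inserted into the two initiality statements.\<close>
  let ?B = "sub_algebra B (carrier B)" and ?C = "sub_algebra C (carrier C)"
  have transpose: "B.good_matrix \<Omega> t s (dual_ops F s t A ops) V Q (\<lambda>i j. m j i) \<longleftrightarrow>
      good_matrix \<Omega> s t ops (sharp F A V) Q m" for Q :: "('f, 'q) bialgebra" and m
    by (rule good_matrix_transpose[OF V ops])
  have "B.good_matrix \<Omega> t s (dual_ops F s t A ops) V C (\<lambda>i j. C.coeff j i)"
    unfolding transpose by (rule C.coeff_good)
  then have gC: "B.good_matrix \<Omega> t s (dual_ops F s t A ops) V ?C (\<lambda>i j. C.coeff j i)"
    by (rule B.good_matrix_sub_algebra[OF _ dops closed_subalgebra_carrier[OF C.unital] C.coeff_closed])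
  have "good_matrix \<Omega> s t ops (sharp F A V) B (\<lambda>i j. B.coeff j i)"
    unfolding transpose[symmetric] by (rule B.coeff_good)
  then have gB: "good_matrix \<Omega> s t ops (sharp F A V) ?B (\<lambda>i j. B.coeff j i)"
    by (rule good_matrix_sub_algebra[OF _ ops closed_subalgebra_carrier[OF B.unital] B.coeff_closed])
  obtain \<phi> where \<phi>: "\<phi> \<in> algebra_hom F B C" "\<And>i j. i \<in> J \<Longrightarrow> j \<in> J \<Longrightarrow> \<phi> (B.coeff i j) = C.coeff j i"
    using ex1_implies_ex[OF B.hom_exists[OF gC]] unfolding algebra_hom_sub_algebra_carrier by blast
  obtain \<psi> where \<psi>: "\<psi> \<in> algebra_hom F C B" "\<And>i j. i \<in> J \<Longrightarrow> j \<in> J \<Longrightarrow> \<psi> (C.coeff i j) = B.coeff j i"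
    using ex1_implies_ex[OF C.hom_exists[OF gB]] unfolding algebra_hom_sub_algebra_carrier by blast
  have \<phi>h: "\<phi> \<in> lhom F B C" "\<phi> \<in> ring_hom B C" and \<psi>h: "\<psi> \<in> lhom F C B" "\<psi> \<in> ring_hom C B"
    using \<phi>(1) \<psi>(1) by (simp_all add: algebra_hom_def linD)
  have id_hom: "(\<lambda>x. x) \<in> ring_hom P P" for P :: "('f, 'q) bialgebra" by (simp add: ring_hom_def)
  have comp_hom: "(\<lambda>x. g (f x)) \<in> ring_hom P R"
    if "f \<in> ring_hom P Q" "g \<in> ring_hom Q R" for f g P Q R
    using ring_hom_trans[OF that] by (simp add: comp_def)
  \<comment> \<open>The two transpositions of indices cancel, so the composite fixes every
    coefficient and agrees with the identity by \<open>hom_ext\<close>.\<close>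
  have \<psi>\<phi>: "\<psi> (\<phi> b) = b" if "b \<in> carrier B" for b
    by (rule B.hom_ext[OF lhom_comp[OF \<phi>h(1) \<psi>h(1)] comp_hom[OF \<phi>h(2) \<psi>h(2)] lhom_id id_hom _ that])
      (simp add: \<phi>(2) \<psi>(2))
  have \<phi>\<psi>: "\<phi> (\<psi> c) = c" if "c \<in> carrier C" for c
    by (rule C.hom_ext[OF lhom_comp[OF \<psi>h(1) \<phi>h(1)] comp_hom[OF \<psi>h(2) \<phi>h(2)] lhom_id id_hom _ that])
      (simp add: \<phi>(2) \<psi>(2))
  have bij: "bij_betw \<phi> (carrier B) (carrier C)"
    by (rule bij_betw_byWitness[where f' = \<psi>])
      (use \<psi>\<phi> \<phi>\<psi> lhom_closed[OF \<phi>h(1)] lhom_closed[OF \<psi>h(1)] in auto)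
  note Bv = unital_algebra_vs[OF B.unital] and Cv = unital_algebra_vs[OF C.unital]
  note \<phi>2 = tensor_map[OF Bv Bv Cv Cv \<phi>h(1) \<phi>h(1)]
  \<comment> \<open>Both sides are linear and multiplicative in \<open>b\<close> as maps into
    \<open>tensor_algebra F C C\<close>, so they are compared on coefficients. For
    \<open>B.coeff k j\<close> each becomes the sum over \<open>i\<close> of
    \<open>C.coeff i k \<otimes> C.coeff j i\<close>, the left side because the flip exchanges the
    factors of \<open>C.coeff j i \<otimes> C.coeff i k\<close>.\<close>
  have comult: "tensor_flip F C C (comult C (\<phi> b)) = tensor_map F B B C C \<phi> \<phi> (comult B b)"
    if b: "b \<in> carrier B" for b
  proof (rule B.hom_ext[where T = "tensor_algebra F C C", unfolded lhom_tensor_algebra, OF _ _ _ _ _ b])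
    show "(\<lambda>b. tensor_flip F C C (comult C (\<phi> b))) \<in> lhom F B (tensor F C C)"
      by (rule lhom_comp[OF lhom_comp[OF \<phi>h(1) is_bialgebraD(2)[OF C.bialgebra]] tensor_flip_lhom[OF Cv Cv]])
    show "(\<lambda>b. tensor_flip F C C (comult C (\<phi> b))) \<in> ring_hom B (tensor_algebra F C C)"
      by (rule comp_hom[OF comp_hom[OF \<phi>h(2) is_bialgebraD(4)[OF C.bialgebra]] tensor_flip_ring_hom[OF C.unital C.unital]])
    show "(\<lambda>b. tensor_map F B B C C \<phi> \<phi> (comult B b)) \<in> lhom F B (tensor F C C)"
      by (rule lhom_comp[OF is_bialgebraD(2)[OF B.bialgebra] \<phi>2(1)])
    show "(\<lambda>b. tensor_map F B B C C \<phi> \<phi> (comult B b)) \<in> ring_hom B (tensor_algebra F C C)"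
      by (rule comp_hom[OF is_bialgebraD(4)[OF B.bialgebra] tensor_map_ring_hom[OF B.unital C.unital \<phi>h]])
    fix k j assume k: "k \<in> J" and j: "j \<in> J"
    interpret CC: vectorspace F "tensor F C C" by (rule tensor_vs[OF Cv Cv])
    note BB = tensor_vs[OF Bv Bv]
    let ?s = "finsum (tensor F C C) (\<lambda>i. pure_tensor F C C (C.coeff i k) (C.coeff j i)) J"
    have s: "(\<lambda>i. pure_tensor F C C (C.coeff i k) (C.coeff j i)) \<in> J \<rightarrow> carrier (tensor F C C)"
      by (intro Pi_I pure_tensor_closed[OF Cv Cv] C.coeff_closed k j)
    have "tensor_flip F C C (comult C (\<phi> (B.coeff k j)))
        = tensor_flip F C C (finsum (tensor F C C) (\<lambda>i. pure_tensor F C C (C.coeff j i) (C.coeff i k)) J)"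
      using C.comult_coeff[OF j k] \<phi>(2)[OF k j] by simp
    also have "\<dots> = finsum (tensor F C C) (\<lambda>i. tensor_flip F C C (pure_tensor F C C (C.coeff j i) (C.coeff i k))) J"
      by (rule lhom_finsum[OF CC.vectorspace_axioms CC.vectorspace_axioms tensor_flip_lhom[OF Cv Cv]])
        (intro pure_tensor_closed[OF Cv Cv] C.coeff_closed k j)
    also have "\<dots> = ?s"
      by (rule CC.M.finsum_cong'[OF refl s]) (intro tensor_flip_pure[OF Cv Cv] C.coeff_closed k j)
    also have "?s = finsum (tensor F C C) (\<lambda>i. tensor_map F B B C C \<phi> \<phi> (pure_tensor F B B (B.coeff k i) (B.coeff i j))) J"
    proof (rule CC.M.finsum_cong'[OF refl, symmetric, OF s])
      fix i assume i: "i \<in> J"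
      show "tensor_map F B B C C \<phi> \<phi> (pure_tensor F B B (B.coeff k i) (B.coeff i j)) = pure_tensor F C C (C.coeff i k) (C.coeff j i)"
        unfolding \<phi>2(2)[OF B.coeff_closed[OF k i] B.coeff_closed[OF i j]] \<phi>(2)[OF k i] \<phi>(2)[OF i j] by (rule refl)
    qed
    also have "\<dots> = tensor_map F B B C C \<phi> \<phi> (finsum (tensor F B B) (\<lambda>i. pure_tensor F B B (B.coeff k i) (B.coeff i j)) J)"
      by (rule lhom_finsum[OF BB CC.vectorspace_axioms \<phi>2(1), symmetric])
        (intro pure_tensor_closed[OF Bv Bv] B.coeff_closed k j)
    also have "\<dots> = tensor_map F B B C C \<phi> \<phi> (comult B (B.coeff k j))"
      using B.comult_coeff[OF k j] by simp
    finally show "tensor_flip F C C (comult C (\<phi> (B.coeff k j))) = tensor_map F B B C C \<phi> \<phi> (comult B (B.coeff k j))" .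
  qed
  \<comment> \<open>The counit is a ring map into \<open>F\<close> but a linear map into
    \<open>ground F\<close>. Comparing maps by \<open>hom_ext\<close> needs a single target, and
    both records have the same ring operations.\<close>
  have ground_hom: "ring_hom P (ground F) = ring_hom P F" for P :: "('f, 'q) bialgebra"
    by (simp add: ring_hom_def)
  have counit: "counit C (\<phi> b) = counit B b" if b: "b \<in> carrier B" for b
  proof (rule B.hom_ext[where T = "ground F", unfolded ground_hom, OF _ _ _ _ _ b])
    show "(\<lambda>b. counit C (\<phi> b)) \<in> lhom F B (ground F)" by (rule lhom_comp[OF \<phi>h(1) is_bialgebraD(3)[OF C.bialgebra]])
    show "(\<lambda>b. counit C (\<phi> b)) \<in> ring_hom B F" by (rule comp_hom[OF \<phi>h(2) is_bialgebraD(5)[OF C.bialgebra]])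
    show "counit B \<in> lhom F B (ground F)" by (rule is_bialgebraD(3)[OF B.bialgebra])
    show "counit B \<in> ring_hom B F" by (rule is_bialgebraD(5)[OF B.bialgebra])
    fix i j assume i: "i \<in> J" and j: "j \<in> J"
    show "counit C (\<phi> (B.coeff i j)) = counit B (B.coeff i j)"
      using B.counit_coeff[OF i j] C.counit_coeff[OF j i]
        \<phi>(2)[OF i j] by simp
  qed
  have "\<phi> \<in> algebra_hom F B (cop F C)"
    using \<phi>(1) by (simp add: algebra_hom_def lin_def module_hom_def ring_hom_def cop_def)
  \<comment> \<open>\<open>cop\<close> alters only the field \<open>comult\<close>, which the tensor
    constructions never inspect.\<close>
  moreover have "tensor_map F B B (cop F C) (cop F C) \<phi> \<phi> = tensor_map F B B C C \<phi> \<phi>"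
    by (simp add: tensor_map_def tensor_cop)
  ultimately have "\<phi> \<in> bialgebra_iso F B (cop F C)"
    using bij comult counit by (simp add: bialgebra_iso_def) (simp add: cop_def)
  then show ?thesis by blast
qed

theorem theorem4p18:
  fixes F :: "('f, 'm) ring_scheme"
    and \<Omega> :: "'w set" and s t :: "'w \<Rightarrow> nat"
    and A :: "('f, 'a) module"
    and ops :: "'w \<Rightarrow> ('f, 'a) tpower_elem \<Rightarrow> ('f, 'a) tpower_elem"
    and V :: "(('a \<Rightarrow> 'f) \<Rightarrow> ('a \<Rightarrow> 'f)) set"
    and B C :: "('f, 'q) bialgebra"
    and \<rho> :: "('a \<Rightarrow> 'f) \<Rightarrow> ('f, 'a \<Rightarrow> 'f, 'q) tensor_elem"
    and \<sigma> :: "'a \<Rightarrow> ('f, 'a, 'q) tensor_elem"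
  assumes "field F"
    and "omega_algebra F \<Omega> s t A ops"
    and "vectorspace.fin_dim F A"
    and "unital_subalgebra F V (End_algebra F (dual F A))"
    and "universal_coacting_bialgebra F \<Omega> t s (dual F A) (dual_ops F s t A ops) V B \<rho>"
    and "universal_coacting_bialgebra F \<Omega> s t A ops (sharp F A V) C \<sigma>"
  shows "\<exists>\<phi>. \<phi> \<in> bialgebra_iso F B (cop F C)"
proof -
  have A: "vectorspace F A" and ops: "\<And>w. w \<in> \<Omega> \<Longrightarrow> ops w \<in> lhom F (tpower F A (s w)) (tpower F A (t w))"
    using assms(2) by (simp_all add: omega_algebra_def)
  \<comment> \<open>The basis vectors serve as their own indices, so the index family is the
    identity and \<open>J\<close> is the basis itself.\<close>
  obtain J d where "dual_bases F A J (\<lambda>x. x) d"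
    using vectorspace.dual_bases_exist[OF A assms(3)] by blast
  then show ?thesis
    by (rule dual_bases.universal_dual_iso[OF _ ops lin_End[OF assms(4)] assms(5,6)])
qed

end
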